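(* Let $q=2$. Let $A=\begin{pmatrix}a_{11} & a_{12} \\ a_{21} & 0\end{pmatrix}$ with entries in $\mathbb{C}_\infty$, $\operatorname{ord}a_{11}=-1$, $a_{21}\neq0$, and put $v=\operatorname{ord}a_{21}$ and $t=\operatorname{ord}\left(\frac{\theta^2}{a_{21}}+\frac{\theta^4}{a_{21}^4}-a_{12}^2\right)$. If $-\frac43<v<-\frac13$ and $t\ge-4v-6$, then $h^1(M(A))=4$.
   Context: Let $q=2$ and $\theta$ a variable. $\mathbb{C}_\infty$ is the completion of an algebraic closure of the completion of $\mathbb{F}_q(\theta)$ at the valuation at infinity $\operatorname{ord}$, normalized by $\operatorname{ord}\theta=-1$ (and $\operatorname{ord}0=+\infty$). $\mathbb{C}_\infty[T,\tau]$ is the ring of non-commutative polynomials with relations $Ta=aT$, $T\tau=\tau T$, $\tau a=a^q\tau$ for $a\in\mathbb{C}_\infty$; $\mathbb{C}_\infty\{\tau\}$ is the subring generated over $\mathbb{C}_\infty$ by $\tau$. For a $2\times2$ matrix $A$ over $\mathbb{C}_\infty$, $M(A)$ is the left $\mathbb{C}_\infty[T,\tau]$-module (Anderson t-motive of dimension 2 and rank 4) which is free over $\mathbb{C}_\infty\{\tau\}$ with basis $e_1,e_2$, where multiplication by $T$ is given, for the column $e_*=(e_1,e_2)^t$, by $Te_*=\theta e_*+A\tau e_*+\tau^2e_*$. It is free of rank 4 over $\mathbb{C}_\infty[T]$. $\mathbb{C}_\infty\{T\}$ is the ring of power series $\sum_{i\ge0}a_iT^i$ with $a_i\in\mathbb{C}_\infty$,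 $a_i\to0$, on which $\tau$ acts by $\tau(\sum a_iT^i)=\sum a_i^qT^i$. On $M\otimes_{\mathbb{C}_\infty[T]}\mathbb{C}_\infty\{T\}$, $\tau$ acts by $\tau(m\otimes f)=\tau(m)\otimes\tau(f)$. $H^1(M)$ is the $\mathbb{F}_q[T]$-module of $\tau$-invariant elements of $M\otimes_{\mathbb{C}_\infty[T]}\mathbb{C}_\infty\{T\}$; it is free, and $h^1(M)$ is its rank over $\mathbb{F}_q[T]$. *)

theory Defs
  imports
    "HOL-Analysis.Analysis"
    "HOL-Computational_Algebra.Computational_Algebra"
    "HOL-Algebra.Free_Abelian_Groups"
begin

section \<open>The field \<open>C\<^sub>\<infinity>\<close>\<close>

text \<open>Everything is for \<open>q = 2\<close>; inside a field of characteristic 2 the prime field is \<open>{0, 1}\<close>,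
  and \<open>F2_poly\<close> is the polynomial ring over it, as a subset of the polynomials over the big field.\<close>

definition F2_poly :: "'c::field poly set"
  where "F2_poly = {p. \<forall>i. coeff p i \<in> {0, 1}}"

definition F2_rat :: "'c::field \<Rightarrow> 'c set"
  where "F2_rat \<theta> = {poly p \<theta> / poly r \<theta> | p r. p \<in> F2_poly \<and> r \<in> F2_poly \<and> poly r \<theta> \<noteq> 0}"

definition val_tendsto :: "('c::field \<Rightarrow> ereal) \<Rightarrow> (nat \<Rightarrow> 'c) \<Rightarrow> 'c \<Rightarrow> bool"
  where "val_tendsto ord X x \<longleftrightarrow> (\<lambda>n. ord (X n - x)) \<longlonglongrightarrow> \<infinity>"

definition val_Cauchy :: "('c::field \<Rightarrow> ereal) \<Rightarrow> (nat \<Rightarrow> 'c) \<Rightarrow> bool"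
  where "val_Cauchy ord X \<longleftrightarrow> (\<forall>B::real. \<exists>N. \<forall>m\<ge>N. \<forall>n\<ge>N. ereal B < ord (X m - X n))"

definition val_closure :: "('c::field \<Rightarrow> ereal) \<Rightarrow> 'c set \<Rightarrow> 'c set"
  where "val_closure ord S = {x. \<exists>X. (\<forall>n. X n \<in> S) \<and> val_tendsto ord X x}"

definition algebraic_elements :: "'c::field set \<Rightarrow> 'c set"
  where "algebraic_elements K = {x. \<exists>p. p \<noteq> 0 \<and> (\<forall>i. coeff p i \<in> K) \<and> poly p x = 0}"

text \<open>A field with a valuation \<open>ord\<close> is \<open>C\<^sub>\<infinity>\<close> when it is the last term of the chain
  \<open>F\<^sub>2(\<theta>) \<subseteq> K\<^sub>\<infinity> \<subseteq> Kbar \<subseteq> C\<^sub>\<infinity>\<close>, realised inside it: the closure \<open>K\<^sub>\<infinity>\<close> of \<open>F\<^sub>2(\<theta>)\<close>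
  (its completion, since the big field is complete), the field \<open>Kbar\<close> of elements algebraic
  over \<open>K\<^sub>\<infinity>\<close>, required to be algebraically closed (so it is an algebraic closure of \<open>K\<^sub>\<infinity>\<close>), and
  the big field, complete and containing \<open>Kbar\<close> densely. These conditions determine the field
  with its valuation and \<open>\<theta>\<close> up to isomorphism. Given the valuation axioms and
  characteristic 2, \<open>ord \<theta> = -1\<close> forces \<open>ord p(\<theta>) = - deg p\<close> for all nonzero \<open>p\<close> in \<open>F\<^sub>2[X]\<close>: so
  \<open>\<theta>\<close> is transcendental and \<open>ord\<close> restricts to the valuation at infinity on \<open>F\<^sub>2(\<theta>)\<close>.\<close>

locale C_infinity =
  fixes ord :: "'c::field \<Rightarrow> ereal" and \<theta> :: 'c
  assumes ord_zero: "ord 0 = \<infinity>"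
    and ord_finite: "x \<noteq> 0 \<Longrightarrow> \<bar>ord x\<bar> \<noteq> \<infinity>"
    and ord_mult: "ord (x * y) = ord x + ord y"
    and ord_add: "min (ord x) (ord y) \<le> ord (x + y)"
    and char_two: "CHAR('c) = 2"
    and ord_theta: "ord \<theta> = -1"
    and complete: "val_Cauchy ord X \<Longrightarrow> \<exists>x. val_tendsto ord X x"
    and alg_closed: "\<lbrakk>degree p > 0; \<And>i. coeff p i \<in> algebraic_elements (val_closure ord (F2_rat \<theta>))\<rbrakk>
      \<Longrightarrow> \<exists>x \<in> algebraic_elements (val_closure ord (F2_rat \<theta>)). poly p x = 0"
    and dense: "val_closure ord (algebraic_elements (val_closure ord (F2_rat \<theta>))) = UNIV"


section \<open>The t-motive \<open>M(A)\<close>\<close>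

text \<open>The free module over \<open>C\<^sub>\<infinity>{\<tau>}\<close> with basis \<open>e\<^sub>1, e\<^sub>2\<close>: the vector \<open>m\<close> stands for
  \<open>\<Sum>\<^sub>i \<Sum>\<^sub>k coeff (m $ i) k \<tau>\<^sup>k e\<^sub>i\<close>. The type \<open>'c poly\<close> only stores the coefficients of a
  noncommutative polynomial in \<open>\<tau>\<close> (written on the left); its commutative product is not used here.\<close>

type_synonym 'c motive = "'c poly ^ 2"

definition M_scale :: "'c::field \<Rightarrow> 'c motive \<Rightarrow> 'c motive"
  where "M_scale a m = (\<chi> i. smult a (m $ i))"

text \<open>Left multiplication by \<open>\<tau>\<close>: \<open>\<tau> a \<tau>\<^sup>k = a\<^sup>2 \<tau>\<^sup>k\<^sup>+\<^sup>1\<close>.\<close>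

definition M_tau :: "'c::field motive \<Rightarrow> 'c motive"
  where "M_tau m = (\<chi> i. pCons 0 (map_poly (\<lambda>a. a ^ 2) (m $ i)))"

definition M_basis :: "2 \<Rightarrow> 'c::field motive"
  where "M_basis i = axis i 1"

definition M_T_basis :: "'c::field \<Rightarrow> 'c ^ 2 ^ 2 \<Rightarrow> 2 \<Rightarrow> 'c motive"
  where "M_T_basis \<theta> A i =
    M_scale \<theta> (M_basis i) + (\<Sum>j\<in>UNIV. M_scale (A $ i $ j) (M_tau (M_basis j)))
      + M_tau (M_tau (M_basis i))"

text \<open>As \<open>T\<close> commutes with \<open>\<tau>\<close> and with scalars,
  \<open>T (\<Sum> c\<^sub>i\<^sub>k \<tau>\<^sup>k e\<^sub>i) = \<Sum> c\<^sub>i\<^sub>k \<tau>\<^sup>k (T e\<^sub>i)\<close>.\<close>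

definition M_T :: "'c::field \<Rightarrow> 'c ^ 2 ^ 2 \<Rightarrow> 'c motive \<Rightarrow> 'c motive"
  where "M_T \<theta> A m =
    (\<Sum>i\<in>UNIV. \<Sum>k\<le>degree (m $ i). M_scale (coeff (m $ i) k) ((M_tau ^^ k) (M_T_basis \<theta> A i)))"

definition M_poly :: "'c::field \<Rightarrow> 'c ^ 2 ^ 2 \<Rightarrow> 'c poly \<Rightarrow> 'c motive \<Rightarrow> 'c motive"
  where "M_poly \<theta> A p m = (\<Sum>k\<le>degree p. M_scale (coeff p k) ((M_T \<theta> A ^^ k) m))"


section \<open>Extension of scalars to \<open>C\<^sub>\<infinity>{T}\<close>\<close>

definition tate :: "('c::field \<Rightarrow> ereal) \<Rightarrow> 'c fps set"
  where "tate ord = {f. val_tendsto ord (fps_nth f) 0}"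

definition tate_tau :: "'c::field fps \<Rightarrow> 'c fps"
  where "tate_tau f = Abs_fps (\<lambda>i. fps_nth f i ^ 2)"

text \<open>The tensor product of \<open>M(A)\<close> and \<open>C\<^sub>\<infinity>{T}\<close> over \<open>C\<^sub>\<infinity>[T]\<close> is the free abelian group on
  symbols \<open>(m, f)\<close> modulo the subgroup generated by the bilinearity and balancing relations;
  its elements are cosets.\<close>

definition tensor_free :: "('c::field \<Rightarrow> ereal) \<Rightarrow> ('c motive \<times> 'c fps \<Rightarrow>\<^sub>0 int) monoid"
  where "tensor_free ord = free_Abelian_group (UNIV \<times> tate ord)"

definition tensor_rels ::
    "('c::field \<Rightarrow> ereal) \<Rightarrow> 'c \<Rightarrow> 'c ^ 2 ^ 2 \<Rightarrow> ('c motive \<times> 'c fps \<Rightarrow>\<^sub>0 int) set"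
  where "tensor_rels ord \<theta> A =
      {frag_of (m + m', f) - frag_of (m, f) - frag_of (m', f) | m m' f. f \<in> tate ord}
    \<union> {frag_of (m, f + f') - frag_of (m, f) - frag_of (m, f') | m f f'. f \<in> tate ord \<and> f' \<in> tate ord}
    \<union> {frag_of (M_poly \<theta> A p m, f) - frag_of (m, fps_of_poly p * f) | p m f. f \<in> tate ord}"

definition tensor_null ::
    "('c::field \<Rightarrow> ereal) \<Rightarrow> 'c \<Rightarrow> 'c ^ 2 ^ 2 \<Rightarrow> ('c motive \<times> 'c fps \<Rightarrow>\<^sub>0 int) set"
  where "tensor_null ord \<theta> A = generate (tensor_free ord) (tensor_rels ord \<theta> A)"

definition tensor ::
    "('c::field \<Rightarrow> ereal) \<Rightarrow> 'c \<Rightarrow> 'c ^ 2 ^ 2 \<Rightarrow> ('c motive \<times> 'c fps \<Rightarrow>\<^sub>0 int) set monoid"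
  where "tensor ord \<theta> A = tensor_free ord Mod tensor_null ord \<theta> A"

text \<open>The map on cosets induced by \<open>m \<otimes> f \<mapsto> g m \<otimes> h f\<close>. The union runs over the representatives
  of a coset; when the map is compatible with the relations, it is the single coset of the image of
  any of them.\<close>

definition tensor_map ::
    "('c::field \<Rightarrow> ereal) \<Rightarrow> 'c \<Rightarrow> 'c ^ 2 ^ 2 \<Rightarrow> ('c motive \<Rightarrow> 'c motive) \<Rightarrow> ('c fps \<Rightarrow> 'c fps)
      \<Rightarrow> ('c motive \<times> 'c fps \<Rightarrow>\<^sub>0 int) set \<Rightarrow> ('c motive \<times> 'c fps \<Rightarrow>\<^sub>0 int) set"
  where "tensor_map ord \<theta> A g h X =
    (\<Union>x\<in>X. tensor_null ord \<theta> A #>\<^bsub>tensor_free ord\<^esub> frag_extend (\<lambda>(m, f). frag_of (g m, h f)) x)"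

definition tensor_tau ::
    "('c::field \<Rightarrow> ereal) \<Rightarrow> 'c \<Rightarrow> 'c ^ 2 ^ 2
      \<Rightarrow> ('c motive \<times> 'c fps \<Rightarrow>\<^sub>0 int) set \<Rightarrow> ('c motive \<times> 'c fps \<Rightarrow>\<^sub>0 int) set"
  where "tensor_tau ord \<theta> A = tensor_map ord \<theta> A M_tau tate_tau"

definition tensor_poly ::
    "('c::field \<Rightarrow> ereal) \<Rightarrow> 'c \<Rightarrow> 'c ^ 2 ^ 2 \<Rightarrow> 'c poly
      \<Rightarrow> ('c motive \<times> 'c fps \<Rightarrow>\<^sub>0 int) set \<Rightarrow> ('c motive \<times> 'c fps \<Rightarrow>\<^sub>0 int) set"
  where "tensor_poly ord \<theta> A p = tensor_map ord \<theta> A id (\<lambda>f. fps_of_poly p * f)"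


section \<open>\<open>H\<^sup>1\<close> and its rank\<close>

definition H1 ::
    "('c::field \<Rightarrow> ereal) \<Rightarrow> 'c \<Rightarrow> 'c ^ 2 ^ 2 \<Rightarrow> ('c motive \<times> 'c fps \<Rightarrow>\<^sub>0 int) set set"
  where "H1 ord \<theta> A = {X \<in> carrier (tensor ord \<theta> A). tensor_tau ord \<theta> A X = X}"

text \<open>\<open>b\<^sub>0, \<dots>, b\<^sub>n\<^sub>-\<^sub>1\<close> is a basis of \<open>H\<^sup>1\<close> over \<open>F\<^sub>2[T]\<close>. The group \<open>tensor\<close> is written
  multiplicatively in \<open>HOL-Algebra\<close>, so \<open>finprod\<close> is the linear combination \<open>\<Sum> c\<^sub>i b\<^sub>i\<close>.\<close>

definition is_H1_basis ::
    "('c::field \<Rightarrow> ereal) \<Rightarrow> 'c \<Rightarrow> 'c ^ 2 ^ 2 \<Rightarrow> nat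
      \<Rightarrow> (nat \<Rightarrow> ('c motive \<times> 'c fps \<Rightarrow>\<^sub>0 int) set) \<Rightarrow> bool"
  where "is_H1_basis ord \<theta> A n b \<longleftrightarrow>
    b \<in> {..<n} \<rightarrow> H1 ord \<theta> A \<and>
    (\<forall>x \<in> H1 ord \<theta> A. \<exists>!c. c \<in> {..<n} \<rightarrow>\<^sub>E F2_poly \<and>
       x = finprod (tensor ord \<theta> A) (\<lambda>i. tensor_poly ord \<theta> A (c i) (b i)) {..<n})"

definition h1 :: "('c::field \<Rightarrow> ereal) \<Rightarrow> 'c \<Rightarrow> 'c ^ 2 ^ 2 \<Rightarrow> nat"
  where "h1 ord \<theta> A = (THE n. \<exists>b. is_H1_basis ord \<theta> A n b)"

end

theory Submission
  imports Defs
begin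

text \<open>
  In the coordinates of the basis \<open>e\<^sub>1, e\<^sub>2, \<tau> e\<^sub>1, \<tau> e\<^sub>2\<close> over \<open>C\<^sub>\<infinity>{T}\<close>, a \<open>\<tau>\<close>-invariant element is
  determined by the coefficients of \<open>\<tau> e\<^sub>1, \<tau> e\<^sub>2\<close>, a sequence of points \<open>z\<^sub>n = (x\<^sub>n, y\<^sub>n)\<close> of \<open>C\<^sub>\<infinity>\<^sup>2\<close>
  that tends to \<open>0\<close> and satisfies \<open>\<Phi> z\<^sub>n = z\<^sub>n\<^sub>-\<^sub>1\<^sup>4\<close> (componentwise power, \<open>z\<^sub>-\<^sub>1 = 0\<close>), where
  \<open>\<Phi> (x, y) = (x + \<theta>\<^sup>2 x\<^sup>4 + a\<^sub>1\<^sub>1 x\<^sup>2 + a\<^sub>2\<^sub>1 y\<^sup>2, y + \<theta>\<^sup>2 y\<^sup>4 + a\<^sub>1\<^sub>2 x\<^sup>2)\<close>. Evaluation at \<open>z\<^sub>0\<close> embeds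
  \<open>H\<^sup>1/T H\<^sup>1\<close> into \<open>ker \<Phi>\<close>, which has 16 elements; so the rank is 4 as soon as every element of
  \<open>ker \<Phi>\<close> is the beginning of a sequence that tends to \<open>0\<close>.

  The condition on \<open>t\<close> amounts to \<open>ord a\<^sub>1\<^sub>2 \<ge> -2v - 3\<close>. There is a polydisc \<open>U\<close> on which \<open>\<Phi> - id\<close> is
  contracting, so that \<open>\<Phi> z = r\<close> can be solved in \<open>U\<close> for \<open>r\<close> in \<open>U\<close>. On
  \<open>ker \<Phi>\<close> one has \<open>ord x \<ge> 1/2\<close> and \<open>ord y \<ge> -v/2\<close>. If \<open>v < -1/2\<close>, the fourth powers of such points
  lie in \<open>U\<close>, and the sequence continues inside \<open>U\<close> and converges. If \<open>v \<ge> -1/2\<close>, one first chooses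
  \<open>z\<^sub>1\<close> well: eliminating \<open>y\<close> gives a monic additive equation of degree 16 for \<open>x\<close> with right hand side
  of order at least 12, which has a root with \<open>ord x \<ge> 12/16\<close>; then \<open>z\<^sub>1\<^sup>4\<close> lies in \<open>U\<close>.

  That \<open>H\<^sup>1\<close> is free follows from the filtration by the \<open>T\<close>-degree of the part outside \<open>U\<close>, whose steps
  are finite: lifts of complements in the graded pieces form a basis.
\<close>

section \<open>Valuations and Hensel's lemma\<close>

context C_infinity
begin

section \<open>Arithmetic in characteristic 2\<close>

lemma char2_double [simp]: "x + x = (0::'c)"
proof -
  have "of_nat 2 = (0::'c)" using of_nat_CHAR[where 'a='c] char_two by metis
  hence "(1::'c) + 1 = 0" by simp
  thus ?thesis by (metis distrib_right mult_1 mult_zero_left)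
qed

lemma char2_two [simp]: "(2::'c) = 0"
  using char2_double[of 1] by (metis one_add_one)

lemma char2_double_left [simp]: "x + (x + y) = (y::'c)"
  by (simp add: add.assoc[symmetric])

lemma char2_minus [simp]: "- x = (x::'c)"
  using char2_double minus_unique by blast

lemma char2_diff [simp]: "x - y = x + (y::'c)"
  by (metis char2_minus diff_conv_add_uminus)

lemma char2_eq_iff: "x + y = z \<longleftrightarrow> x = y + (z::'c)"
  by (metis add.commute char2_double_left)

lemma square_add: "(x + y) ^ 2 = x ^ 2 + (y::'c) ^ 2"
  by (simp add: power2_sum)

lemma power_two_power_add: "(x + y) ^ (2 ^ k) = x ^ (2 ^ k) + (y::'c) ^ (2 ^ k)"
  by (induction k arbitrary: x y) (simp_all add: power_mult square_add)

lemma fourth_power_add: "(x + y) ^ 4 = x ^ 4 + (y::'c) ^ 4"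
  using power_two_power_add[of x y 2] by simp

lemma square_inj: "x ^ 2 = y ^ 2 \<longleftrightarrow> x = (y::'c)"
proof
  assume "x ^ 2 = y ^ 2"
  hence "(x + y) ^ 2 = 0" by (simp add: square_add)
  thus "x = y" by (simp add: char2_eq_iff)
qed simp


section \<open>Lower bounds on the order\<close>

text \<open>A real lower bound as a predicate: it holds of 0 for every bound, so that estimates
  avoid case distinctions and arithmetic with infinite orders.\<close>

definition ord_ge :: "real \<Rightarrow> 'c \<Rightarrow> bool"
  where "ord_ge r x \<longleftrightarrow> ereal r \<le> ord x"

lemma ord_ge_imp_less: "ord_ge (B + 1) x \<Longrightarrow> ereal B < ord x"
  unfolding ord_ge_def by (rule less_le_trans[of _ "ereal (B + 1)"]) simp_all

lemma ord_real: "x \<noteq> 0 \<Longrightarrow> \<exists>r. ord x = ereal r"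
  using ord_finite[of x] by (cases "ord x") auto

lemma ord_ge_0 [simp]: "ord_ge r 0"
  by (simp add: ord_ge_def ord_zero)

lemma ord_ge_mono: "ord_ge r x \<Longrightarrow> s \<le> r \<Longrightarrow> ord_ge s x"
  unfolding ord_ge_def by (meson ereal_less_eq(3) order_trans)

lemma ord_ge_add: "ord_ge r x \<Longrightarrow> ord_ge r y \<Longrightarrow> ord_ge r (x + y)"
  unfolding ord_ge_def by (meson min.boundedI order_trans ord_add)

lemma ord_ge_mult: "ord_ge r x \<Longrightarrow> ord_ge s y \<Longrightarrow> ord_ge (r + s) (x * y)"
  unfolding ord_ge_def ord_mult by (metis add_mono plus_ereal.simps(1))

lemma ord_ge_mult': "ord_ge r x \<Longrightarrow> ord_ge s y \<Longrightarrow> u \<le> r + s \<Longrightarrow> ord_ge u (x * y)"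
  using ord_ge_mult ord_ge_mono by blast

lemma ord_one: "ord 1 = 0"
proof -
  obtain r where r: "ord 1 = ereal r" using ord_real[of 1] by auto
  have "ord 1 = ord 1 + ord 1" using ord_mult[of 1 1] by simp
  thus ?thesis using r by (simp add: zero_ereal_def)
qed

lemma ord_ge_1: "ord_ge 0 1"
  by (simp add: ord_ge_def ord_one)

lemma ord_power: "ord x = ereal r \<Longrightarrow> ord (x ^ n) = ereal (real n * r)"
  by (induction n) (auto simp: ord_one ord_mult algebra_simps zero_ereal_def)

lemma ord_mult_real: "ord x = ereal r \<Longrightarrow> ord y = ereal s \<Longrightarrow> ord (x * y) = ereal (r + s)"
  by (simp add: ord_mult)

lemma ord_real_nonzero: "ord x = ereal r \<Longrightarrow> x \<noteq> 0"
  by (auto simp: ord_zero)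

lemma ord_inverse: assumes "ord x = ereal r" shows "ord (inverse x) = ereal (- r)"
proof -
  have x: "x \<noteq> 0" using assms ord_real_nonzero by blast
  then obtain s where s: "ord (inverse x) = ereal s" using ord_real[of "inverse x"] by auto
  have "ord (x * inverse x) = ereal (r + s)" using ord_mult_real[OF assms s] .
  hence "r + s = 0" using x by (simp add: ord_one zero_ereal_def)
  hence "s = - r" by linarith
  thus ?thesis using s by simp
qed

lemma ord_divide: "ord x = ereal r \<Longrightarrow> ord y = ereal s \<Longrightarrow> ord (x / y) = ereal (r - s)"
  using ord_mult_real[OF _ ord_inverse, of x r y s] by (simp add: divide_inverse)

lemma ord_geI: "ord x = ereal r \<Longrightarrow> s \<le> r \<Longrightarrow> ord_ge s x"
  by (simp add: ord_ge_def)

lemma not_ord_geD: "\<not> ord_ge r x \<Longrightarrow> \<exists>s<r. ord x = ereal s"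
  using ord_real[of x] by (cases "x = 0") (auto simp: ord_ge_def not_le ord_zero)

lemma ord_ge_power: assumes "ord_ge r x" shows "ord_ge (real n * r) (x ^ n)"
  by (induction n) (use assms in \<open>auto simp: ord_ge_1 intro!: ord_ge_mult' simp: algebra_simps\<close>)

lemma ord_ge_power': "ord_ge r x \<Longrightarrow> s \<le> real n * r \<Longrightarrow> ord_ge s (x ^ n)"
  using ord_ge_power ord_ge_mono by blast

lemma ord_ge_powerD: assumes "ord_ge s (x ^ n)" "n > 0" shows "ord_ge (s / real n) x"
proof (rule ccontr)
  assume "\<not> ?thesis"
  then obtain r where r: "r < s / real n" "ord x = ereal r" using not_ord_geD by blast
  have "s \<le> real n * r" using assms ord_power[OF r(2), of n] by (simp add: ord_ge_def)
  thus False using r(1) assms(2) by (simp add: field_simps)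
qed

lemma ord_ge_exists: "\<exists>r. ord_ge r x"
  using ord_real[of x] by (cases "x = 0") (auto intro: ord_geI)

lemma ord_ge_all_imp_0: assumes "\<And>r. ord_ge r x" shows "x = 0"
proof (rule ccontr)
  assume "x \<noteq> 0"
  then obtain r where "ord x = ereal r" using ord_real by blast
  with assms[of "r + 1"] show False by (simp add: ord_ge_def)
qed

lemma ord_ge_multD: assumes "ord_ge s (x * y)" "ord x = ereal r" shows "ord_ge (s - r) y"
proof -
  have "x \<noteq> 0" using assms ord_real_nonzero by blast
  hence y: "inverse x * (x * y) = y" by simp
  have "ord_ge (- r + s) (inverse x * (x * y))"
    using assms(1) by (rule ord_ge_mult[OF ord_geI[OF ord_inverse[OF assms(2)] order_refl]])
  thus ?thesis unfolding y by (simp add: algebra_simps)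
qed

lemma ord_ge_sum: "(\<And>i. i \<in> I \<Longrightarrow> ord_ge r (f i)) \<Longrightarrow> ord_ge r (sum f I)"
  by (induction I rule: infinite_finite_induct) (auto intro: ord_ge_add)

text \<open>The sign of \<open>C\<close> matters in the uses: \<open>real i * C\<close> decreases
  with \<open>i\<close>, and \<open>- C\<close> serves as a nonnegative radius.\<close>

lemma ord_ge_common:
  assumes "finite I"
  shows "\<exists>C\<le>0. \<forall>i\<in>I. ord_ge C (f i)"
  using assms
proof (induction I)
  case (insert i I)
  then obtain C where C: "C \<le> 0" "\<forall>i\<in>I. ord_ge C (f i)" by blast
  obtain r where "ord_ge r (f i)" using ord_ge_exists by blast
  hence "\<forall>i\<in>insert i I. ord_ge (min C r) (f i)" using C by (auto intro: ord_ge_mono)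
  thus ?case using C by (intro exI[of _ "min C r"]) auto
qed auto

lemma val_tendsto_iff: "val_tendsto ord X x \<longleftrightarrow> (\<forall>B. eventually (\<lambda>n. ord_ge B (X n - x)) sequentially)"
proof
  assume L: "val_tendsto ord X x"
  show "\<forall>B. eventually (\<lambda>n. ord_ge B (X n - x)) sequentially"
  proof
    fix B
    have "eventually (\<lambda>n. ereal B < ord (X n - x)) sequentially"
      using L unfolding val_tendsto_def tendsto_PInfty by blast
    thus "eventually (\<lambda>n. ord_ge B (X n - x)) sequentially"
      by eventually_elim (simp add: ord_ge_def)
  qed
next
  assume R: "\<forall>B. eventually (\<lambda>n. ord_ge B (X n - x)) sequentially"
  show "val_tendsto ord X x" unfolding val_tendsto_def tendsto_PInfty
  proof
    fix B
    show "eventually (\<lambda>n. ereal B < ord (X n - x)) sequentially"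
      using R[rule_format, of "B + 1"]
      by eventually_elim (rule ord_ge_imp_less)
  qed
qed

text \<open>By the ultrametric inequality a bound on consecutive differences bounds all later
  differences, so the sequence is Cauchy; the bound survives in the limit because it holds for
  \<open>X m\<close> with arbitrarily large \<open>m\<close>.\<close>

lemma val_limit_exists:
  assumes step: "\<And>n. ord_ge (c + real n * d) (X (Suc n) + X n)" and d: "d > 0"
  shows "\<exists>x. \<forall>n. ord_ge (c + real n * d) (x + X n)"
proof -
  have X: "ord_ge (c + real n * d) (X (n + k) + X n)" for n k
  proof (induction k)
    case (Suc k)
    have "ord_ge (c + real n * d) (X (Suc (n + k)) + X (n + k))"
      using step[of "n + k"] by (rule ord_ge_mono) (use d in simp)
    from ord_ge_add[OF this Suc] show ?case by (simp add: ac_simps)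
  qed simp
  hence X': "ord_ge (c + real n * d) (X m + X n)" if "m \<ge> n" for m n
    using that by (metis le_Suc_ex)
  have "val_Cauchy ord X" unfolding val_Cauchy_def
  proof
    fix B :: real
    obtain N :: nat where N: "(B + 1 - c) / d < real N" using reals_Archimedean2 by blast
    have "ereal B < ord (X m - X n)" if "m \<ge> N" "n \<ge> N" for m n
    proof -
      have "ord_ge (c + real N * d) ((X m + X N) + (X n + X N))"
        using that by (intro ord_ge_add X')
      hence "ord_ge (c + real N * d) (X m - X n)" by (simp add: ac_simps)
      moreover have "B + 1 \<le> c + real N * d" using N d by (simp add: pos_divide_less_eq)
      ultimately show ?thesis using ord_ge_mono ord_ge_imp_less by blast
    qed
    thus "\<exists>N. \<forall>m\<ge>N. \<forall>n\<ge>N. ereal B < ord (X m - X n)" by blast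
  qed
  then obtain x where x: "val_tendsto ord X x" using complete by blast
  have "ord_ge (c + real n * d) (x + X n)" for n
  proof -
    have "eventually (\<lambda>m. ord_ge (c + real n * d) (X m - x)) sequentially"
      using x val_tendsto_iff by blast
    then obtain m where m: "m \<ge> n" "ord_ge (c + real n * d) (X m - x)"
      unfolding eventually_sequentially by (meson nat_le_linear)
    from ord_ge_add[OF m(2) X'[OF m(1)]] show ?thesis by (simp add: ac_simps)
  qed
  thus ?thesis by blast
qed


section \<open>Contractions on a polydisc and Hensel's lemma\<close>

definition pair_ge :: "real \<Rightarrow> real \<Rightarrow> real \<Rightarrow> 'c \<times> 'c \<Rightarrow> bool"
  where "pair_ge \<xi> \<eta> \<rho> z \<longleftrightarrow> ord_ge (\<xi> + \<rho>) (fst z) \<and> ord_ge (\<eta> + \<rho>) (snd z)"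

lemma pair_ge_add: "pair_ge \<xi> \<eta> \<rho> z \<Longrightarrow> pair_ge \<xi> \<eta> \<rho> w \<Longrightarrow> pair_ge \<xi> \<eta> \<rho> (z + w)"
  by (simp add: pair_ge_def ord_ge_add)

lemma pair_ge_0 [simp]: "pair_ge \<xi> \<eta> \<rho> 0"
  by (simp add: pair_ge_def)

lemma pair_ge_mono: "pair_ge \<xi> \<eta> \<rho> z \<Longrightarrow> \<rho>' \<le> \<rho> \<Longrightarrow> pair_ge \<xi> \<eta> \<rho>' z"
  by (auto simp: pair_ge_def intro: ord_ge_mono)

lemma pair_ge_all_imp_0: assumes "\<And>n::nat. pair_ge \<xi> \<eta> (c + real n * d) z" "d > 0" shows "z = 0"
proof -
  have "ord_ge r (fst z) \<and> ord_ge r (snd z)" for r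
  proof -
    obtain n :: nat where n: "(\<bar>r\<bar> + \<bar>c\<bar> + \<bar>\<xi>\<bar> + \<bar>\<eta>\<bar>) / d < real n" using reals_Archimedean2 by blast
    hence "\<bar>r\<bar> + \<bar>c\<bar> + \<bar>\<xi>\<bar> + \<bar>\<eta>\<bar> < real n * d" using assms(2) by (simp add: field_simps)
    thus ?thesis using assms(1)[of n] by (auto simp: pair_ge_def elim!: ord_ge_mono)
  qed
  thus ?thesis by (auto simp: prod_eq_iff intro: ord_ge_all_imp_0)
qed

lemma pair_double [simp]: "(z::'c \<times> 'c) + z = 0"
  by (simp add: prod_eq_iff)

lemma pair_double_left [simp]: "(z::'c \<times> 'c) + (z + w) = w"
  by (simp add: prod_eq_iff)

text \<open>Neumann series: \<open>z\<close> is the sum of the iterates \<open>(L ^^ k) r\<close>,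
  without signs in characteristic 2. The number \<open>\<rho>\<close> is the depth inside the
  polydisc with radii \<open>\<xi>\<close> and \<open>\<eta>\<close>; its doubling under
  \<open>L\<close> forces convergence.\<close>

lemma hensel:
  assumes add: "\<And>z w. L (z + w) = L z + L w"
    and contr: "\<And>\<rho> z. \<rho> \<ge> 0 \<Longrightarrow> pair_ge \<xi> \<eta> \<rho> z \<Longrightarrow> pair_ge \<xi> \<eta> (2 * \<rho>) (L z)"
    and "\<rho> > 0" and r: "pair_ge \<xi> \<eta> \<rho> r"
  shows "\<exists>z. pair_ge \<xi> \<eta> \<rho> z \<and> z + L z = r"
proof -
  define S where "S n = (\<Sum>k<n. (L ^^ k) r)" for n
  have L0: "L 0 = 0" using add[of 0 0] by simp
  \<comment> \<open>Doubling gives more, but linear growth is the form that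
    \<open>val_limit_exists\<close> takes.\<close>
  have Lk: "pair_ge \<xi> \<eta> (\<rho> + real k * \<rho>) ((L ^^ k) r)" for k
  proof (induction k)
    case (Suc k)
    have "pair_ge \<xi> \<eta> (2 * (\<rho> + real k * \<rho>)) ((L ^^ Suc k) r)"
      using contr[OF _ Suc] \<open>\<rho> > 0\<close> by simp
    thus ?case by (rule pair_ge_mono) (use \<open>\<rho> > 0\<close> in \<open>simp add: algebra_simps\<close>)
  qed (use r in simp)
  have SS: "S (Suc n) + S n = (L ^^ n) r" for n
    unfolding S_def by (simp add: ac_simps)
  have "ord_ge (\<xi> + \<rho> + real n * \<rho>) (fst (S (Suc n)) + fst (S n))"
       "ord_ge (\<eta> + \<rho> + real n * \<rho>) (snd (S (Suc n)) + snd (S n))" for n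
    using Lk[of n] unfolding SS[symmetric] by (simp_all add: pair_ge_def add.assoc)
  from val_limit_exists[of _ _ "\<lambda>n. fst (S n)", OF this(1) \<open>\<rho> > 0\<close>]
       val_limit_exists[of _ _ "\<lambda>n. snd (S n)", OF this(2) \<open>\<rho> > 0\<close>]
  obtain x y where xy: "\<And>n. ord_ge (\<xi> + \<rho> + real n * \<rho>) (x + fst (S n))"
       "\<And>n. ord_ge (\<eta> + \<rho> + real n * \<rho>) (y + snd (S n))" by blast
  define z where "z = (x, y)"
  have z: "pair_ge \<xi> \<eta> (\<rho> + real n * \<rho>) (z + S n)" for n
    using xy[of n] by (simp add: pair_ge_def z_def add.assoc)
  \<comment> \<open>Telescoping: all intermediate iterates occur twice.\<close>
  have SL: "S n + L (S n) = r + (L ^^ n) r" for n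
  proof (induction n)
    case (Suc n)
    have "S (Suc n) + L (S (Suc n)) = (S n + L (S n)) + (L ^^ n) r + (L ^^ Suc n) r"
      unfolding S_def by (simp add: add ac_simps)
    thus ?case unfolding Suc by (simp add: ac_simps)
  qed (simp add: S_def L0)
  \<comment> \<open>The error splits into \<open>z + S n\<close>, its image under \<open>L\<close>
    and the term \<open>(L ^^ n) r\<close>, all of depth growing with \<open>n\<close>.\<close>
  have "pair_ge \<xi> \<eta> (\<rho> + real n * \<rho>) (z + L z + r)" for n
  proof -
    have "pair_ge \<xi> \<eta> (2 * (\<rho> + real n * \<rho>)) (L (z + S n))"
      using contr[OF _ z[of n]] \<open>\<rho> > 0\<close> by simp
    hence "pair_ge \<xi> \<eta> (\<rho> + real n * \<rho>) (L (z + S n))"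
      by (rule pair_ge_mono) (use \<open>\<rho> > 0\<close> in simp)
    from pair_ge_add[OF pair_ge_add[OF z[of n] this] Lk[of n]]
    have "pair_ge \<xi> \<eta> (\<rho> + real n * \<rho>) (z + L z + (S n + L (S n)) + (L ^^ n) r)"
      by (simp add: add ac_simps)
    thus ?thesis unfolding SL by (simp add: ac_simps)
  qed
  hence "z + L z + r = 0" by (rule pair_ge_all_imp_0) (use \<open>\<rho> > 0\<close> in simp)
  hence "z + L z = r" by (metis add.commute add.right_neutral pair_double_left)
  moreover have "pair_ge \<xi> \<eta> \<rho> z" using z[of 0] by (simp add: S_def)
  ultimately show ?thesis by blast
qed

text \<open>A solution is a fixed point of \<open>L\<close>, so its depth can be doubled again and
  again, which only 0 allows.\<close>

lemma hensel_unique: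
  assumes contr: "\<And>\<rho> z. \<rho> \<ge> 0 \<Longrightarrow> pair_ge \<xi> \<eta> \<rho> z \<Longrightarrow> pair_ge \<xi> \<eta> (2 * \<rho>) (L z)"
    and "\<rho> > 0" and z: "pair_ge \<xi> \<eta> \<rho> z" and eq: "z + L z = 0"
  shows "z = 0"
proof -
  have Lz: "L z = z" using eq by (metis add.right_neutral pair_double_left)
  have "pair_ge \<xi> \<eta> (\<rho> + real n * \<rho>) z" for n
  proof (induction n)
    case (Suc n)
    have "pair_ge \<xi> \<eta> (2 * (\<rho> + real n * \<rho>)) z"
      using contr[OF _ Suc] \<open>\<rho> > 0\<close> unfolding Lz by simp
    thus ?case by (rule pair_ge_mono) (use \<open>\<rho> > 0\<close> in \<open>simp add: algebra_simps\<close>)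
  qed (use z in simp)
  thus ?thesis by (rule pair_ge_all_imp_0) (rule \<open>\<rho> > 0\<close>)
qed

end


section \<open>Additive polynomials\<close>

context C_infinity
begin

section \<open>Roots by approximation from the dense algebraically closed subfield\<close>

abbreviation Kbar :: "'c set"
  where "Kbar \<equiv> algebraic_elements (val_closure ord (F2_rat \<theta>))"

text \<open>\<open>alg_closed\<close> speaks of all coefficients of a polynomial, including the
  zeros beyond its degree.\<close>

lemma zero_in_Kbar: "0 \<in> Kbar"
proof -
  have F2: "0 \<in> F2_poly" "1 \<in> F2_poly" by (auto simp: F2_poly_def)
  have "0 \<in> F2_rat \<theta>" unfolding F2_rat_def using F2
    by (intro CollectI exI[of _ 0] exI[of _ 1]) auto
  moreover have "1 \<in> F2_rat \<theta>" unfolding F2_rat_def using F2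
    by (intro CollectI exI[of _ 1]) auto
  moreover have "x \<in> val_closure ord (F2_rat \<theta>)" if "x \<in> F2_rat \<theta>" for x
    unfolding val_closure_def using that
    by (intro CollectI exI[of _ "\<lambda>_. x"]) (auto simp: val_tendsto_iff)
  ultimately have "\<forall>i. coeff [:0, 1:] i \<in> val_closure ord (F2_rat \<theta>)"
    by (auto simp: coeff_pCons split: nat.splits)
  thus ?thesis unfolding algebraic_elements_def by (intro CollectI exI[of _ "[:0, 1:]"]) auto
qed

lemma Kbar_dense: "\<exists>a\<in>Kbar. ord_ge B (a + x)"
proof -
  have "x \<in> val_closure ord Kbar" using dense by simp
  then obtain X where X: "\<And>n. X n \<in> Kbar" "val_tendsto ord X x"
    unfolding val_closure_def by blast
  from X(2) have "eventually (\<lambda>n. ord_ge B (X n - x)) sequentially" using val_tendsto_iff by blast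
  then obtain n where "ord_ge B (X n - x)" using eventually_sequentially by auto
  thus ?thesis using X(1) by (intro bexI[of _ "X n"]) auto
qed

text \<open>Algebraic closedness is available in \<open>Kbar\<close> only. The coefficients are
  approximated in \<open>Kbar\<close> and a root of the approximating polynomial is taken; as its
  leading coefficient is a unit, the order of this root is bounded below by a \<open>C\<close>
  independent of the precision \<open>B\<close>.\<close>

lemma approximate_root:
  fixes p :: "'c poly"
  assumes deg: "degree p > 0" and lead: "lead_coeff p = 1"
  shows "\<exists>C. \<forall>B. \<exists>x. ord_ge C x \<and> ord_ge B (poly p x)"
proof -
  define d where "d = degree p"
  obtain C where C: "C \<le> 0" "\<And>i. i \<le> d \<Longrightarrow> ord_ge C (coeff p i)"
    using ord_ge_common[of "{..d}" "coeff p"] by auto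
  show ?thesis
  proof (intro exI[of _ C] allI)
    fix B :: real
    \<comment> \<open>The bound 1 makes the leading coefficient \<open>a d\<close> congruent to 1;
      the other one makes up for the powers of the root, whose orders may be as low as
      \<open>real d * C\<close>.\<close>
    define B' where "B' = max 1 (B - real d * C)"
    have "\<exists>a. \<forall>i. a i \<in> Kbar \<and> ord_ge B' (a i + coeff p i)"
      using Kbar_dense[of B'] by (intro choice allI) blast
    then obtain a where a: "\<And>i. a i \<in> Kbar" "\<And>i. ord_ge B' (a i + coeff p i)" by blast
    define q where "q = (\<Sum>i\<le>d. monom (a i) i)"
    have cq: "coeff q i = (if i \<le> d then a i else 0)" for i
      unfolding q_def by (simp add: coeff_sum coeff_monom)
    have ordad: "ord (a d) = 0"
    proof (rule ccontr)
      assume ne: "ord (a d) \<noteq> 0"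
      have ge1: "ord_ge 1 (a d + 1)" using a(2)[of d] lead ord_ge_mono[of B' _ 1]
        by (simp add: d_def B'_def)
      hence g0: "ord_ge 0 (a d)"
        using ord_ge_add[OF ord_ge_mono[OF ge1, of 0] ord_ge_1] by (simp add: add.assoc)
      have "\<exists>r>0. ord_ge r (a d)"
      proof (cases "a d = 0")
        case False
        then obtain r where "ord (a d) = ereal r" using ord_real by blast
        thus ?thesis using g0 ne by (intro exI[of _ r]) (auto simp: ord_ge_def zero_ereal_def)
      qed (auto intro: exI[of _ 1])
      then obtain r where r: "r > 0" "ord_ge r (a d)" by blast
      have "ord_ge (min 1 r) (a d + (a d + 1))"
        by (intro ord_ge_add ord_ge_mono[OF r(2)] ord_ge_mono[OF ge1]) auto
      thus False using r(1) by (simp add: ord_ge_def ord_one min_def zero_ereal_def split: if_splits)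
    qed
    hence adn: "a d \<noteq> 0" using ord_zero by auto
    have "degree q = d"
    proof (rule antisym)
      show "degree q \<le> d" by (rule degree_le) (simp add: cq)
      show "d \<le> degree q" by (rule le_degree) (simp add: cq adn)
    qed
    hence "degree q > 0" using deg d_def by simp
    moreover have "coeff q i \<in> Kbar" for i using a(1) zero_in_Kbar by (simp add: cq)
    ultimately obtain x where x: "poly q x = 0" using alg_closed by blast
    have pq: "poly q x = (\<Sum>i\<le>d. a i * x ^ i)"
      unfolding q_def by (simp add: poly_sum poly_monom)
    have pp: "poly p x = (\<Sum>i\<le>d. coeff p i * x ^ i)"
      by (simp add: poly_altdef d_def)
    \<comment> \<open>If the root had order \<open>s < C\<close>, the leading term of order
      \<open>real d * s\<close> could not be cancelled by the others, whose orders are at least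
      \<open>C + (real d - 1) * s\<close>.\<close>
    have geC: "ord_ge C x"
    proof (rule ccontr)
      assume "\<not> ord_ge C x"
      then obtain s where s: "s < C" "ord x = ereal s" using not_ord_geD by blast
      have "a d * x ^ d = (\<Sum>i<d. a i * x ^ i)"
        using x unfolding pq by (simp add: lessThan_Suc_atMost[symmetric] char2_eq_iff add.commute)
      moreover have "ord_ge (C + (real d - 1) * s) (\<Sum>i<d. a i * x ^ i)"
      proof (rule ord_ge_sum)
        fix i assume i: "i \<in> {..<d}"
        have "ord_ge C (a i)"
          using ord_ge_add[OF ord_ge_mono[OF a(2)[of i], of C] C(2)[of i]] i C(1)
          by (simp add: B'_def add.assoc)
        moreover have "(real d - 1) * s \<le> real i * s"
          using i s C(1) by (intro mult_right_mono_neg) auto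
        ultimately show "ord_ge (C + (real d - 1) * s) (a i * x ^ i)"
          by (intro ord_ge_mult[OF _ ord_geI[OF ord_power[OF s(2)]]])
      qed
      moreover have "ord (a d * x ^ d) = ereal (0 + real d * s)"
        by (rule ord_mult_real[OF _ ord_power[OF s(2)]]) (simp add: ordad zero_ereal_def)
      ultimately show False using s(1) by (simp add: ord_ge_def algebra_simps)
    qed
    have "poly p x = (\<Sum>i\<le>d. (a i + coeff p i) * x ^ i)"
      using x unfolding pp pq by (simp add: distrib_right sum.distrib)
    moreover have "ord_ge B (\<Sum>i\<le>d. (a i + coeff p i) * x ^ i)"
    proof (rule ord_ge_sum)
      fix i assume i: "i \<in> {..d}"
      have "real d * C \<le> real i * C" using i C(1) by (intro mult_right_mono_neg) auto
      thus "ord_ge B ((a i + coeff p i) * x ^ i)"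
        by (intro ord_ge_mult'[OF a(2) ord_ge_power[OF geC]]) (auto simp: B'_def)
    qed
    ultimately show "\<exists>x. ord_ge C x \<and> ord_ge B (poly p x)" using geC by auto
  qed
qed

text \<open>Squaring is additive, so approximate square roots of increasing precision differ by
  elements of increasing order; they converge, and the limit is an exact root.\<close>

lemma square_root_exists: "\<exists>y. y ^ 2 = (c::'c)"
proof -
  have *: "\<exists>x. ord_ge B (x ^ 2 + c)" for B
    using approximate_root[of "[:c, 0, 1:]"] by (auto simp: power2_eq_square add.commute)
  have "\<exists>X. \<forall>n::nat. ord_ge (real n) (X n ^ 2 + c)"
    by (intro choice allI *)
  then obtain X where X: "\<And>n::nat. ord_ge (real n) (X n ^ 2 + c)" by blast
  have "ord_ge (0 + real n * (1 / 2)) (X (Suc n) + X n)" for n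
  proof -
    have "ord_ge (real n) (X (Suc n) ^ 2 + c + (X n ^ 2 + c))"
      by (rule ord_ge_add[OF ord_ge_mono[OF X] X]) simp
    hence "ord_ge (real n) ((X (Suc n) + X n) ^ 2)" by (simp add: square_add ac_simps)
    from ord_ge_powerD[OF this] show ?thesis by simp
  qed
  from val_limit_exists[OF this] obtain y where y: "\<And>n. ord_ge (real n / 2) (y + X n)" by auto
  have ge: "ord_ge (real n) (y ^ 2 + c)" for n
  proof -
    have "ord_ge (real n) ((y + X n) ^ 2)" by (rule ord_ge_power'[OF y]) simp
    from ord_ge_add[OF this X[of n]] show ?thesis by (simp add: square_add ac_simps)
  qed
  have "y ^ 2 + c = 0"
  proof (rule ord_ge_all_imp_0)
    fix r :: real
    obtain n :: nat where "r \<le> real n" using real_arch_simple by blast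
    thus "ord_ge r (y ^ 2 + c)" using ge ord_ge_mono by blast
  qed
  thus ?thesis by (auto simp: char2_eq_iff)
qed


section \<open>Roots and division of additive polynomials\<close>

definition apoly :: "(nat \<Rightarrow> 'c) \<Rightarrow> nat \<Rightarrow> 'c \<Rightarrow> 'c"
  where "apoly p k x = (\<Sum>i\<le>k. p i * x ^ (2 ^ i))"

lemma apoly_add: "apoly p k (x + y) = apoly p k x + apoly p k y"
  by (simp add: apoly_def power_two_power_add distrib_left sum.distrib)

lemma apoly_0 [simp]: "apoly p k 0 = 0"
  by (simp add: apoly_def power_0_left)

lemma apoly_Suc: "apoly p (Suc k) x = apoly p k x + p (Suc k) * x ^ (2 ^ Suc k)"
  by (simp add: apoly_def)

lemma apoly_upd: "k < n \<Longrightarrow> apoly (p(n := c)) k x = apoly p k x"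
  unfolding apoly_def by (intro sum.cong) auto

lemma apoly_split0: "apoly p k x = p 0 * x + (\<Sum>i\<in>{1..k}. p i * x ^ (2 ^ i))"
proof -
  have "{..k} = insert 0 {1..k}" by auto
  thus ?thesis by (simp add: apoly_def)
qed

text \<open>Hensel's lemma in the first coordinate of a pair, with a trivial second coordinate.\<close>

lemma apoly_hensel:
  assumes p0: "p 0 \<noteq> 0"
  shows "\<exists>\<xi>\<ge>0. (\<forall>i\<in>{1..k}. ord_ge (- \<xi>) (p i / p 0)) \<and>
    (\<forall>r. ord_ge (\<xi> + 1) r \<longrightarrow> (\<exists>z. ord_ge (\<xi> + 1) z \<and> apoly p k z = p 0 * r))"
proof -
  obtain C where C: "C \<le> 0" "\<And>i. i \<in> {1..k} \<Longrightarrow> ord_ge C (p i / p 0)"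
    using ord_ge_common[of "{1..k}" "\<lambda>i. p i / p 0"] by auto
  define L :: "'c \<times> 'c \<Rightarrow> 'c \<times> 'c" where "L z = (\<Sum>i\<in>{1..k}. p i / p 0 * fst z ^ (2 ^ i), 0)" for z
  have add: "L (z + w) = L z + L w" for z w
    by (simp add: L_def power_two_power_add distrib_left sum.distrib)
  have contr: "pair_ge (- C) 0 (2 * \<rho>) (L z)" if "\<rho> \<ge> 0" "pair_ge (- C) 0 \<rho> z" for \<rho> z
  proof -
    have "ord_ge (- C + 2 * \<rho>) (\<Sum>i\<in>{1..k}. p i / p 0 * fst z ^ (2 ^ i))"
    proof (rule ord_ge_sum)
      fix i assume i: "i \<in> {1..k}"
      \<comment> \<open>An exponent of at least 2 doubles the order \<open>- C + \<rho>\<close>,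
        while the coefficient costs \<open>C\<close> only once:
        \<open>C + 2 * (- C + \<rho>) = - C + 2 * \<rho>\<close>.\<close>
      have "(2::real) ^ 1 \<le> 2 ^ i" using i by (intro power_increasing) auto
      hence "2 * (- C + \<rho>) \<le> real (2 ^ i) * (- C + \<rho>)" using C(1) that(1) by (intro mult_right_mono) auto
      moreover have "ord_ge (real (2 ^ i) * (- C + \<rho>)) (fst z ^ (2 ^ i))"
        using that by (intro ord_ge_power) (simp add: pair_ge_def)
      ultimately show "ord_ge (- C + 2 * \<rho>) (p i / p 0 * fst z ^ (2 ^ i))"
        by (intro ord_ge_mult'[OF C(2)[OF i]]) (auto simp: algebra_simps)
    qed
    thus ?thesis by (simp add: pair_ge_def L_def)
  qed
  have "\<exists>z. ord_ge (- C + 1) z \<and> apoly p k z = p 0 * r" if "ord_ge (- C + 1) r" for r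
  proof -
    have "pair_ge (- C) 0 1 (r, 0)" using that by (simp add: pair_ge_def)
    from hensel[of L, OF add contr _ this] obtain z
      where z: "pair_ge (- C) 0 1 z" "z + L z = (r, 0)" by auto
    from z(2) have "fst z + (\<Sum>i\<in>{1..k}. p i / p 0 * fst z ^ (2 ^ i)) = r"
      by (auto simp: L_def prod_eq_iff)
    hence "p 0 * (fst z + (\<Sum>i\<in>{1..k}. p i / p 0 * fst z ^ (2 ^ i))) = p 0 * r" by simp
    hence "apoly p k (fst z) = p 0 * r"
      using p0 by (simp add: apoly_split0 distrib_left sum_distrib_left)
    thus ?thesis using z(1) by (auto simp: pair_ge_def)
  qed
  thus ?thesis using C by (intro exI[of _ "- C"]) auto
qed

text \<open>The error of a good approximate root is small enough for Hensel's lemma, and by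
  additivity the solution for the error can be added to the approximate root.\<close>

lemma quadratic_root_exists:
  assumes "u \<noteq> 0"
  shows "\<exists>x. x ^ 2 + u * x = (r::'c)"
proof -
  define p :: "nat \<Rightarrow> 'c" where "p = (\<lambda>i. if i = 0 then u else 1)"
  have p: "apoly p 1 x = x ^ 2 + u * x" for x
    by (simp add: apoly_def p_def add.commute power2_eq_square)
  have p0: "p 0 = u" by (simp add: p_def)
  obtain \<xi> where \<xi>: "\<And>r. ord_ge (\<xi> + 1) r \<Longrightarrow> \<exists>z. apoly p 1 z = u * r"
    using apoly_hensel[of p 1, unfolded p0, OF assms] by blast
  obtain s where s: "ord u = ereal s" using ord_real assms by blast
  obtain x where x: "ord_ge (\<xi> + 1 + s) (poly [:r, u, 1:] x)"
    using approximate_root[of "[:r, u, 1:]"] by fastforce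
  have "ord_ge (\<xi> + 1 + s) (u * (poly [:r, u, 1:] x / u))" using x assms by simp
  from ord_ge_multD[OF this s] obtain z where "apoly p 1 z = u * (poly [:r, u, 1:] x / u)"
    using \<xi>[of "poly [:r, u, 1:] x / u"] by auto
  moreover have "u * (poly [:r, u, 1:] x / u) = poly [:r, u, 1:] x" using assms
    by (simp only: times_divide_eq_right nonzero_mult_div_cancel_left not_False_eq_True)
  moreover have "poly [:r, u, 1:] x = r + apoly p 1 x" unfolding p
    by (simp add: power2_eq_square algebra_simps)
  ultimately have "apoly p 1 z = r + apoly p 1 x" by simp
  hence "apoly p 1 (x + z) = r" unfolding apoly_add by (simp add: ac_simps)
  thus ?thesis using p by auto
qed

text \<open>The two roots are \<open>x\<close> and \<open>x + u\<close>, with product \<open>r\<close>.\<close>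

lemma quadratic_root_large_ord:
  assumes "u \<noteq> 0" "ord_ge s r"
  shows "\<exists>x. x ^ 2 + u * x = r \<and> ord_ge (s / 2) x"
proof -
  obtain x where x: "x ^ 2 + u * x = r" using quadratic_root_exists assms by blast
  have x': "(x + u) ^ 2 + u * (x + u) = r"
    using x by (simp add: square_add algebra_simps power2_eq_square)
  have "ord_ge (s / 2) x \<or> ord_ge (s / 2) (x + u)"
  proof (rule ccontr)
    assume "\<not> ?thesis"
    then obtain a b where ab: "a < s / 2" "ord x = ereal a" "b < s / 2" "ord (x + u) = ereal b"
      using not_ord_geD by meson
    have "x * (x + u) = r" using x by (simp add: power2_eq_square algebra_simps)
    hence "ord r = ereal (a + b)" using ord_mult_real[OF ab(2,4)] by simp
    thus False using assms(2) ab by (simp add: ord_ge_def)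
  qed
  thus ?thesis using x x' by blast
qed

text \<open>Division by \<open>x\<close> gives \<open>f\<close>, whose roots are the nonzero kernel
  elements. An approximate root of \<open>f\<close> is corrected by Hensel's lemma to an exact zero
  of the additive polynomial; this zero is not 0, because on the disc of the corrections
  \<open>f\<close> stays close to \<open>p 0\<close> and is not small.\<close>

lemma apoly_nonzero_root:
  assumes k: "k > 0" and p0: "p 0 \<noteq> 0" and pk: "p k = 1"
  shows "\<exists>u. u \<noteq> 0 \<and> apoly p k u = 0"
proof -
  obtain \<xi> where \<xi>: "\<xi> \<ge> 0" "\<And>i. i \<in> {1..k} \<Longrightarrow> ord_ge (- \<xi>) (p i / p 0)"
    "\<And>r. ord_ge (\<xi> + 1) r \<Longrightarrow> \<exists>z. ord_ge (\<xi> + 1) z \<and> apoly p k z = p 0 * r"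
    using apoly_hensel[of p k] p0 by blast
  obtain s where s: "ord (p 0) = ereal s" using ord_real p0 by blast
  define f where "f = (\<Sum>i\<le>k. monom (p i) (2 ^ i - 1))"
  have two: "(2::nat) ^ i - 1 = 2 ^ j - 1 \<longleftrightarrow> i = j" for i j
  proof -
    have "(2::nat) ^ i \<ge> 1" "(2::nat) ^ j \<ge> 1" by simp_all
    hence "(2::nat) ^ i - 1 = 2 ^ j - 1 \<longleftrightarrow> (2::nat) ^ i = 2 ^ j" by linarith
    thus ?thesis by simp
  qed
  have cf: "coeff f (2 ^ k - 1) = 1"
    unfolding f_def using pk by (simp add: coeff_sum coeff_monom two del: One_nat_def)
  have le: "degree f \<le> 2 ^ k - 1" unfolding f_def
    by (intro degree_sum_le order_trans[OF degree_monom_le] diff_le_mono power_increasing) auto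
  have df: "degree f = 2 ^ k - 1" using le le_degree[of f "2 ^ k - 1"] cf by simp
  have "x * (p i * x ^ (2 ^ i - 1)) = p i * x ^ (2 ^ i)" for x i
    using power_minus_mult[of "2 ^ i" x] by (simp add: ac_simps)
  hence xf: "x * poly f x = apoly p k x" for x
    unfolding f_def apoly_def poly_sum sum_distrib_left poly_monom by (simp only:)
  have "(2::nat) ^ 1 \<le> 2 ^ k" using k by (intro power_increasing) auto
  hence "degree f > 0" using df by simp
  from approximate_root[OF this] cf df obtain C
    where C: "\<And>B. \<exists>x. ord_ge C x \<and> ord_ge B (poly f x)" by auto
  \<comment> \<open>The first bound makes \<open>poly f x\<close> smaller than \<open>p 0\<close>,
    the second brings \<open>x * poly f x / p 0\<close> into the disc where Hensel's lemma
    applies.\<close>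
  define B where "B = max (s + 1) (\<xi> + 1 + s - C)"
  obtain x where x: "ord_ge C x" "ord_ge B (poly f x)" using C by blast
  have "ord_ge (\<xi> + 1 + s) (p 0 * (apoly p k x / p 0))"
    using ord_ge_mult'[OF x, of "\<xi> + 1 + s"] p0 by (simp add: xf B_def)
  from \<xi>(3)[of "apoly p k x / p 0"] ord_ge_multD[OF this s] obtain z
    where z: "ord_ge (\<xi> + 1) z" "apoly p k z = apoly p k x" using p0 by auto
  have "x \<noteq> z"
  proof
    assume "x = z"
    hence "ord_ge (\<xi> + 1) x" using z by simp
    have f0: "poly f x = p 0 + (\<Sum>i\<in>{1..k}. p 0 * (p i / p 0 * x ^ (2 ^ i - 1)))"
    proof -
      have "{..k} = insert 0 {1..k}" by auto
      thus ?thesis unfolding f_def using p0 by (simp add: poly_sum poly_monom)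
    qed
    have "ord_ge (s + 1) (\<Sum>i\<in>{1..k}. p 0 * (p i / p 0 * x ^ (2 ^ i - 1)))"
    proof (rule ord_ge_sum)
      fix i assume i: "i \<in> {1..k}"
      have "(2::nat) \<le> 2 ^ i" using i power_increasing[of 1 i "2::nat"] by simp
      hence "(1::nat) \<le> 2 ^ i - 1" by linarith
      from of_nat_mono[OF this, where 'a=real] have "1 \<le> real (2 ^ i - 1)" by (simp only: of_nat_1)
      hence "1 * (\<xi> + 1) \<le> real (2 ^ i - 1) * (\<xi> + 1)" using \<xi>(1) by (intro mult_right_mono) auto
      hence "ord_ge 1 (p i / p 0 * x ^ (2 ^ i - 1))"
        by (intro ord_ge_mult'[OF \<xi>(2)[OF i] ord_ge_power[OF \<open>ord_ge (\<xi> + 1) x\<close>]]) auto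
      thus "ord_ge (s + 1) (p 0 * (p i / p 0 * x ^ (2 ^ i - 1)))"
        by (intro ord_ge_mult ord_geI[OF s]) auto
    qed
    moreover have "ord_ge (s + 1) (poly f x)" using x(2) by (rule ord_ge_mono) (simp add: B_def)
    ultimately have "ord_ge (s + 1) (p 0)" unfolding f0
      using ord_ge_add by (metis add.commute char2_double_left)
    thus False using s by (simp add: ord_ge_def)
  qed
  hence "x + z \<noteq> 0" by (simp add: char2_eq_iff)
  moreover have "apoly p k (x + z) = 0" by (simp add: apoly_add z(2))
  ultimately show ?thesis by blast
qed

text \<open>Right division by \<open>x ^ 2 + u * x\<close> with respect to composition, with
  remainder \<open>c * x\<close>; the leading term is removed first.\<close>

lemma apoly_division:
  "\<exists>q c. q k = p (Suc k) \<and> p 0 = u * q 0 + c \<and>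
     (\<forall>x. apoly p (Suc k) x = apoly q k (x ^ 2 + u * x) + c * x)"
proof (induction k arbitrary: p)
  case 0
  show ?case
    by (intro exI[of _ "\<lambda>_. p 1"] exI[of _ "p 0 + u * p 1"])
       (auto simp: apoly_def algebra_simps power2_eq_square)
next
  case (Suc k)
  \<comment> \<open>What remains after subtracting
    \<open>p (Suc (Suc k)) * (x ^ 2 + u * x) ^ (2 ^ Suc k)\<close>.\<close>
  define p' where "p' = p(Suc k := p (Suc k) + p (Suc (Suc k)) * u ^ (2 ^ Suc k))"
  obtain q c where q: "q k = p' (Suc k)" "p' 0 = u * q 0 + c"
    "\<And>x. apoly p' (Suc k) x = apoly q k (x ^ 2 + u * x) + c * x"
    using Suc[of p'] by blast
  define q' where "q' = q(Suc k := p (Suc (Suc k)))"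
  have p': "apoly p (Suc k) x = apoly p' (Suc k) x + p (Suc (Suc k)) * u ^ (2 ^ Suc k) * x ^ (2 ^ Suc k)" for x
  proof -
    have "apoly p' k x = apoly p k x" unfolding p'_def by (rule apoly_upd) simp
    thus ?thesis unfolding apoly_Suc[of p] apoly_Suc[of p'] by (simp add: p'_def algebra_simps)
  qed
  have q': "apoly q' (Suc k) y = apoly q k y + p (Suc (Suc k)) * y ^ (2 ^ Suc k)" for y
    unfolding apoly_Suc by (simp add: q'_def apoly_upd)
  have pw: "(x ^ 2 + u * x) ^ (2 ^ Suc k) = x ^ (2 ^ Suc (Suc k)) + u ^ (2 ^ Suc k) * x ^ (2 ^ Suc k)" for x
    unfolding power_two_power_add power_mult_distrib by (simp add: power_mult[symmetric])
  have "apoly p (Suc (Suc k)) x = apoly q' (Suc k) (x ^ 2 + u * x) + c * x" for x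
    unfolding apoly_Suc[of p "Suc k"] p' q(3) q' pw by (simp add: algebra_simps)
  moreover have "q' (Suc k) = p (Suc (Suc k))" "p 0 = u * q' 0 + c"
    using q by (simp_all add: q'_def p'_def)
  ultimately show ?case by blast
qed

text \<open>A nonzero root \<open>u\<close> splits off the inner factor
  \<open>x ^ 2 + u * x\<close>, and the quotient is again monic with nonzero linear coefficient.
  Each such factor is onto, has fibres of two elements, and costs a factor 2 in the order of a
  suitable preimage.\<close>

theorem apoly_surj_and_kernel:
  assumes "p 0 \<noteq> 0" "p k = 1"
  shows "(\<forall>r s. ord_ge s r \<longrightarrow> (\<exists>x. apoly p k x = r \<and> ord_ge (s / 2 ^ k) x))
    \<and> finite {x. apoly p k x = 0} \<and> card {x. apoly p k x = 0} = 2 ^ k"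
  using assms
proof (induction k arbitrary: p)
  case 0
  hence "apoly p 0 x = x" for x by (simp add: apoly_def)
  thus ?case by simp
next
  case (Suc k)
  obtain u where u: "u \<noteq> 0" "apoly p (Suc k) u = 0"
    using apoly_nonzero_root[of "Suc k" p] Suc.prems by auto
  obtain q c where q: "q k = p (Suc k)" "p 0 = u * q 0 + c"
    "\<And>x. apoly p (Suc k) x = apoly q k (x ^ 2 + u * x) + c * x"
    using apoly_division[of k p u] by blast
  \<comment> \<open>Since \<open>x ^ 2 + u * x\<close> vanishes at \<open>u\<close>, the value at
    \<open>u\<close> is \<open>c * u\<close>.\<close>
  have "c = 0" using u q(3)[of u] by (simp add: power2_eq_square)
  hence q0: "q 0 \<noteq> 0" and pq: "\<And>x. apoly p (Suc k) x = apoly q k (x ^ 2 + u * x)"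
    using q Suc.prems by auto
  note IH = Suc.IH[OF q0 q(1)[unfolded Suc.prems(2)]]
  have "\<exists>x. apoly p (Suc k) x = r \<and> ord_ge (s / 2 ^ Suc k) x" if "ord_ge s r" for r s
  proof -
    obtain y where y: "apoly q k y = r" "ord_ge (s / 2 ^ k) y" using IH \<open>ord_ge s r\<close> by blast
    obtain x where "x ^ 2 + u * x = y" "ord_ge (s / 2 ^ k / 2) x"
      using quadratic_root_large_ord[OF u(1) y(2)] by blast
    thus ?thesis using y pq by (intro exI[of _ x]) (simp add: mult.commute)
  qed
  moreover have fib: "finite {x. x ^ 2 + u * x = y} \<and> card {x. x ^ 2 + u * x = y} = 2" for y
  proof -
    obtain x where x: "x ^ 2 + u * x = y" using quadratic_root_exists[OF u(1)] by blast
    have "z ^ 2 + u * z = y \<longleftrightarrow> z = x \<or> z = x + u" for z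
    proof -
      have "(z + x) * (z + x + u) = (z + x) ^ 2 + u * (z + x)"
        by (simp add: power2_eq_square algebra_simps)
      also have "\<dots> = z ^ 2 + u * z + y"
        unfolding x[symmetric] square_add by (simp add: algebra_simps)
      finally have "z ^ 2 + u * z = y \<longleftrightarrow> (z + x) * (z + x + u) = 0"
        by (simp add: char2_eq_iff[of _ y 0])
      thus ?thesis by (auto simp: char2_eq_iff add.assoc)
    qed
    hence "{x. x ^ 2 + u * x = y} = {x, x + u}" by auto
    thus ?thesis using u(1) by simp
  qed
  moreover have "{x. apoly p (Suc k) x = 0} = (\<Union>y\<in>{y. apoly q k y = 0}. {x. x ^ 2 + u * x = y})"
    by (auto simp: pq)
  moreover have "card (\<Union>y\<in>{y. apoly q k y = 0}. {x. x ^ 2 + u * x = y}) = 2 ^ k * 2"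
    using IH fib by (subst card_UN_disjoint) auto
  ultimately show ?case using IH by auto
qed

end


section \<open>Filtered modules over \<open>F\<^sub>2[T]\<close>\<close>

text \<open>A family \<open>\<beta>\<close> is a basis over \<open>F\<^sub>2[T]\<close> when the elements \<open>T\<^sup>k \<beta>\<^sub>i\<close> are a basis over \<open>F\<^sub>2\<close>,
  that is, when every element is the sum of exactly one finite set of them.\<close>

locale F2T_module =
  fixes H :: "'h::ab_group_add set" and T :: "'h \<Rightarrow> 'h" and \<epsilon> :: "'h \<Rightarrow> 'k::ab_group_add"
  assumes double: "x + x = (0::'h)"
    and H_0: "0 \<in> H" and H_add: "x \<in> H \<Longrightarrow> y \<in> H \<Longrightarrow> x + y \<in> H"
    and T_add: "T (x + y) = T x + T y"
    and T_inj: "T x = 0 \<Longrightarrow> x = 0"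
    and H_T: "x \<in> H \<Longrightarrow> T x \<in> H"
    and eps_add: "\<epsilon> (x + y) = \<epsilon> x + \<epsilon> y"
    and eps_0_iff: "x \<in> H \<Longrightarrow> \<epsilon> x = 0 \<longleftrightarrow> x \<in> T ` H"
    and eps_finite: "finite (\<epsilon> ` H)"
begin

text \<open>\<open>J\<close> is the support of a family of polynomials over the field of two
  elements: \<open>(k, i)\<close> is in \<open>J\<close> when the \<open>k\<close>-th power of
  \<open>T\<close> occurs in the coefficient of \<open>\<beta> i\<close>. Families are added by
  symmetric difference.\<close>

definition T_sum :: "('i \<Rightarrow> 'h) \<Rightarrow> (nat \<times> 'i) set \<Rightarrow> 'h"
  where "T_sum \<beta> J = (\<Sum>(k, i)\<in>J. (T ^^ k) (\<beta> i))"

definition is_basis :: "'i set \<Rightarrow> ('i \<Rightarrow> 'h) \<Rightarrow> bool"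
  where "is_basis I \<beta> \<longleftrightarrow> \<beta> ` I \<subseteq> H \<and>
    (\<forall>J. finite J \<longrightarrow> J \<subseteq> UNIV \<times> I \<longrightarrow> T_sum \<beta> J = 0 \<longrightarrow> J = {}) \<and>
    (\<forall>x\<in>H. \<exists>J. finite J \<and> J \<subseteq> UNIV \<times> I \<and> T_sum \<beta> J = x)"

lemma eq_add_iff: "x + y = z \<longleftrightarrow> x = y + (z::'h)"
proof
  assume "x + y = z"
  hence "y + z = x + (y + y)" by (simp add: ac_simps)
  thus "x = y + z" by (simp add: double)
next
  assume "x = y + z"
  hence "x + y = z + (y + y)" by (simp add: ac_simps)
  thus "x + y = z" by (simp add: double)
qed

lemma T_0 [simp]: "T 0 = 0"
  using T_add[of 0 0] by simp

lemma eps_0 [simp]: "\<epsilon> 0 = 0"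
  using eps_add[of 0 0] by simp

lemma T_sum_distrib: "T (sum f J) = (\<Sum>j\<in>J. T (f j))"
  by (induction J rule: infinite_finite_induct) (auto simp: T_add)

lemma eps_sum: "\<epsilon> (sum f J) = (\<Sum>j\<in>J. \<epsilon> (f j))"
  by (induction J rule: infinite_finite_induct) (auto simp: eps_add)

lemma T_pow_H: "x \<in> H \<Longrightarrow> (T ^^ k) x \<in> H"
  by (induction k) (auto intro: H_T)

lemma H_sum: "(\<And>j. j \<in> J \<Longrightarrow> f j \<in> H) \<Longrightarrow> sum f J \<in> H"
  by (induction J rule: infinite_finite_induct) (auto intro: H_0 H_add)

lemma T_sum_empty [simp]: "T_sum \<beta> {} = 0"
  by (simp add: T_sum_def)

lemma sum_sym_diff:
  assumes "finite J" "finite J'"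
  shows "sum f (sym_diff J J') = sum f J + sum (f :: 'a \<Rightarrow> 'h) J'"
proof -
  have "sum f J = sum f (J - J') + sum f (J \<inter> J')"
    using sum.Int_Diff[OF assms(1), of f J'] by (simp add: add.commute)
  moreover have "sum f J' = sum f (J' - J) + sum f (J \<inter> J')"
    using sum.Int_Diff[OF assms(2), of f J] by (simp add: add.commute Int_commute)
  moreover have "sum f (sym_diff J J') = sum f (J - J') + sum f (J' - J)"
    using assms by (intro sum.union_disjoint) auto
  ultimately show ?thesis
    by (simp add: ac_simps) (metis add.assoc add.left_neutral double)
qed

lemma T_sum_sym_diff: "finite J \<Longrightarrow> finite J' \<Longrightarrow> T_sum \<beta> (sym_diff J J') = T_sum \<beta> J + T_sum \<beta> J'"
  unfolding T_sum_def by (rule sum_sym_diff)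

lemma T_sum_shift: "T_sum \<beta> (map_prod Suc id ` J) = T (T_sum \<beta> J)"
  unfolding T_sum_def T_sum_distrib
  by (subst sum.reindex) (auto simp: inj_on_def case_prod_unfold)

lemma eps_T: "x \<in> H \<Longrightarrow> \<epsilon> (T x) = 0"
  using eps_0_iff[OF H_T] by blast

text \<open>The image of \<open>H\<close> under \<open>\<epsilon>\<close> is \<open>H\<close> modulo
  \<open>T H\<close>, and a basis over the polynomial ring becomes a basis of it over the field of
  two elements: its elements correspond to the finite subsets of \<open>I\<close>. As it is finite,
  so is \<open>I\<close>.\<close>

lemma basis_card:
  assumes "is_basis I \<beta>"
  shows "finite I \<and> 2 ^ card I = card (\<epsilon> ` H)"
proof -
  note b = assms[unfolded is_basis_def]
  note I = b[THEN conjunct1] and indep = b[THEN conjunct2, THEN conjunct1, rule_format]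
    and span = b[THEN conjunct2, THEN conjunct2, rule_format]
  have T0: "T_sum \<beta> (Pair 0 ` K) = sum \<beta> K" for K
    unfolding T_sum_def by (subst sum.reindex) (auto simp: inj_on_def)
  have "bij_betw (\<lambda>K. \<epsilon> (sum \<beta> K)) (Fpow I) (\<epsilon> ` H)"
    unfolding bij_betw_def
  proof
    show "inj_on (\<lambda>K. \<epsilon> (sum \<beta> K)) (Fpow I)"
    proof (rule inj_onI)
      fix K K' assume K: "K \<in> Fpow I" "K' \<in> Fpow I" and eq: "\<epsilon> (sum \<beta> K) = \<epsilon> (sum \<beta> K')"
      let ?D = "sym_diff K K'"
      have fin: "finite K" "finite K'" "K \<subseteq> I" "K' \<subseteq> I" using K by (auto simp: Fpow_def)
      have "\<epsilon> (sum \<beta> ?D) = \<epsilon> (sum \<beta> K' + sum \<beta> K')"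
        unfolding sum_sym_diff[OF fin(1,2)] eps_add eq ..
      hence "\<epsilon> (sum \<beta> ?D) = 0" by (simp add: double)
      moreover have "sum \<beta> ?D \<in> H" using fin I by (intro H_sum) auto
      ultimately obtain x where x: "x \<in> H" "sum \<beta> ?D = T x" using eps_0_iff by auto
      obtain J where J: "finite J" "J \<subseteq> UNIV \<times> I" "T_sum \<beta> J = x" using span x(1) by blast
      let ?J = "map_prod Suc id ` J"
      \<comment> \<open>A relation between basis elements: the terms from \<open>?D\<close> have
        exponent 0 and the shifted ones positive exponents, so nothing cancels between the two
        sets.\<close>
      have "T_sum \<beta> (sym_diff (Pair 0 ` ?D) ?J) = T x + T x"
        using fin J x by (subst T_sum_sym_diff) (auto simp: T0 T_sum_shift)
      hence "sym_diff (Pair 0 ` ?D) ?J = {}"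
        using fin J by (intro indep) (auto simp: double)
      moreover have "Pair 0 ` ?D \<inter> ?J = {}" by auto
      ultimately show "K = K'" by blast
    qed
    show "(\<lambda>K. \<epsilon> (sum \<beta> K)) ` Fpow I = \<epsilon> ` H"
    proof
      show "(\<lambda>K. \<epsilon> (sum \<beta> K)) ` Fpow I \<subseteq> \<epsilon> ` H"
        using I by (auto simp: Fpow_def intro!: imageI H_sum)
      show "\<epsilon> ` H \<subseteq> (\<lambda>K. \<epsilon> (sum \<beta> K)) ` Fpow I"
      proof
        fix y assume "y \<in> \<epsilon> ` H"
        then obtain x where x: "x \<in> H" "y = \<epsilon> x" by blast
        obtain J where J: "finite J" "J \<subseteq> UNIV \<times> I" "T_sum \<beta> J = x" using span x(1) by blast
        \<comment> \<open>Only the terms without a factor \<open>T\<close> survive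
          \<open>\<epsilon>\<close>.\<close>
        define K where "K = {i. (0, i) \<in> J}"
        have "K \<subseteq> snd ` J" by (force simp: K_def)
        hence K: "finite K" "K \<subseteq> I"
          using J(2) finite_subset[OF _ finite_imageI[OF J(1)]] by (auto simp: K_def)
        have "Pair 0 ` K \<subseteq> J" by (auto simp: K_def)
        hence "x = T_sum \<beta> (J - Pair 0 ` K) + T_sum \<beta> (Pair 0 ` K)"
          unfolding J(3)[symmetric] T_sum_def by (rule sum.subset_diff) (rule J(1))
        moreover have "\<epsilon> (T_sum \<beta> (J - Pair 0 ` K)) = 0"
          unfolding T_sum_def eps_sum
        proof (intro sum.neutral ballI)
          fix z assume z: "z \<in> J - Pair 0 ` K"
          obtain k i where ki: "z = (k, i)" by (cases z)
          have "k \<noteq> 0" using z by (auto simp: ki K_def)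
          then obtain k' where "k = Suc k'" by (cases k) auto
          moreover have "i \<in> I" using z ki J by auto
          ultimately show "\<epsilon> (case z of (k, i) \<Rightarrow> (T ^^ k) (\<beta> i)) = 0"
            using I by (auto simp: ki intro!: eps_T T_pow_H)
        qed
        ultimately have "y = \<epsilon> (sum \<beta> K)" using x by (simp add: eps_add T0)
        thus "y \<in> (\<lambda>K. \<epsilon> (sum \<beta> K)) ` Fpow I" using K by (auto simp: Fpow_def)
      qed
    qed
  qed
  hence *: "finite (Fpow I)" "card (Fpow I) = card (\<epsilon> ` H)"
    using eps_finite bij_betw_finite bij_betw_same_card by blast+
  have "finite I"
  proof -
    have "finite ((\<lambda>i. {i}) ` I)" by (rule finite_subset[OF _ *(1)]) (auto simp: Fpow_def)
    thus ?thesis by (rule finite_imageD) (auto simp: inj_on_def)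
  qed
  moreover from this have "Fpow I = Pow I" by (auto simp: Fpow_def finite_subset)
  ultimately show ?thesis using *(2) by (simp add: card_Pow)
qed

lemma is_basis_reindex:
  assumes e: "bij_betw e K I" and "is_basis I \<beta>"
  shows "is_basis K (\<beta> \<circ> e)"
proof -
  note b = \<open>is_basis I \<beta>\<close>[unfolded is_basis_def]
  note I = b[THEN conjunct1] and indep = b[THEN conjunct2, THEN conjunct1, rule_format]
    and span = b[THEN conjunct2, THEN conjunct2, rule_format]
  have inj: "inj_on e K" and eK: "e ` K = I" using e by (simp_all add: bij_betw_def)
  have S: "T_sum \<beta> (map_prod id e ` J) = T_sum (\<beta> \<circ> e) J" if "J \<subseteq> UNIV \<times> K" for J
  proof -
    have "inj_on (map_prod id e) J"
      using that inj by (auto simp: inj_on_def subset_iff)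
    thus ?thesis unfolding T_sum_def by (subst sum.reindex) (auto simp: case_prod_unfold)
  qed
  show ?thesis unfolding is_basis_def
  proof (intro conjI allI impI ballI)
    show "(\<beta> \<circ> e) ` K \<subseteq> H" using I eK by auto
    fix J assume J: "finite J" "J \<subseteq> UNIV \<times> K" "T_sum (\<beta> \<circ> e) J = 0"
    have "map_prod id e ` J = {}"
    proof (rule indep)
      show "map_prod id e ` J \<subseteq> UNIV \<times> I" using J(2) eK by auto
      show "T_sum \<beta> (map_prod id e ` J) = 0" using S[OF J(2)] J(3) by simp
    qed (use J(1) in simp)
    thus "J = {}" by simp
  next
    fix x assume "x \<in> H"
    then obtain J where J: "finite J" "J \<subseteq> UNIV \<times> I" "T_sum \<beta> J = x" using span by blast
    let ?J = "map_prod id (inv_into K e) ` J"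
    have inv: "inv_into K e i \<in> K" "e (inv_into K e i) = i" if "i \<in> I" for i
      using that unfolding eK[symmetric] by (rule inv_into_into, rule f_inv_into_f)
    have "map_prod id e (map_prod id (inv_into K e) z) = z" if "z \<in> J" for z
      using that J(2) inv(2)[of "snd z"] by (cases z) auto
    hence "map_prod id e ` ?J = (\<lambda>z. z) ` J" unfolding image_image by (intro image_cong refl)
    hence "map_prod id e ` ?J = J" by simp
    moreover have J': "?J \<subseteq> UNIV \<times> K" using J(2) inv(1) by auto
    ultimately have "T_sum (\<beta> \<circ> e) ?J = x" using S[OF J'] J(3) by simp
    thus "\<exists>J. finite J \<and> J \<subseteq> UNIV \<times> K \<and> T_sum (\<beta> \<circ> e) J = x" using J(1) J' by blast
  qed
qed

text \<open>A maximal subset of \<open>V\<close> that is independent modulo \<open>W\<close> spans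
  \<open>V\<close> modulo \<open>W\<close>, as in linear algebra over the field of two
  elements.\<close>

lemma F2_complement_exists:
  assumes "finite V" and W: "0 \<in> W" "\<And>x y. x \<in> W \<Longrightarrow> y \<in> W \<Longrightarrow> x + y \<in> W"
  shows "\<exists>B\<subseteq>V. (\<forall>J\<subseteq>B. sum id J \<in> W \<longrightarrow> J = {}) \<and> (\<forall>x\<in>V. \<exists>J\<subseteq>B. x + sum id J \<in> (W::'h set))"
proof -
  define \<B> where "\<B> = {B. B \<subseteq> V \<and> (\<forall>J\<subseteq>B. sum id J \<in> W \<longrightarrow> J = {})}"
  have "finite \<B>" by (rule finite_subset[of _ "Pow V"]) (use assms(1) in \<open>auto simp: \<B>_def\<close>)
  moreover have "{} \<in> \<B>" by (auto simp: \<B>_def)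
  ultimately obtain B where B: "B \<in> \<B>" "\<And>B'. B' \<in> \<B> \<Longrightarrow> B \<subseteq> B' \<Longrightarrow> B = B'"
    using finite_has_maximal[of \<B>] by auto
  have "\<exists>J\<subseteq>B. x + sum id J \<in> W" if x: "x \<in> V" for x
  proof (rule ccontr)
    assume no: "\<not> ?thesis"
    have xB: "x \<notin> B"
    proof
      assume "x \<in> B"
      hence "x + sum id {x} \<in> W" using W(1) by (simp add: double)
      thus False using no \<open>x \<in> B\<close> by blast
    qed
    have "insert x B \<in> \<B>"
      unfolding \<B>_def
    proof (intro CollectI conjI allI impI)
      show "insert x B \<subseteq> V" using x B(1) by (auto simp: \<B>_def)
      fix J assume J: "J \<subseteq> insert x B" "sum id J \<in> W"
      have "x \<notin> J"
      proof
        assume "x \<in> J"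
        moreover have "finite J" using finite_subset[OF order_trans[OF J(1) \<open>insert x B \<subseteq> V\<close>] assms(1)] .
        ultimately have "sum id J = x + sum id (J - {x})" using sum.remove[of J x id] by simp
        thus False using no J by (metis Diff_subset_conv insert_is_Un)
      qed
      thus "J = {}" using J B(1) by (auto simp: \<B>_def)
    qed
    thus False using B(2) xB by blast
  qed
  thus ?thesis using B(1) by (auto simp: \<B>_def)
qed

end

section \<open>A basis adapted to a filtration\<close>

text \<open>\<open>F d\<close> behaves like the polynomials of degree less than \<open>d\<close>.
  The equivalence \<open>F_T\<close> says that \<open>T\<close> raises degrees by exactly one, so
  that it is injective on the graded pieces.\<close>

locale filtered_F2T_module = F2T_module +
  fixes F :: "nat \<Rightarrow> 'a set"
  assumes F_add: "x \<in> F d \<Longrightarrow> y \<in> F d \<Longrightarrow> x + y \<in> F d"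
    and F_zero: "F 0 = {0}"
    and F_mono: "F d \<subseteq> F (Suc d)"
    and F_T: "x \<in> H \<Longrightarrow> T x \<in> F (Suc d) \<longleftrightarrow> x \<in> F d"
    and F_union: "H = (\<Union>d. F d)"
begin

lemma F_sub: "F d \<subseteq> H"
  using F_union by auto

lemma F_mono': "d \<le> e \<Longrightarrow> F d \<subseteq> F e"
  using F_mono by (rule lift_Suc_mono_le)

lemma F_0: "0 \<in> F d"
  using F_mono'[of 0 d] F_zero by auto

lemma F_sum: "(\<And>j. j \<in> J \<Longrightarrow> f j \<in> F d) \<Longrightarrow> sum f J \<in> F d"
  by (induction J rule: infinite_finite_induct) (auto intro: F_0 F_add)

lemma F_T_pow: "x \<in> F d \<Longrightarrow> (T ^^ k) x \<in> F (d + k)"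
  using F_sub by (induction k) (auto simp: F_T subset_iff)

text \<open>Two elements of \<open>F (Suc d)\<close> with the same value of
  \<open>\<epsilon>\<close> differ by some \<open>T y\<close> with \<open>y\<close> in
  \<open>F d\<close>; so the fibres of \<open>\<epsilon>\<close> are finite by induction, and there
  are finitely many of them.\<close>

lemma F_finite: "finite (F d)"
proof (induction d)
  case (Suc d)
  have "finite {x \<in> F (Suc d). \<epsilon> x = e}" for e
  proof (cases "\<exists>x0\<in>F (Suc d). \<epsilon> x0 = e")
    case True
    then obtain x0 where x0: "x0 \<in> F (Suc d)" "\<epsilon> x0 = e" by blast
    have "{x \<in> F (Suc d). \<epsilon> x = e} \<subseteq> (\<lambda>y. x0 + T y) ` F d"
    proof clarify
      fix x assume x: "x \<in> F (Suc d)" "e = \<epsilon> x"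
      have in_F: "x0 + x \<in> F (Suc d)" using x0 x F_add by blast
      have "\<epsilon> (x0 + x) = \<epsilon> (x + x)" using x0(2) x(2) by (simp add: eps_add)
      hence "\<epsilon> (x0 + x) = 0" by (simp add: double)
      then obtain y where y: "y \<in> H" "x0 + x = T y" using eps_0_iff in_F F_sub by blast
      hence "y \<in> F d" using in_F F_T by auto
      moreover have "x = x0 + T y" using y(2) by (simp add: eq_add_iff)
      ultimately show "x \<in> (\<lambda>y. x0 + T y) ` F d" by blast
    qed
    thus ?thesis using Suc finite_subset by blast
  qed (use not_finite_existsD in blast)
  hence "finite (\<Union>e\<in>\<epsilon> ` H. {x \<in> F (Suc d). \<epsilon> x = e})" using eps_finite by blast
  moreover have "F (Suc d) \<subseteq> (\<Union>e\<in>\<epsilon> ` H. {x \<in> F (Suc d). \<epsilon> x = e})" using F_sub by auto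
  ultimately show ?case by (rule rev_finite_subset)
qed (simp add: F_zero)

text \<open>The basis is adapted to the filtration: its elements of degree \<open>d + 1\<close> complement
  \<open>F d + T (F d)\<close> in \<open>F (d + 1)\<close>.\<close>

theorem basis_exists: "\<exists>I (\<beta> :: nat \<times> 'a \<Rightarrow> 'a). is_basis I \<beta>"
proof -
  define W where "W d = {x + T y | x y. x \<in> F d \<and> y \<in> F d}" for d
  have W_0: "0 \<in> W d" for d using F_0[of d] by (force simp: W_def)
  have W_add: "x \<in> W d \<Longrightarrow> y \<in> W d \<Longrightarrow> x + y \<in> W d" for x y d
  proof -
    assume "x \<in> W d" "y \<in> W d"
    then obtain a b a' b' where *: "x = a + T b" "y = a' + T b'" "a \<in> F d" "b \<in> F d" "a' \<in> F d" "b' \<in> F d"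
      unfolding W_def by blast
    have "x + y = (a + a') + T (b + b')" using * by (simp add: T_add ac_simps)
    thus "x + y \<in> W d" unfolding W_def using * F_add by blast
  qed
  have "\<exists>B. \<forall>d. B d \<subseteq> F (Suc d) \<and> (\<forall>J\<subseteq>B d. sum id J \<in> W d \<longrightarrow> J = {}) \<and>
      (\<forall>x\<in>F (Suc d). \<exists>J\<subseteq>B d. x + sum id J \<in> W d)"
    by (intro choice allI F2_complement_exists F_finite W_0 W_add)
  then obtain B where B': "\<forall>d. B d \<subseteq> F (Suc d) \<and> (\<forall>J\<subseteq>B d. sum id J \<in> W d \<longrightarrow> J = {}) \<and>
      (\<forall>x\<in>F (Suc d). \<exists>J\<subseteq>B d. x + sum id J \<in> W d)" ..
  note B = B'[rule_format, THEN conjunct1]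
    B'[rule_format, THEN conjunct2, THEN conjunct1, rule_format]
    B'[rule_format, THEN conjunct2, THEN conjunct2, rule_format]
  define I where "I = Sigma UNIV B"
  let ?S = "T_sum snd"
  \<comment> \<open>Modulo sums of elements of \<open>B d\<close>, an element of
    \<open>F (Suc d)\<close> is \<open>y + T z\<close> with both \<open>y\<close> and
    \<open>z\<close> in \<open>F d\<close>.\<close>
  have span: "\<exists>J. finite J \<and> J \<subseteq> UNIV \<times> I \<and> ?S J = x" if "x \<in> F d" for x d
    using that
  proof (induction d arbitrary: x)
    case 0
    thus ?case using F_zero by (intro exI[of _ "{}"]) auto
  next
    case (Suc d)
    obtain K where K: "K \<subseteq> B d" "x + sum id K \<in> W d" using B(3)[OF Suc.prems] by blast
    then obtain y z where yz: "x + sum id K = y + T z" "y \<in> F d" "z \<in> F d" unfolding W_def by blast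
    obtain Jy Jz where J: "finite Jy" "Jy \<subseteq> UNIV \<times> I" "?S Jy = y" "finite Jz" "Jz \<subseteq> UNIV \<times> I" "?S Jz = z"
      using Suc.IH yz by meson
    have finK: "finite K" using finite_subset[OF order_trans[OF K(1) B(1)] F_finite] .
    let ?K = "(\<lambda>b. (0, d, b)) ` K" and ?Jz = "map_prod Suc id ` Jz"
    have SK: "?S ?K = sum id K" unfolding T_sum_def by (subst sum.reindex) (auto simp: inj_on_def)
    have "?S (sym_diff (sym_diff ?K Jy) ?Jz) = sum id K + y + T z"
      using finK J by (simp add: T_sum_sym_diff SK T_sum_shift)
    also have "\<dots> = x" using yz(1) by (metis add.assoc add.commute eq_add_iff)
    finally show ?case using finK J K(1)
      by (intro exI[of _ "sym_diff (sym_diff ?K Jy) ?Jz"]) (auto simp: I_def)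
  qed
  \<comment> \<open>Terms of the same level \<open>d + k = m\<close> lie in
    \<open>F (Suc m)\<close>; their sum falls into \<open>F m\<close> only if there are none. The
    terms with \<open>k = 0\<close> sum to an element of \<open>W m\<close> and so are absent; then
    \<open>T\<close> is cancelled from the others.\<close>
  have top: "J = {}" if "finite J" "J \<subseteq> {(k, d, b). b \<in> B d \<and> d + k = m}" "?S J \<in> F m" for J m
    using that
  proof (induction m arbitrary: J)
    case 0
    show ?case
    proof (rule ccontr)
      assume "J \<noteq> {}"
      have fin0: "{(k, d, b). b \<in> B d \<and> d + k = (0::nat)} = (\<lambda>b. (0, 0, b)) ` B 0" by auto
      then obtain K where K: "K \<subseteq> B 0" "J = (\<lambda>b. (0, 0, b)) ` K"
        using "0.prems"(2) by (auto simp: subset_image_iff)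
      have "?S J = sum id K" unfolding T_sum_def K(2) by (subst sum.reindex) (auto simp: inj_on_def)
      hence "sum id K = 0" using "0.prems"(3) F_zero by auto
      hence "K = {}" using B(2)[OF K(1)] W_0 by simp
      thus False using K \<open>J \<noteq> {}\<close> by simp
    qed
  next
    case (Suc m)
    define K where "K = {b. (0, Suc m, b) \<in> J}"
    define J' where "J' = {(k, d, b). (Suc k, d, b) \<in> J}"
    have K: "K \<subseteq> B (Suc m)" using Suc.prems(2) by (auto simp: K_def)
    have J': "J' \<subseteq> {(k, d, b). b \<in> B d \<and> d + k = m}" using Suc.prems(2) by (auto simp: J'_def)
    have J_eq: "J = (\<lambda>b. (0, Suc m, b)) ` K \<union> map_prod Suc id ` J'"
    proof (rule Set.set_eqI)
      fix z show "z \<in> J \<longleftrightarrow> z \<in> (\<lambda>b. (0, Suc m, b)) ` K \<union> map_prod Suc id ` J'"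
      proof (cases z)
        case (fields k d b)
        thus ?thesis using Suc.prems(2)
          by (cases k) (force simp: K_def J'_def image_iff)+
      qed
    qed
    have fin: "finite K" "finite J'"
      using Suc.prems(1) unfolding J_eq by (auto dest!: finite_imageD simp: inj_on_def)
    have "?S J = ?S ((\<lambda>b. (0, Suc m, b)) ` K) + ?S (map_prod Suc id ` J')"
      unfolding T_sum_def J_eq using fin by (intro sum.union_disjoint) auto
    also have "?S ((\<lambda>b. (0, Suc m, b)) ` K) = sum id K"
      unfolding T_sum_def by (subst sum.reindex) (auto simp: inj_on_def)
    finally have SJ: "?S J = sum id K + T (?S J')" unfolding T_sum_shift .
    have SJ': "?S J' \<in> F (Suc m)"
      unfolding T_sum_def
    proof (rule F_sum)
      fix z assume z: "z \<in> J'"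
      obtain k d b where kdb: "z = (k, d, b)" by (cases z)
      have "b \<in> F (Suc d)" "Suc d + k = Suc m" using z J' B(1) by (auto simp: kdb)
      from F_T_pow[OF this(1), of k] this(2)
      show "(case z of (k, i) \<Rightarrow> (T ^^ k) (snd i)) \<in> F (Suc m)" by (simp add: kdb)
    qed
    have "sum id K = ?S J + T (?S J')" unfolding SJ by (simp add: add.assoc double)
    hence "sum id K \<in> W (Suc m)" unfolding W_def using SJ' Suc.prems(3) by blast
    hence "K = {}" using B(2)[OF K] by blast
    hence "T (?S J') \<in> F (Suc m)" using SJ Suc.prems(3) by simp
    hence "?S J' \<in> F m" using F_T SJ' F_sub by blast
    hence "J' = {}" using Suc.IH[OF fin(2) J'] by blast
    thus ?case using J_eq \<open>K = {}\<close> by simp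
  qed
  \<comment> \<open>In a relation all terms below the highest level \<open>m\<close> lie in
    \<open>F m\<close>, so the terms of level \<open>m\<close> sum to an element of
    \<open>F m\<close> as well, and \<open>top\<close> excludes them.\<close>
  have indep: "J = {}" if J: "finite J" "J \<subseteq> UNIV \<times> I" "?S J = 0" for J
  proof (rule ccontr)
    assume ne: "J \<noteq> {}"
    define lev where "lev = (\<lambda>(k, d, b :: 'a). d + k :: nat)"
    define m where "m = Max (lev ` J)"
    have le: "lev z \<le> m" if "z \<in> J" for z using that J(1) by (simp add: m_def)
    have "m \<in> lev ` J" unfolding m_def using J(1) ne by (intro Max_in) auto
    then obtain z0 where z0: "z0 \<in> J" "lev z0 = m" by blast
    define J1 where "J1 = {z\<in>J. lev z = m}"
    have "?S J = ?S (J - J1) + ?S J1"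
      unfolding T_sum_def by (rule sum.subset_diff) (use J(1) in \<open>auto simp: J1_def\<close>)
    hence "?S J1 = ?S (J - J1)" using J(3) by (metis add.right_neutral eq_add_iff)
    moreover have "?S (J - J1) \<in> F m" unfolding T_sum_def
    proof (rule F_sum)
      fix z assume z: "z \<in> J - J1"
      obtain k d b where kdb: "z = (k, d, b)" by (cases z)
      have b: "b \<in> F (Suc d)" using z J(2) B(1) by (auto simp: kdb I_def)
      have "lev z < m" using z le by (fastforce simp: J1_def)
      hence "F (Suc d + k) \<subseteq> F m" by (intro F_mono') (simp add: kdb lev_def)
      thus "(case z of (k, i) \<Rightarrow> (T ^^ k) (snd i)) \<in> F m" using F_T_pow[OF b, of k] by (auto simp: kdb)
    qed
    ultimately have "J1 = {}"
      using J by (intro top[of J1 m]) (auto simp: J1_def I_def lev_def)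
    thus False using z0 unfolding J1_def by blast
  qed
  have "is_basis I snd" unfolding is_basis_def
  proof (intro conjI allI impI ballI)
    show "snd ` I \<subseteq> H" using B(1) F_sub by (fastforce simp: I_def)
    show "J = {}" if "finite J" "J \<subseteq> UNIV \<times> I" "?S J = 0" for J using that by (rule indep)
    show "\<exists>J. finite J \<and> J \<subseteq> UNIV \<times> I \<and> ?S J = x" if x: "x \<in> H" for x
    proof -
      obtain d where "x \<in> F d" using x F_union by auto
      thus ?thesis by (rule span)
    qed
  qed
  thus ?thesis by blast
qed

end


section \<open>Coordinates on the tensor product\<close>

no_notation fps_nth (infixl "$" 75)

type_synonym 'c coords = "('c fps ^ 2) \<times> ('c fps ^ 2)"

definition smul :: "'c::field fps \<Rightarrow> 'c coords \<Rightarrow> 'c coords"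
  where "smul f h = ((\<chi> i. f * fst h $ i), (\<chi> i. f * snd h $ i))"

lemma coords_eqI: "(\<And>i. fst h $ i = fst h' $ i) \<Longrightarrow> (\<And>i. snd h $ i = snd h' $ i) \<Longrightarrow> h = (h' :: 'c coords)"
  by (simp add: prod_eq_iff vec_eq_iff)

lemma smul_nth [simp]: "fst (smul f h) $ i = f * fst h $ i" "snd (smul f h) $ i = f * snd h $ i"
  by (simp_all add: smul_def)

lemma smul_add_right: "smul f (h + h') = smul f h + smul f h'"
  by (rule coords_eqI) (simp_all add: distrib_left)

lemma smul_add_left: "smul (f + g) h = smul f h + smul g h"
  by (rule coords_eqI) (simp_all add: distrib_right)

lemma smul_smul: "smul f (smul g h) = smul (f * g) h"
  by (rule coords_eqI) (simp_all add: mult.assoc)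

lemma smul_0_right [simp]: "smul f 0 = 0"
  by (rule coords_eqI) simp_all

lemma smul_0_left [simp]: "smul 0 h = 0"
  by (rule coords_eqI) simp_all

lemma smul_1 [simp]: "smul 1 h = h"
  by (rule coords_eqI) simp_all

lemma smul_sum_right: "smul f (sum g I) = (\<Sum>i\<in>I. smul f (g i))"
  by (induction I rule: infinite_finite_induct) (simp_all add: smul_add_right)

lemma smul_sum_left: "smul (sum g I) h = (\<Sum>i\<in>I. smul (g i) h)"
  by (induction I rule: infinite_finite_induct) (simp_all add: smul_add_left)

lemma fps_of_poly_sum_monom:
  "degree p \<le> N \<Longrightarrow> fps_of_poly p = (\<Sum>k\<le>N. fps_const (coeff p k) * fps_X ^ k)"
  by (rule fps_ext) (auto simp: fps_sum_nth fps_X_power_nth coeff_eq_0 if_distrib cong: if_cong)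

context C_infinity
begin

section \<open>Convergent power series and the Frobenius on their coefficients\<close>

lemma fps_double [simp]: "f + f = (0 :: 'c fps)"
  by (rule fps_ext) simp

lemma coords_double: "h + h = (0 :: 'c coords)"
  by (rule coords_eqI) simp_all

lemma motive_double: "m + m = (0 :: 'c motive)"
  unfolding vec_eq_iff poly_eq_iff
  by (simp only: vector_add_component coeff_add char2_double zero_index coeff_0 simp_thms)

lemma tate_tau_nth [simp]: "fps_nth (tate_tau f) n = fps_nth f n ^ 2"
  by (simp add: tate_tau_def)

lemma square_sum: "(sum f I) ^ 2 = (\<Sum>i\<in>I. f i ^ 2 :: 'c)"
  by (induction I rule: infinite_finite_induct) (simp_all add: square_add)

lemma tate_tau_add: "tate_tau (f + g) = tate_tau f + (tate_tau g :: 'c fps)"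
  by (rule fps_ext) (simp add: square_add)

lemma tate_tau_mult: "tate_tau (f * g) = tate_tau f * (tate_tau g :: 'c fps)"
  by (rule fps_ext) (simp add: fps_mult_nth square_sum power_mult_distrib)

lemma tate_tau_const [simp]: "tate_tau (fps_const a) = fps_const (a ^ 2)"
  by (rule fps_ext) simp

lemma tate_tau_0 [simp]: "tate_tau 0 = (0 :: 'c fps)"
  by (rule fps_ext) simp

lemma tate_tau_1 [simp]: "tate_tau 1 = (1 :: 'c fps)"
  by (rule fps_ext) simp

lemma tate_tau_X [simp]: "tate_tau fps_X = (fps_X :: 'c fps)"
  by (rule fps_ext) (simp add: fps_X_def)

lemma tate_iff: "f \<in> tate ord \<longleftrightarrow> (\<forall>B. eventually (\<lambda>n. ord_ge B (fps_nth f n)) sequentially)"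
  by (simp add: tate_def val_tendsto_iff)

lemma tate_0 [simp]: "0 \<in> tate ord"
  by (simp add: tate_iff)

lemma tate_add [intro]: "f \<in> tate ord \<Longrightarrow> g \<in> tate ord \<Longrightarrow> f + g \<in> tate ord"
  unfolding tate_iff fps_add_nth by (blast intro: eventually_elim2 ord_ge_add)

lemma tate_const_mult [intro]:
  assumes "f \<in> tate ord" shows "fps_const a * f \<in> tate ord"
  unfolding tate_iff
proof
  fix B
  obtain r where r: "ord_ge r a" using ord_ge_exists by blast
  have "eventually (\<lambda>n. ord_ge (B - r) (fps_nth f n)) sequentially" using assms tate_iff by blast
  thus "eventually (\<lambda>n. ord_ge B (fps_nth (fps_const a * f) n)) sequentially"
    by eventually_elim (auto intro: ord_ge_mult'[OF r])
qed

lemma tate_X_mult_iff [simp]: "fps_X * f \<in> tate ord \<longleftrightarrow> f \<in> tate ord"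
proof -
  have "eventually (\<lambda>n. ord_ge B (fps_nth (fps_X * f) n)) sequentially \<longleftrightarrow>
      eventually (\<lambda>n. ord_ge B (fps_nth f n)) sequentially" for B
    using eventually_sequentially_Suc[of "\<lambda>n. ord_ge B (fps_nth (fps_X * f) n)"] by simp
  thus ?thesis by (simp add: tate_iff)
qed

lemma tate_poly_mult [intro]: "f \<in> tate ord \<Longrightarrow> fps_of_poly p * f \<in> tate ord"
proof (induction p)
  case (pCons a p)
  have "fps_of_poly (pCons a p) * f = fps_const a * f + fps_X * (fps_of_poly p * f)"
    by (simp add: fps_of_poly_pCons algebra_simps)
  thus ?case using pCons by auto
qed auto

lemma tate_tau_tate [intro]: assumes "f \<in> tate ord" shows "tate_tau f \<in> tate ord"
  unfolding tate_iff
proof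
  fix B
  have "eventually (\<lambda>n. ord_ge (B / 2) (fps_nth f n)) sequentially" using assms tate_iff by blast
  thus "eventually (\<lambda>n. ord_ge B (fps_nth (tate_tau f) n)) sequentially"
    by eventually_elim (auto intro: ord_ge_power')
qed

lemma tate_sum: "(\<And>i. i \<in> I \<Longrightarrow> f i \<in> tate ord) \<Longrightarrow> sum f I \<in> tate ord"
  by (induction I rule: infinite_finite_induct) auto


end

locale t_motive = C_infinity ord \<theta>
  for ord :: "'c::field \<Rightarrow> ereal" and \<theta> +
  fixes A :: "'c ^ 2 ^ 2"
begin

text \<open>The pair \<open>(f, g)\<close> stands for \<open>\<Sum>\<^sub>i e\<^sub>i \<otimes> f\<^sub>i + \<tau> e\<^sub>i \<otimes> g\<^sub>i\<close>; the formula for \<open>\<tau>\<close> comes from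
  \<open>\<tau>\<^sup>2 e\<^sub>i = (T - \<theta>) e\<^sub>i - \<Sum>\<^sub>j a\<^sub>i\<^sub>j \<tau> e\<^sub>j\<close>, written without signs in characteristic 2.\<close>

definition coords_tau :: "'c coords \<Rightarrow> 'c coords"
  where "coords_tau h = ((\<chi> i. (fps_X + fps_const \<theta>) * tate_tau (snd h $ i)),
    (\<chi> j. tate_tau (fst h $ j) + (\<Sum>i\<in>UNIV. fps_const (A $ i $ j) * tate_tau (snd h $ i))))"

definition coords_basis :: "2 \<Rightarrow> 'c coords"
  where "coords_basis i = (axis i 1, 0)"

text \<open>Sends \<open>\<tau>\<^sup>k e\<^sub>i\<close> to an iterate of
  \<open>coords_tau\<close>, so that compatibility with \<open>\<tau>\<close> is built in and
  compatibility with \<open>T\<close> is what has to be proved.\<close>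

definition coords :: "'c motive \<Rightarrow> 'c coords"
  where "coords m = (\<Sum>i\<in>UNIV. \<Sum>k\<le>degree (m $ i).
    smul (fps_const (coeff (m $ i) k)) ((coords_tau ^^ k) (coords_basis i)))"

lemma coords_tau_add: "coords_tau (h + h') = coords_tau h + coords_tau h'"
  by (rule coords_eqI) (simp_all add: coords_tau_def tate_tau_add distrib_left sum.distrib ac_simps)

lemma coords_tau_smul: "coords_tau (smul f h) = smul (tate_tau f) (coords_tau h)"
  by (rule coords_eqI) (simp_all add: coords_tau_def tate_tau_mult distrib_left sum_distrib_left ac_simps)

lemma coords_tau_0 [simp]: "coords_tau 0 = 0"
  by (rule coords_eqI) (simp_all add: coords_tau_def)

lemma coords_tau_sum: "coords_tau (sum f I) = (\<Sum>i\<in>I. coords_tau (f i))"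
  by (induction I rule: infinite_finite_induct) (simp_all add: coords_tau_add)

lemma coords_tau_pow_smul_X: "(coords_tau ^^ k) (smul fps_X h) = smul fps_X ((coords_tau ^^ k) h)"
  by (induction k) (simp_all add: coords_tau_smul)

lemma coords_eq_sum:
  assumes "\<And>i. degree (m $ i) \<le> N"
  shows "coords m = (\<Sum>i\<in>UNIV. \<Sum>k\<le>N.
    smul (fps_const (coeff (m $ i) k)) ((coords_tau ^^ k) (coords_basis i)))"
  unfolding coords_def
  by (intro sum.cong refl sum.mono_neutral_left) (use assms in \<open>auto simp: coeff_eq_0\<close>)

lemma motive_degree_bound: "\<exists>N. \<forall>i. degree ((m :: 'c motive) $ i) \<le> N"
  by (intro exI[of _ "\<Sum>i\<in>UNIV. degree (m $ i)"] allI member_le_sum) auto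

lemma coords_add: "coords (m + m') = coords m + coords m'"
proof -
  obtain N N' where N: "\<And>i. degree (m $ i) \<le> N" "\<And>i. degree (m' $ i) \<le> N'"
    using motive_degree_bound by meson
  have "degree (m $ i) \<le> max N N'" "degree (m' $ i) \<le> max N N'" "degree ((m + m') $ i) \<le> max N N'" for i
    using N[of i] by (auto intro: degree_add_le)
  thus ?thesis
    by (simp add: coords_eq_sum[of _ "max N N'"] smul_add_left sum.distrib fps_const_add[symmetric] del: fps_const_add)
qed

lemma coords_scale: "coords (M_scale a m) = smul (fps_const a) (coords m)"
proof -
  obtain N where N: "\<And>i. degree (m $ i) \<le> N" using motive_degree_bound by blast
  hence "degree (M_scale a m $ i) \<le> N" for i
    unfolding M_scale_def by (simp add: order_trans[OF degree_smult_le])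
  thus ?thesis using N
    by (simp add: coords_eq_sum[of _ N] smul_sum_right smul_smul M_scale_def)
qed

lemma M_tau_nth_coeff: "coeff (M_tau m $ i) k = (case k of 0 \<Rightarrow> 0 | Suc k \<Rightarrow> coeff (m $ i) k ^ 2)"
  for m :: "'c motive"
  by (simp add: M_tau_def coeff_pCons coeff_map_poly split: nat.splits)

lemma coords_M_tau: "coords (M_tau m) = coords_tau (coords m)"
proof -
  obtain N where N: "\<And>i. degree (m $ i) \<le> N" using motive_degree_bound by blast
  have "degree (M_tau m $ i) \<le> Suc N" for i
    by (rule degree_le) (use N[of i] in \<open>auto simp: M_tau_nth_coeff coeff_eq_0 split: nat.splits\<close>)
  thus ?thesis using N
    by (simp add: coords_eq_sum[of m N] coords_eq_sum[of "M_tau m" "Suc N"] sum.atMost_Suc_shift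
      coords_tau_sum coords_tau_smul M_tau_nth_coeff del: sum.atMost_Suc)
qed

lemma coords_M_tau_pow: "coords ((M_tau ^^ k) m) = (coords_tau ^^ k) (coords m)"
  by (induction k) (simp_all add: coords_M_tau)

lemma coords_0 [simp]: "coords 0 = 0"
  by (simp add: coords_def)

lemma coords_sum: "coords (sum f I) = (\<Sum>i\<in>I. coords (f i))"
  by (induction I rule: infinite_finite_induct) (simp_all add: coords_add)

lemma coords_M_basis: "coords (M_basis i) = coords_basis i"
proof -
  have "coords (M_basis i) = (\<Sum>j\<in>UNIV. if j = i then coords_basis i else 0)"
    unfolding coords_def by (intro sum.cong) (auto simp: M_basis_def axis_def)
  thus ?thesis by simp
qed

lemma coords_tau_basis: "coords_tau (coords_basis i) = (0, axis i 1)"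
  by (rule coords_eqI) (simp_all add: coords_tau_def coords_basis_def axis_def)

text \<open>\<open>coords_tau\<close> comes from solving the definition of
  \<open>T e\<^sub>i\<close> for \<open>\<tau>\<^sup>2 e\<^sub>i\<close>; put back, the terms with
  \<open>\<theta>\<close> and \<open>A\<close> occur twice and cancel.\<close>

lemma coords_M_T_basis: "coords (M_T_basis \<theta> A i) = smul fps_X (coords_basis i)"
proof -
  have "coords (M_T_basis \<theta> A i) = smul (fps_const \<theta>) (coords_basis i)
      + (\<Sum>j\<in>UNIV. smul (fps_const (A $ i $ j)) (0, axis j 1)) + coords_tau (0, axis i 1)"
    unfolding M_T_basis_def
    by (simp add: coords_add coords_sum coords_scale coords_M_tau coords_M_basis coords_tau_basis)
  also have "\<dots> = smul fps_X (coords_basis i)"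
  proof (rule coords_eqI)
    fix j
    show "fst (smul (fps_const \<theta>) (coords_basis i)
      + (\<Sum>j\<in>UNIV. smul (fps_const (A $ i $ j)) (0, axis j 1)) + coords_tau (0, axis i 1)) $ j
      = fst (smul fps_X (coords_basis i)) $ j"
      by (simp add: fst_sum coords_basis_def axis_def coords_tau_def)
    show "snd (smul (fps_const \<theta>) (coords_basis i)
      + (\<Sum>j\<in>UNIV. smul (fps_const (A $ i $ j)) (0, axis j 1)) + coords_tau (0, axis i 1)) $ j
      = snd (smul fps_X (coords_basis i)) $ j"
      by (simp add: snd_sum coords_basis_def axis_def coords_tau_def if_distrib if_distribR cong: if_cong)
  qed
  finally show ?thesis .
qed

lemma coords_M_T: "coords (M_T \<theta> A m) = smul fps_X (coords m)"
proof -
  have "coords (M_T \<theta> A m) = (\<Sum>i\<in>UNIV. \<Sum>k\<le>degree (m $ i).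
      smul (fps_const (coeff (m $ i) k)) ((coords_tau ^^ k) (smul fps_X (coords_basis i))))"
    unfolding M_T_def by (simp add: coords_sum coords_scale coords_M_tau_pow coords_M_T_basis)
  thus ?thesis
    by (simp add: coords_tau_pow_smul_X coords_def smul_sum_right smul_smul mult.commute)
qed

lemma coords_M_poly: "coords (M_poly \<theta> A p m) = smul (fps_of_poly p) (coords m)"
proof -
  have "coords ((M_T \<theta> A ^^ k) m) = smul (fps_X ^ k) (coords m)" for k
    by (induction k) (simp_all add: coords_M_T smul_smul)
  thus ?thesis
    by (simp add: M_poly_def coords_sum coords_scale smul_smul smul_sum_left fps_of_poly_sum_monom[OF order_refl])
qed

end


text \<open>A standard representative of given coordinates in the free abelian group; it is additive
  only modulo the relations.\<close>

definition coords_rep :: "'c::field coords \<Rightarrow> 'c motive \<times> 'c fps \<Rightarrow>\<^sub>0 int"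
  where "coords_rep h = (\<Sum>i\<in>UNIV. frag_of (M_basis i, fst h $ i) + frag_of (M_tau (M_basis i), snd h $ i))"

context t_motive
begin

section \<open>The relations as the kernel of the coordinate map\<close>

abbreviation "Free \<equiv> tensor_free ord"
abbreviation "Null \<equiv> tensor_null ord \<theta> A"
abbreviation "Tens \<equiv> tensor ord \<theta> A"

definition tate_coords :: "'c coords set"
  where "tate_coords = {h. \<forall>i. fst h $ i \<in> tate ord \<and> snd h $ i \<in> tate ord}"

text \<open>The homomorphism that takes the symbol \<open>(m, f)\<close> to
  \<open>smul f (coords m)\<close>. The aim is that its kernel on \<open>Free\<close> is
  \<open>Null\<close>, so that cosets are determined by coordinates.\<close>

definition frag_coords :: "('c motive \<times> 'c fps \<Rightarrow>\<^sub>0 int) \<Rightarrow> 'c coords"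
  where "frag_coords x = (\<Sum>z\<in>Poly_Mapping.keys x.
    smul (of_int (Poly_Mapping.lookup x z) * snd z) (coords (fst z)))"

lemma frag_coords_eq_sum:
  assumes "finite S" "Poly_Mapping.keys x \<subseteq> S"
  shows "frag_coords x = (\<Sum>z\<in>S. smul (of_int (Poly_Mapping.lookup x z) * snd z) (coords (fst z)))"
  unfolding frag_coords_def
  by (intro sum.mono_neutral_left) (use assms in \<open>auto simp: in_keys_iff\<close>)

lemma frag_coords_add: "frag_coords (x + y) = frag_coords x + frag_coords y"
proof -
  let ?S = "Poly_Mapping.keys x \<union> Poly_Mapping.keys y"
  have "Poly_Mapping.keys (x + y) \<subseteq> ?S" by (rule Poly_Mapping.keys_add)
  thus ?thesis
    by (simp add: frag_coords_eq_sum[of ?S] lookup_add distrib_right smul_add_left sum.distrib)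
qed

lemma frag_coords_0 [simp]: "frag_coords 0 = 0"
  by (simp add: frag_coords_def)

lemma coords_minus [simp]: "- h = (h :: 'c coords)"
  using coords_double[of h] by (simp add: neg_eq_iff_add_eq_0)

lemma frag_coords_minus [simp]: "frag_coords (- x) = frag_coords x"
  using frag_coords_add[of x "- x"] by (metis add.right_inverse coords_minus frag_coords_0 neg_eq_iff_add_eq_0)

lemma frag_coords_diff: "frag_coords (x - y) = frag_coords x + frag_coords y"
  using frag_coords_add[of x "- y"] by simp

lemma frag_coords_of [simp]: "frag_coords (frag_of (m, f)) = smul f (coords m)"
  by (simp add: frag_coords_def)

lemma frag_coords_sum: "frag_coords (sum f I) = (\<Sum>i\<in>I. frag_coords (f i))"
  by (induction I rule: infinite_finite_induct) (simp_all add: frag_coords_add)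

lemma coords_expand:
  "h = (\<Sum>i\<in>UNIV. smul (fst h $ i) (coords_basis i) + smul (snd h $ i) (0, axis i 1))"
proof -
  have "c * axis i 1 $ j = (if j = i then c else 0)" for c :: "'c fps" and i j :: 2
    by (simp add: axis_def)
  thus ?thesis
    by (intro coords_eqI) (simp_all add: fst_sum snd_sum coords_basis_def sum.distrib)
qed

lemma frag_coords_rep [simp]: "frag_coords (coords_rep h) = h"
  unfolding coords_rep_def
  by (simp add: frag_coords_sum frag_coords_add coords_M_tau coords_M_basis coords_tau_basis
      coords_expand[of h, symmetric])

lemma in_Free: "x \<in> carrier Free \<longleftrightarrow> Poly_Mapping.keys x \<subseteq> UNIV \<times> tate ord"
  by (simp add: tensor_free_def)

lemma Free_group: "group Free" and Free_comm: "comm_group Free"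
  by (simp_all add: tensor_free_def abelian_free_Abelian_group)

lemma Free_of: "f \<in> tate ord \<Longrightarrow> frag_of (m, f) \<in> carrier Free"
  by (simp add: in_Free)

lemma Free_diff: "x \<in> carrier Free \<Longrightarrow> y \<in> carrier Free \<Longrightarrow> x - y \<in> carrier Free"
  unfolding in_Free using keys_diff[of x y] by blast

lemma Free_add: "x \<in> carrier Free \<Longrightarrow> y \<in> carrier Free \<Longrightarrow> x + y \<in> carrier Free"
  unfolding in_Free using Poly_Mapping.keys_add[of x y] by blast

lemma Free_0: "0 \<in> carrier Free"
  by (simp add: in_Free)

lemma Free_sum: "(\<And>i. i \<in> I \<Longrightarrow> f i \<in> carrier Free) \<Longrightarrow> sum f I \<in> carrier Free"
  by (induction I rule: infinite_finite_induct) (auto intro: Free_add Free_0)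

lemma rels_in_Free: "tensor_rels ord \<theta> A \<subseteq> carrier Free"
  unfolding tensor_rels_def
  by (auto intro!: Free_diff Free_of)

lemma Null_subgroup: "subgroup Null Free"
  unfolding tensor_null_def by (rule group.generate_is_subgroup[OF Free_group rels_in_Free])

lemma Null_in_Free: "x \<in> Null \<Longrightarrow> x \<in> carrier Free"
  using subgroup.mem_carrier[OF Null_subgroup] .

lemma Null_0 [simp]: "0 \<in> Null"
  using subgroup.one_closed[OF Null_subgroup] by (simp add: tensor_free_def)

lemma Null_add: "x \<in> Null \<Longrightarrow> y \<in> Null \<Longrightarrow> x + y \<in> Null"
  using subgroup.m_closed[OF Null_subgroup] by (simp add: tensor_free_def)

lemma Null_uminus: "x \<in> Null \<Longrightarrow> - x \<in> Null"
  using subgroup.m_inv_closed[OF Null_subgroup, of x] Null_in_Free[of x]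
  by (simp add: tensor_free_def)

lemma Null_diff: "x \<in> Null \<Longrightarrow> y \<in> Null \<Longrightarrow> x - y \<in> Null"
  using Null_add[of x "- y"] Null_uminus by simp

lemma Null_sum: "(\<And>i. i \<in> I \<Longrightarrow> f i \<in> Null) \<Longrightarrow> sum f I \<in> Null"
  by (induction I rule: infinite_finite_induct) (auto intro: Null_add)

lemma Null_rel_add_left: "f \<in> tate ord \<Longrightarrow> frag_of (m + m', f) - frag_of (m, f) - frag_of (m', f) \<in> Null"
  unfolding tensor_null_def by (rule generate.incl) (auto simp: tensor_rels_def)

lemma Null_rel_add_right:
  "f \<in> tate ord \<Longrightarrow> g \<in> tate ord \<Longrightarrow> frag_of (m, f + g) - frag_of (m, f) - frag_of (m, g) \<in> Null"
  unfolding tensor_null_def by (rule generate.incl) (auto simp: tensor_rels_def)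

lemma Null_rel_poly:
  "f \<in> tate ord \<Longrightarrow> frag_of (M_poly \<theta> A p m, f) - frag_of (m, fps_of_poly p * f) \<in> Null"
  unfolding tensor_null_def by (rule generate.incl) (auto simp: tensor_rels_def)

lemma Null_of_0: "frag_of (m, 0) \<in> Null"
  using Null_uminus[OF Null_rel_add_right[of 0 0 m]] by simp

lemma rel_coords: "x \<in> tensor_rels ord \<theta> A \<Longrightarrow> frag_coords x = 0"
  unfolding tensor_rels_def
  by (auto simp: frag_coords_diff coords_add smul_add_right smul_add_left coords_M_poly smul_smul
      coords_double mult.commute ac_simps)

lemma Null_coords:
  assumes "x \<in> Null" shows "frag_coords x = 0"
  using assms unfolding tensor_null_def
proof (induction rule: generate.induct)
  case one
  thus ?case by (simp add: tensor_free_def)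
next
  case (incl h)
  thus ?case by (rule rel_coords)
next
  case (inv h)
  hence "h \<in> carrier Free" using rels_in_Free by blast
  thus ?case using rel_coords[OF inv] by (simp add: tensor_free_def)
next
  case (eng h1 h2)
  thus ?case by (simp add: tensor_free_def frag_coords_add)
qed

lemma Null_trans: "x - y \<in> Null \<Longrightarrow> y - z \<in> Null \<Longrightarrow> x - z \<in> Null"
  using Null_add[of "x - y" "y - z"] by simp

lemma coords_rep_Null_add:
  assumes "h \<in> tate_coords" "h' \<in> tate_coords"
  shows "coords_rep (h + h') - (coords_rep h + coords_rep h') \<in> Null"
proof -
  have "coords_rep (h + h') - (coords_rep h + coords_rep h') =
    (\<Sum>i\<in>UNIV. (frag_of (M_basis i, fst h $ i + fst h' $ i) - frag_of (M_basis i, fst h $ i) - frag_of (M_basis i, fst h' $ i))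
     + (frag_of (M_tau (M_basis i), snd h $ i + snd h' $ i) - frag_of (M_tau (M_basis i), snd h $ i)
          - frag_of (M_tau (M_basis i), snd h' $ i)))"
    unfolding coords_rep_def sum.distrib[symmetric] sum_subtractf[symmetric]
    by (intro sum.cong) simp_all
  thus ?thesis using assms
    by (auto simp: tate_coords_def intro!: Null_sum Null_add Null_rel_add_right)
qed

lemma coords_rep_in_Free: "h \<in> tate_coords \<Longrightarrow> coords_rep h \<in> carrier Free"
  unfolding coords_rep_def by (intro Free_sum Free_add Free_of) (auto simp: tate_coords_def)

lemma tate_coords_add: "h \<in> tate_coords \<Longrightarrow> h' \<in> tate_coords \<Longrightarrow> h + h' \<in> tate_coords"
  by (auto simp: tate_coords_def)

lemma tate_coords_0 [simp]: "0 \<in> tate_coords"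
  by (auto simp: tate_coords_def)

lemma tate_coords_poly: "h \<in> tate_coords \<Longrightarrow> smul (fps_of_poly p) h \<in> tate_coords"
  by (auto simp: tate_coords_def)

section \<open>Generation of the motive by four elements\<close>

lemma M_tau_pow_basis_nth:
  "(M_tau ^^ k) (M_basis i :: 'c motive) $ j = (if j = i then monom 1 k else 0)"
proof (induction k)
  case (Suc k)
  thus ?case
    by (intro poly_eqI) (auto simp: M_tau_nth_coeff coeff_monom split: nat.splits)
qed (simp add: M_basis_def axis_def)

lemma M_T_tau_pow_basis: "M_T \<theta> A ((M_tau ^^ k) (M_basis i)) = (M_tau ^^ k) (M_T_basis \<theta> A i)"
proof -
  have deg: "degree (monom (1 :: 'c) k) = k" by (rule Polynomial.degree_monom_eq) simp
  have *: "M_scale 0 m = 0" "M_scale 1 m = m" for m :: "'c motive"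
    by (simp_all add: M_scale_def vec_eq_iff)
  have "M_T \<theta> A ((M_tau ^^ k) (M_basis i)) =
    (\<Sum>j\<in>UNIV. if j = i then (M_tau ^^ k) (M_T_basis \<theta> A i) else 0)"
    unfolding M_T_def M_tau_pow_basis_nth
  proof (intro sum.cong refl)
    fix j :: 2
    have "(\<Sum>l\<le>k. M_scale (if k = l then 1 else 0) ((M_tau ^^ l) (M_T_basis \<theta> A i))) =
        (\<Sum>l\<le>k. if l = k then (M_tau ^^ k) (M_T_basis \<theta> A i) else 0)"
      by (intro sum.cong) (auto simp: *)
    thus "(\<Sum>l\<le>degree (if j = i then monom 1 k else 0 :: 'c poly).
         M_scale (coeff (if j = i then monom 1 k else 0) l) ((M_tau ^^ l) (M_T_basis \<theta> A j))) =
      (if j = i then (M_tau ^^ k) (M_T_basis \<theta> A i) else 0)"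
      by (cases "j = i") (simp_all add: * deg)
  qed
  thus ?thesis by simp
qed

lemma M_tau_add: "M_tau (m + m') = M_tau m + (M_tau m' :: 'c motive)"
  by (simp add: vec_eq_iff poly_eq_iff M_tau_nth_coeff square_add split: nat.splits)

lemma M_tau_0: "M_tau 0 = (0 :: 'c motive)"
  by (simp add: vec_eq_iff poly_eq_iff M_tau_nth_coeff split: nat.splits)

lemma M_tau_scale: "M_tau (M_scale a m) = M_scale (a ^ 2) (M_tau m :: 'c motive)"
  by (simp add: vec_eq_iff poly_eq_iff M_tau_nth_coeff M_scale_def power_mult_distrib split: nat.splits)

lemma M_tau_pow_add: "(M_tau ^^ k) (m + m') = (M_tau ^^ k) m + ((M_tau ^^ k) m' :: 'c motive)"
  by (induction k) (simp_all add: M_tau_add)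

lemma M_tau_pow_sum: "(M_tau ^^ k) (sum f I) = (\<Sum>i\<in>I. (M_tau ^^ k) (f i :: 'c motive))"
proof -
  have "(M_tau ^^ k) 0 = (0 :: 'c motive)" by (induction k) (simp_all add: M_tau_0)
  thus ?thesis by (induction I rule: infinite_finite_induct) (simp_all add: M_tau_pow_add)
qed

lemma M_tau_pow_scale: "(M_tau ^^ k) (M_scale a m) = M_scale (a ^ (2 ^ k)) ((M_tau ^^ k) (m :: 'c motive))"
  by (induction k) (simp_all add: M_tau_scale power_mult[symmetric] mult.commute)

lemma motive_expand:
  "(m :: 'c motive) = (\<Sum>i\<in>UNIV. \<Sum>k\<le>degree (m $ i). M_scale (coeff (m $ i) k) ((M_tau ^^ k) (M_basis i)))"
proof -
  have "(\<Sum>i\<in>UNIV. \<Sum>k\<le>degree (m $ i). M_scale (coeff (m $ i) k) ((M_tau ^^ k) (M_basis i))) $ j = m $ j" for j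
  proof -
    have "(\<Sum>i\<in>UNIV. \<Sum>k\<le>degree (m $ i). M_scale (coeff (m $ i) k) ((M_tau ^^ k) (M_basis i))) $ j =
      (\<Sum>i\<in>UNIV. if i = j then (\<Sum>k\<le>degree (m $ i). monom (coeff (m $ i) k) k) else 0)"
      unfolding sum_component
      by (intro sum.cong refl) (auto simp: M_scale_def M_tau_pow_basis_nth smult_monom)
    thus ?thesis by (simp add: poly_as_sum_of_monoms)
  qed
  thus ?thesis by (simp add: vec_eq_iff)
qed

text \<open>In the tensor product, every symbol \<open>(m, f)\<close> is the combination of the four
  basis symbols that \<open>coords\<close> predicts. This property passes through all operations by
  which \<open>m\<close> is built from the basis.\<close>

definition generated :: "'c motive \<Rightarrow> bool"
  where "generated m \<longleftrightarrow> (\<forall>f\<in>tate ord. smul f (coords m) \<in> tate_coords \<and>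
    frag_of (m, f) - coords_rep (smul f (coords m)) \<in> Null)"

lemma generated_add:
  assumes "generated m" "generated m'"
  shows "generated (m + m')"
  unfolding generated_def
proof (intro ballI conjI)
  fix f assume f: "f \<in> tate ord"
  let ?u = "smul f (coords m)" and ?u' = "smul f (coords m')"
  have u: "?u \<in> tate_coords" "?u' \<in> tate_coords"
    "frag_of (m, f) - coords_rep ?u \<in> Null" "frag_of (m', f) - coords_rep ?u' \<in> Null"
    using assms f by (auto simp: generated_def)
  show "smul f (coords (m + m')) \<in> tate_coords"
    using u by (simp add: coords_add smul_add_right tate_coords_add)
  have "(frag_of (m + m', f) - frag_of (m, f) - frag_of (m', f)) + (frag_of (m, f) - coords_rep ?u)
      + (frag_of (m', f) - coords_rep ?u') - (coords_rep (?u + ?u') - (coords_rep ?u + coords_rep ?u')) \<in> Null"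
    by (intro Null_add Null_diff u Null_rel_add_left f coords_rep_Null_add)
  thus "frag_of (m + m', f) - coords_rep (smul f (coords (m + m'))) \<in> Null"
    by (simp add: coords_add smul_add_right)
qed

lemma generated_0: "generated 0"
  unfolding generated_def
proof (intro ballI conjI)
  fix f assume f: "f \<in> tate ord"
  have "- (frag_of (0 + 0 :: 'c motive, f) - frag_of (0, f) - frag_of (0, f)) - coords_rep 0 \<in> Null"
    unfolding coords_rep_def
    by (intro Null_uminus Null_diff Null_rel_add_left Null_sum Null_add f) (simp_all add: Null_of_0)
  thus "frag_of (0, f) - coords_rep (smul f (coords 0)) \<in> Null" by simp
qed simp

lemma generated_sum: "(\<And>i. i \<in> I \<Longrightarrow> generated (f i)) \<Longrightarrow> generated (sum f I)"
  by (induction I rule: infinite_finite_induct) (auto intro: generated_add generated_0)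

lemma generated_poly:
  assumes "generated m"
  shows "generated (M_poly \<theta> A p m)"
  unfolding generated_def
proof (intro ballI conjI)
  fix f assume f: "f \<in> tate ord"
  have eq: "smul f (coords (M_poly \<theta> A p m)) = smul (fps_of_poly p * f) (coords m)"
    by (simp add: coords_M_poly smul_smul mult.commute)
  show "smul f (coords (M_poly \<theta> A p m)) \<in> tate_coords"
    unfolding eq using assms f by (auto simp: generated_def)
  show "frag_of (M_poly \<theta> A p m, f) - coords_rep (smul f (coords (M_poly \<theta> A p m))) \<in> Null"
    unfolding eq using assms f
    by (intro Null_trans[OF Null_rel_poly]) (auto simp: generated_def)
qed

lemma generated_scale: "generated m \<Longrightarrow> generated (M_scale a m)"
  using generated_poly[of m "[:a:]"] by (simp add: M_poly_def)

lemma generated_T: "generated m \<Longrightarrow> generated (M_T \<theta> A m)"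
proof -
  have "M_poly \<theta> A [:0, 1:] m = M_T \<theta> A m"
    by (simp add: M_poly_def M_scale_def vec_eq_iff)
  thus "generated m \<Longrightarrow> generated (M_T \<theta> A m)" using generated_poly[of m "[:0, 1:]"] by simp
qed

lemma coords_rep_axis:
  assumes "f \<in> tate ord"
  shows "frag_of (M_basis i, f) - coords_rep (axis i f, 0) \<in> Null"
    and "frag_of (M_tau (M_basis i), f) - coords_rep (0, axis i f) \<in> Null"
proof -
  have 1: "(\<Sum>j\<in>UNIV. if j = i then x else (0 :: 'c motive \<times> 'c fps \<Rightarrow>\<^sub>0 int)) = x" for x by simp
  have "frag_of (M_basis i, f) - coords_rep (axis i f, 0) =
     (\<Sum>j\<in>UNIV. (if j = i then frag_of (M_basis i, f) else 0)
       - (frag_of (M_basis j, if j = i then f else 0) + frag_of (M_tau (M_basis j), 0)))"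
    unfolding sum_subtractf 1 by (simp add: coords_rep_def axis_def)
  moreover have "(if j = i then frag_of (M_basis i, f) else 0)
       - (frag_of (M_basis j, if j = i then f else 0) + frag_of (M_tau (M_basis j), 0)) \<in> Null" for j
    by (cases "j = i") (auto intro!: Null_add Null_uminus simp: Null_of_0 diff_conv_add_uminus simp del: add_uminus_conv_diff minus_add_distrib)
  ultimately show "frag_of (M_basis i, f) - coords_rep (axis i f, 0) \<in> Null"
    by (simp add: Null_sum)
  have "frag_of (M_tau (M_basis i), f) - coords_rep (0, axis i f) =
     (\<Sum>j\<in>UNIV. (if j = i then frag_of (M_tau (M_basis i), f) else 0)
       - (frag_of (M_basis j, 0) + frag_of (M_tau (M_basis j), if j = i then f else 0)))"
    unfolding sum_subtractf 1 by (simp add: coords_rep_def axis_def)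
  moreover have "(if j = i then frag_of (M_tau (M_basis i), f) else 0)
       - (frag_of (M_basis j, 0) + frag_of (M_tau (M_basis j), if j = i then f else 0)) \<in> Null" for j
    by (cases "j = i") (auto intro!: Null_add Null_uminus simp: Null_of_0 diff_conv_add_uminus simp del: add_uminus_conv_diff minus_add_distrib)
  ultimately show "frag_of (M_tau (M_basis i), f) - coords_rep (0, axis i f) \<in> Null"
    by (simp add: Null_sum)
qed

lemma generated_basis: "generated (M_basis i)" "generated (M_tau (M_basis i))"
proof -
  have "smul f (coords (M_basis i)) = (axis i f, 0)" for f
    by (rule coords_eqI; simp add: coords_M_basis coords_basis_def axis_def)
  moreover have "smul f (coords (M_tau (M_basis i))) = (0, axis i f)" for f
    unfolding coords_M_tau coords_M_basis coords_tau_basis by (rule coords_eqI; simp add: axis_def)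
  ultimately show "generated (M_basis i)" "generated (M_tau (M_basis i))"
    by (simp_all add: generated_def coords_rep_axis) (simp_all add: tate_coords_def axis_def)
qed

text \<open>Applying \<open>\<tau>\<^sup>k\<close> to the definition of \<open>T e\<^sub>i\<close>
  expresses \<open>\<tau>\<^sup>k\<^sup>+\<^sup>2 e\<^sub>i\<close> through
  \<open>T \<tau>\<^sup>k e\<^sub>i\<close> and lower powers of \<open>\<tau>\<close>; hence the
  two-step induction.\<close>

lemma generated_tau_pow_basis: "generated ((M_tau ^^ k) (M_basis i))"
proof (induction k arbitrary: i rule: induct_nat_012)
  case (ge2 k)
  let ?u = "M_scale (\<theta> ^ (2 ^ k)) ((M_tau ^^ k) (M_basis i))
      + (\<Sum>j\<in>UNIV. M_scale ((A $ i $ j) ^ (2 ^ k)) ((M_tau ^^ Suc k) (M_basis j)))"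
  have tau: "(M_tau ^^ k) (M_tau m) = (M_tau ^^ Suc k) m" for k and m :: "'c motive"
    by (simp add: funpow_swap1)
  have eq: "M_T \<theta> A ((M_tau ^^ k) (M_basis i)) = ?u + (M_tau ^^ Suc (Suc k)) (M_basis i)"
    unfolding M_T_tau_pow_basis M_T_basis_def M_tau_pow_add M_tau_pow_sum M_tau_pow_scale tau ..
  have "(M_tau ^^ Suc (Suc k)) (M_basis i) = ?u + M_T \<theta> A ((M_tau ^^ k) (M_basis i))"
    unfolding eq add.assoc[symmetric] motive_double add_0_left ..
  moreover have "generated (?u + M_T \<theta> A ((M_tau ^^ k) (M_basis i)))"
    by (intro generated_add generated_sum generated_scale generated_T ge2)
  ultimately show ?case by simp
qed (simp_all add: generated_basis)

lemma generated_all: "generated m"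
  by (subst motive_expand) (intro generated_sum generated_scale generated_tau_pow_basis)

lemma coords_rep_frag_coords:
  assumes "x \<in> carrier Free"
  shows "frag_coords x \<in> tate_coords \<and> x - coords_rep (frag_coords x) \<in> Null"
  using assms[unfolded in_Free]
proof (induction x rule: frag_induction)
  case zero
  show ?case unfolding frag_coords_0 coords_rep_def
    by (auto intro!: Null_uminus Null_sum Null_add simp: Null_of_0 simp del: minus_add_distrib)
next
  case (one z)
  thus ?case using generated_all by (cases z) (auto simp: generated_def)
next
  case (diff a b)
  let ?a = "frag_coords a" and ?b = "frag_coords b"
  have a: "?a \<in> tate_coords" "a - coords_rep ?a \<in> Null" and b: "?b \<in> tate_coords" "b - coords_rep ?b \<in> Null"
    using diff by blast+
  \<comment> \<open>Additivity modulo \<open>Null\<close> is applied to \<open>?a + ?b\<close> and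
    \<open>?b\<close>, whose sum is \<open>?a\<close> in characteristic 2; this replaces a rule for
    differences.\<close>
  have "(a - coords_rep ?a) - (b - coords_rep ?b) + (coords_rep (?a + ?b + ?b) - (coords_rep (?a + ?b) + coords_rep ?b)) \<in> Null"
    by (rule Null_add[OF Null_diff[OF a(2) b(2)] coords_rep_Null_add[OF tate_coords_add[OF a(1) b(1)] b(1)]])
  moreover have "?a + ?b + ?b = ?a" by (simp add: add.assoc coords_double)
  moreover have "(a - coords_rep ?a) - (b - coords_rep ?b)
      + (coords_rep ?a - (coords_rep (?a + ?b) + coords_rep ?b)) = a - b - coords_rep (?a + ?b)"
    by simp
  ultimately have "a - b - coords_rep (?a + ?b) \<in> Null" by (simp only:)
  thus ?case using diff by (simp add: frag_coords_diff tate_coords_add)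
qed

text \<open>An element with coordinates 0 is congruent to \<open>coords_rep 0\<close>, a sum of
  symbols \<open>(m, 0)\<close>, which lie in \<open>Null\<close>.\<close>

lemma Null_iff: "x \<in> Null \<longleftrightarrow> x \<in> carrier Free \<and> frag_coords x = 0"
proof
  assume x: "x \<in> carrier Free \<and> frag_coords x = 0"
  have "coords_rep 0 \<in> Null" unfolding coords_rep_def
    by (auto intro!: Null_sum Null_add simp: Null_of_0)
  thus "x \<in> Null" using coords_rep_frag_coords[of x] x Null_add[of "x - coords_rep 0" "coords_rep 0"] by simp
qed (auto intro: Null_in_Free Null_coords)


section \<open>Cosets described by coordinates\<close>

definition tensor_of :: "'c coords \<Rightarrow> ('c motive \<times> 'c fps \<Rightarrow>\<^sub>0 int) set"
  where "tensor_of h = {x \<in> carrier Free. frag_coords x = h}"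

lemma coset_eq: "x \<in> carrier Free \<Longrightarrow> Null #>\<^bsub>Free\<^esub> x = tensor_of (frag_coords x)"
proof (intro Set.set_eqI iffI)
  fix y assume x: "x \<in> carrier Free" and "y \<in> Null #>\<^bsub>Free\<^esub> x"
  then obtain n where "n \<in> Null" "y = n + x" by (auto simp: r_coset_def tensor_free_def)
  thus "y \<in> tensor_of (frag_coords x)" using x Null_iff
    by (auto simp: tensor_of_def frag_coords_add intro: Free_add)
next
  fix y assume x: "x \<in> carrier Free" and "y \<in> tensor_of (frag_coords x)"
  hence "y - x \<in> Null" unfolding Null_iff
    by (auto simp: tensor_of_def frag_coords_diff coords_double intro: Free_diff)
  moreover have "y = (y - x) + x" by simp
  ultimately show "y \<in> Null #>\<^bsub>Free\<^esub> x" unfolding r_coset_def tensor_free_def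
    by (metis (no_types, lifting) UN_I mult_free_Abelian_group singletonI)
qed

lemma tensor_of_rep: "h \<in> tate_coords \<Longrightarrow> coords_rep h \<in> tensor_of h"
  by (simp add: tensor_of_def coords_rep_in_Free)

lemma tensor_of_inj: "h \<in> tate_coords \<Longrightarrow> tensor_of h = tensor_of h' \<Longrightarrow> h = h'"
  using tensor_of_rep[of h] by (auto simp: tensor_of_def)

lemma coset_rep: "h \<in> tate_coords \<Longrightarrow> Null #>\<^bsub>Free\<^esub> coords_rep h = tensor_of h"
  by (simp add: coset_eq coords_rep_in_Free)

lemma tensor_carrier: "carrier Tens = tensor_of ` tate_coords"
proof -
  have "carrier Tens = (\<lambda>x. Null #>\<^bsub>Free\<^esub> x) ` carrier Free"
    by (auto simp: tensor_def FactGroup_def RCOSETS_def)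
  also have "\<dots> = tensor_of ` tate_coords"
  proof (intro equalityI subsetI)
    fix X assume "X \<in> (\<lambda>x. Null #>\<^bsub>Free\<^esub> x) ` carrier Free"
    then obtain x where "x \<in> carrier Free" "X = Null #>\<^bsub>Free\<^esub> x" by blast
    thus "X \<in> tensor_of ` tate_coords" using coset_eq coords_rep_frag_coords by blast
  next
    fix X assume "X \<in> tensor_of ` tate_coords"
    then obtain h where "h \<in> tate_coords" "X = tensor_of h" by blast
    thus "X \<in> (\<lambda>x. Null #>\<^bsub>Free\<^esub> x) ` carrier Free" using coset_rep coords_rep_in_Free by blast
  qed
  finally show ?thesis .
qed

lemma Null_normal: "Null \<lhd> Free"
  using comm_group.subgroup_imp_normal[OF Free_comm Null_subgroup] .

lemma tensor_comm_group: "comm_group Tens"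
  unfolding tensor_def by (rule comm_group.abelian_FactGroup[OF Free_comm Null_subgroup])

lemma tensor_mult:
  assumes "h \<in> tate_coords" "h' \<in> tate_coords"
  shows "tensor_of h \<otimes>\<^bsub>Tens\<^esub> tensor_of h' = tensor_of (h + h')"
proof -
  have "tensor_of h \<otimes>\<^bsub>Tens\<^esub> tensor_of h' = Null #>\<^bsub>Free\<^esub> (coords_rep h \<otimes>\<^bsub>Free\<^esub> coords_rep h')"
    using normal.rcos_sum[OF Null_normal] assms
    by (simp add: tensor_def FactGroup_def coset_rep[symmetric] coords_rep_in_Free)
  also have "\<dots> = tensor_of (h + h')"
    using assms coset_eq[OF Free_add[OF coords_rep_in_Free coords_rep_in_Free]]
    by (simp add: tensor_free_def frag_coords_add)
  finally show ?thesis .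
qed

lemma tensor_one: "\<one>\<^bsub>Tens\<^esub> = tensor_of 0"
proof -
  have "\<one>\<^bsub>Tens\<^esub> = Null" by (simp add: tensor_def FactGroup_def)
  also have "\<dots> = tensor_of 0" by (auto simp: tensor_of_def Null_iff)
  finally show ?thesis .
qed

lemma tensor_finprod:
  assumes "finite I" "\<And>i. i \<in> I \<Longrightarrow> h i \<in> tate_coords"
  shows "finprod Tens (\<lambda>i. tensor_of (h i)) I = tensor_of (\<Sum>i\<in>I. h i) \<and> (\<Sum>i\<in>I. h i) \<in> tate_coords"
  using assms
proof (induction I rule: finite_induct)
  case empty
  interpret comm_group Tens by (rule tensor_comm_group)
  show ?case by (simp add: tensor_one)
next
  case (insert j I)
  interpret comm_group Tens by (rule tensor_comm_group)
  have "(\<lambda>i. tensor_of (h i)) \<in> I \<rightarrow> carrier Tens" "tensor_of (h j) \<in> carrier Tens"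
    using insert.prems by (auto simp: tensor_carrier)
  thus ?case using insert by (simp add: tensor_mult tate_coords_add)
qed

text \<open>Coordinates decide membership in a coset, so a map of symbols that acts on coordinates
  by an additive \<open>\<sigma>\<close> takes all representatives into one coset, and the union
  collapses to it.\<close>

lemma tensor_map_eq:
  assumes gh: "\<And>m f. f \<in> tate ord \<Longrightarrow> h f \<in> tate ord \<and> smul (h f) (coords (g m)) = \<sigma> (smul f (coords m))"
    and \<sigma>: "\<And>u u'. \<sigma> (u + u') = \<sigma> u + \<sigma> u'" and u: "u \<in> tate_coords"
  shows "tensor_map ord \<theta> A g h (tensor_of u) = tensor_of (\<sigma> u)"
proof -
  let ?\<phi> = "frag_extend (\<lambda>(m, f). frag_of (g m, h f))"
  have \<sigma>0: "\<sigma> 0 = 0" using \<sigma>[of 0 0] by simp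
  have ext: "?\<phi> x \<in> carrier Free \<and> frag_coords (?\<phi> x) = \<sigma> (frag_coords x)"
    if "Poly_Mapping.keys x \<subseteq> UNIV \<times> tate ord" for x
    using that
  proof (induction x rule: frag_induction)
    case zero
    show ?case by (simp add: \<sigma>0 in_Free)
  next
    case (one z)
    thus ?case using gh by (cases z) (auto intro: Free_of)
  next
    case (diff a b)
    thus ?case by (auto simp: frag_extend_diff frag_coords_diff \<sigma> intro: Free_diff)
  qed
  have "Null #>\<^bsub>Free\<^esub> ?\<phi> x = tensor_of (\<sigma> u)" if "x \<in> tensor_of u" for x
    using ext[of x] that by (auto simp: tensor_of_def in_Free coset_eq)
  thus ?thesis using tensor_of_rep[OF u] unfolding tensor_map_def by auto
qed

lemma tensor_tau_eq: "u \<in> tate_coords \<Longrightarrow> tensor_tau ord \<theta> A (tensor_of u) = tensor_of (coords_tau u)"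
  unfolding tensor_tau_def
  by (rule tensor_map_eq) (auto simp: coords_M_tau coords_tau_smul coords_tau_add)

lemma tensor_poly_eq:
  "u \<in> tate_coords \<Longrightarrow> tensor_poly ord \<theta> A p (tensor_of u) = tensor_of (smul (fps_of_poly p) u)"
  unfolding tensor_poly_def
  by (rule tensor_map_eq) (auto simp: smul_smul smul_add_right)

definition invariants :: "'c coords set"
  where "invariants = {h \<in> tate_coords. coords_tau h = h}"

lemma H1_eq: "H1 ord \<theta> A = tensor_of ` invariants"
proof (intro equalityI subsetI)
  fix X assume "X \<in> H1 ord \<theta> A"
  then obtain h where h: "h \<in> tate_coords" "X = tensor_of h" "tensor_tau ord \<theta> A X = X"
    by (auto simp: H1_def tensor_carrier)
  hence "coords_tau h = h" using tensor_of_inj[of h "coords_tau h"] by (simp add: tensor_tau_eq)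
  thus "X \<in> tensor_of ` invariants" using h by (auto simp: invariants_def)
qed (auto simp: H1_def tensor_carrier invariants_def tensor_tau_eq)

lemma is_H1_basis_iff:
  assumes \<beta>: "\<And>i. i < n \<Longrightarrow> \<beta> i \<in> invariants" and b: "\<And>i. i < n \<Longrightarrow> b i = tensor_of (\<beta> i)"
  shows "is_H1_basis ord \<theta> A n b \<longleftrightarrow>
    (\<forall>x\<in>invariants. \<exists>!c. c \<in> {..<n} \<rightarrow>\<^sub>E F2_poly \<and> x = (\<Sum>i<n. smul (fps_of_poly (c i)) (\<beta> i)))"
proof -
  have lin: "finprod Tens (\<lambda>i. tensor_poly ord \<theta> A (c i) (b i)) {..<n}
      = tensor_of (\<Sum>i<n. smul (fps_of_poly (c i)) (\<beta> i))" for c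
  proof -
    interpret comm_group Tens by (rule tensor_comm_group)
    have "finprod Tens (\<lambda>i. tensor_poly ord \<theta> A (c i) (b i)) {..<n}
        = finprod Tens (\<lambda>i. tensor_of (smul (fps_of_poly (c i)) (\<beta> i))) {..<n}"
      using \<beta> b by (intro finprod_cong') (auto simp: tensor_poly_eq invariants_def tensor_carrier intro: tate_coords_poly)
    thus ?thesis using tensor_finprod[of "{..<n}" "\<lambda>i. smul (fps_of_poly (c i)) (\<beta> i)"] \<beta>
      by (simp add: invariants_def tate_coords_poly)
  qed
  have eq: "tensor_of x = tensor_of y \<longleftrightarrow> x = y" if "x \<in> invariants" for x y
    using that tensor_of_inj unfolding invariants_def by blast
  show ?thesis unfolding is_H1_basis_def H1_eq lin
    using \<beta> b by (auto simp: eq)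
qed

end


section \<open>The invariants as sequences\<close>

context t_motive
begin

abbreviation "T_op \<equiv> smul (fps_X :: 'c fps)"

lemma T_op_pow: "(T_op ^^ k) h = smul (fps_X ^ k) h"
  by (induction k) (simp_all add: smul_smul)

lemma invariants_add: "h \<in> invariants \<Longrightarrow> h' \<in> invariants \<Longrightarrow> h + h' \<in> invariants"
  by (simp add: invariants_def tate_coords_add coords_tau_add)

lemma invariants_0: "0 \<in> invariants"
  by (simp add: invariants_def)

lemma invariants_T: "h \<in> invariants \<Longrightarrow> T_op h \<in> invariants"
  using tate_coords_poly[of h "[:0, 1:]"]
  by (simp add: invariants_def coords_tau_smul fps_of_poly_pCons)

text \<open>A family of polynomials over the field of two elements amounts to its support, a finite
  set of pairs \<open>(k, i)\<close>; under this dictionary unique representation becomes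
  independence together with spanning.\<close>

lemma is_H1_basis_iff_is_basis:
  assumes M: "F2T_module invariants T_op \<epsilon>"
    and \<beta>: "\<And>i. i < n \<Longrightarrow> \<beta> i \<in> invariants" and b: "\<And>i. i < n \<Longrightarrow> b i = tensor_of (\<beta> i)"
  shows "is_H1_basis ord \<theta> A n b \<longleftrightarrow> F2T_module.is_basis invariants T_op {..<n} \<beta>"
proof -
  interpret M: F2T_module invariants T_op \<epsilon> by (rule M)
  define supp where "supp c = {(k, i). i < n \<and> coeff (c i) k = 1}" for c :: "nat \<Rightarrow> 'c poly"
  have finc: "finite {k. coeff p k = 1}" for p :: "'c poly"
    by (rule finite_subset[of _ "{..degree p}"]) (auto intro: le_degree)
  have supp_eq: "supp c = (\<lambda>(i, k). (k, i)) ` Sigma {..<n} (\<lambda>i. {k. coeff (c i) k = 1})" for c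
    by (auto simp: supp_def image_iff)
  have fin: "finite (supp c)" for c
    unfolding supp_eq using finc by auto
  have sub: "supp c \<subseteq> UNIV \<times> {..<n}" for c by (auto simp: supp_def)
  have poly: "smul (fps_of_poly p) h = (\<Sum>k | coeff p k = 1. (T_op ^^ k) h)" if "p \<in> F2_poly" for p h
  proof -
    have "fps_of_poly p = (\<Sum>k\<le>degree p. fps_const (coeff p k) * fps_X ^ k)"
      by (rule fps_of_poly_sum_monom) simp
    also have "\<dots> = (\<Sum>k | coeff p k = 1. fps_const (coeff p k) * fps_X ^ k)"
      using that by (intro sum.mono_neutral_right) (auto simp: F2_poly_def intro: le_degree)
    also have "\<dots> = (\<Sum>k | coeff p k = 1. fps_X ^ k)" by (intro sum.cong) auto
    finally show ?thesis by (simp add: smul_sum_left T_op_pow)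
  qed
  have sum_supp: "(\<Sum>i<n. smul (fps_of_poly (c i)) (\<beta> i)) = M.T_sum \<beta> (supp c)"
    if "c \<in> {..<n} \<rightarrow>\<^sub>E F2_poly" for c
  proof -
    have "M.T_sum \<beta> (supp c) = (\<Sum>(i, k)\<in>Sigma {..<n} (\<lambda>i. {k. coeff (c i) k = 1}). (T_op ^^ k) (\<beta> i))"
      unfolding M.T_sum_def supp_eq by (subst sum.reindex) (auto simp: inj_on_def case_prod_unfold)
    also have "\<dots> = (\<Sum>i<n. \<Sum>k | coeff (c i) k = 1. (T_op ^^ k) (\<beta> i))"
      using finc by (subst sum.Sigma) auto
    also have "\<dots> = (\<Sum>i<n. smul (fps_of_poly (c i)) (\<beta> i))"
      using that by (intro sum.cong refl poly[symmetric]) auto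
    finally show ?thesis ..
  qed
  have supp_inj: "c = c'" if "supp c = supp c'" "c \<in> {..<n} \<rightarrow>\<^sub>E F2_poly" "c' \<in> {..<n} \<rightarrow>\<^sub>E F2_poly" for c c'
  proof
    fix i show "c i = c' i"
    proof (cases "i < n")
      case True
      have "coeff (c i) k = coeff (c' i) k" for k
      proof -
        have "coeff (c i) k = 1 \<longleftrightarrow> coeff (c' i) k = 1" using that(1) True by (auto simp: supp_def set_eq_iff)
        moreover have "coeff (c i) k \<in> {0, 1}" "coeff (c' i) k \<in> {0, 1}"
          using that(2,3) True by (auto simp: F2_poly_def PiE_def Pi_def)
        ultimately show ?thesis by auto
      qed
      thus ?thesis by (rule poly_eqI)
    qed (use that(2,3) in \<open>auto simp: PiE_def extensional_def\<close>)
  qed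
  have supp_surj: "\<exists>c\<in>{..<n} \<rightarrow>\<^sub>E F2_poly. supp c = J" if J: "finite J" "J \<subseteq> UNIV \<times> {..<n}" for J
  proof -
    define c :: "nat \<Rightarrow> 'c poly"
      where "c = restrict (\<lambda>i. \<Sum>k | (k, i) \<in> J. monom 1 k) {..<n}"
    have finJ: "finite {k. (k, i) \<in> J}" for i
      by (rule finite_subset[OF _ finite_imageI[OF J(1), of fst]]) (auto intro: rev_image_eqI)
    have cc: "coeff (c i) k = (if (k, i) \<in> J then 1 else 0)" if "i < n" for i k
      using that finJ[of i] by (simp add: c_def coeff_sum coeff_monom)
    have "c \<in> {..<n} \<rightarrow>\<^sub>E F2_poly" unfolding PiE_iff F2_poly_def
      by (auto simp: cc) (simp add: c_def)
    moreover have "supp c = J" using J(2) by (auto simp: supp_def cc split: if_splits)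
    ultimately show ?thesis by blast
  qed
  have "is_H1_basis ord \<theta> A n b \<longleftrightarrow> (\<forall>x\<in>invariants. \<exists>!c. c \<in> {..<n} \<rightarrow>\<^sub>E F2_poly \<and> x = (\<Sum>i<n. smul (fps_of_poly (c i)) (\<beta> i)))"
    by (rule is_H1_basis_iff[OF \<beta> b])
  also have "\<dots> \<longleftrightarrow> M.is_basis {..<n} \<beta>"
  proof
    assume R: "\<forall>x\<in>invariants. \<exists>!c. c \<in> {..<n} \<rightarrow>\<^sub>E F2_poly \<and> x = (\<Sum>i<n. smul (fps_of_poly (c i)) (\<beta> i))"
    show "M.is_basis {..<n} \<beta>" unfolding M.is_basis_def
    proof (intro conjI allI impI ballI)
      show "\<beta> ` {..<n} \<subseteq> invariants" using \<beta> by auto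
      fix J assume J: "finite J" "J \<subseteq> UNIV \<times> {..<n}" "M.T_sum \<beta> J = 0"
      obtain c where c: "c \<in> {..<n} \<rightarrow>\<^sub>E F2_poly" "supp c = J" using supp_surj J by blast
      \<comment> \<open>The zero family; uniqueness for the element 0 identifies \<open>c\<close>
        with it.\<close>
      obtain c0 where c0: "c0 \<in> {..<n} \<rightarrow>\<^sub>E F2_poly" "supp c0 = {}" using supp_surj[of "{}"] by auto
      define Q where "Q a \<longleftrightarrow> a \<in> {..<n} \<rightarrow>\<^sub>E F2_poly \<and> 0 = (\<Sum>i<n. smul (fps_of_poly (a i)) (\<beta> i))" for a
      have E: "\<exists>!a. Q a" unfolding Q_def by (rule R[rule_format, OF invariants_0])
      have "Q c" "Q c0" unfolding Q_def
        using c J(3) sum_supp[OF c(1)] c0 sum_supp[OF c0(1)] by simp_all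
      hence "c = c0" using E by blast
      thus "J = {}" using c c0 by simp
    next
      fix x assume "x \<in> invariants"
      then obtain c where "c \<in> {..<n} \<rightarrow>\<^sub>E F2_poly" "x = (\<Sum>i<n. smul (fps_of_poly (c i)) (\<beta> i))"
        using R by blast
      thus "\<exists>J. finite J \<and> J \<subseteq> UNIV \<times> {..<n} \<and> M.T_sum \<beta> J = x"
        using fin[of c] sub[of c] sum_supp by (intro exI[of _ "supp c"]) auto
    qed
  next
    assume B: "M.is_basis {..<n} \<beta>"
    note indep = B[unfolded M.is_basis_def, THEN conjunct2, THEN conjunct1, rule_format]
      and span = B[unfolded M.is_basis_def, THEN conjunct2, THEN conjunct2, rule_format]
    show "\<forall>x\<in>invariants. \<exists>!c. c \<in> {..<n} \<rightarrow>\<^sub>E F2_poly \<and> x = (\<Sum>i<n. smul (fps_of_poly (c i)) (\<beta> i))"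
    proof (intro ballI ex_ex1I)
      fix x assume "x \<in> invariants"
      then obtain J where J: "finite J" "J \<subseteq> UNIV \<times> {..<n}" "M.T_sum \<beta> J = x" using span by blast
      then obtain c where "c \<in> {..<n} \<rightarrow>\<^sub>E F2_poly" "supp c = J" using supp_surj by blast
      thus "\<exists>c. c \<in> {..<n} \<rightarrow>\<^sub>E F2_poly \<and> x = (\<Sum>i<n. smul (fps_of_poly (c i)) (\<beta> i))"
        using sum_supp J by (intro exI[of _ c]) auto
    next
      fix x c c' assume c: "c \<in> {..<n} \<rightarrow>\<^sub>E F2_poly \<and> x = (\<Sum>i<n. smul (fps_of_poly (c i)) (\<beta> i))"
        "c' \<in> {..<n} \<rightarrow>\<^sub>E F2_poly \<and> x = (\<Sum>i<n. smul (fps_of_poly (c' i)) (\<beta> i))"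
      hence "M.T_sum \<beta> (sym_diff (supp c) (supp c')) = x + x"
        using sum_supp[of c] sum_supp[of c'] by (simp add: M.T_sum_sym_diff fin)
      hence "sym_diff (supp c) (supp c') = {}"
        using fin sub[of c] sub[of c'] by (intro indep) (auto simp: coords_double)
      hence "supp c = supp c'" by blast
      thus "c = c'" using supp_inj c by blast
    qed
  qed
  finally show ?thesis .
qed

section \<open>The recursion for the coefficients\<close>

definition pt :: "'c coords \<Rightarrow> nat \<Rightarrow> 'c \<times> 'c"
  where "pt h n = (fps_nth (snd h $ 1) n, fps_nth (snd h $ 2) n)"

definition frob4 :: "'c \<times> 'c \<Rightarrow> 'c \<times> 'c"
  where "frob4 z = (fst z ^ 4, snd z ^ 4)"

text \<open>The coefficients \<open>z\<^sub>n\<close> of a \<open>\<tau>\<close>-invariant element satisfy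
  \<open>z\<^sub>n + L z\<^sub>n = z\<^sub>n\<^sub>-\<^sub>1\<^sup>4\<close> (componentwise power), and \<open>z\<^sub>0 + L z\<^sub>0 = 0\<close>.\<close>

definition Lpart :: "'c \<times> 'c \<Rightarrow> 'c \<times> 'c"
  where "Lpart z = (\<theta> ^ 2 * fst z ^ 4 + A $ 1 $ 1 * fst z ^ 2 + A $ 2 $ 1 * snd z ^ 2,
    \<theta> ^ 2 * snd z ^ 4 + A $ 1 $ 2 * fst z ^ 2 + A $ 2 $ 2 * snd z ^ 2)"

lemma Lpart_add: "Lpart (z + w) = Lpart z + Lpart w"
  by (simp add: Lpart_def square_add fourth_power_add distrib_left ac_simps)

lemma frob4_0 [simp]: "frob4 0 = 0"
  by (simp add: frob4_def prod_eq_iff)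

lemma pt_add: "pt (h + h') n = pt h n + pt h' n"
  by (simp add: pt_def)

lemma pt_0 [simp]: "pt 0 n = 0"
  by (simp add: pt_def prod_eq_iff)

lemma pt_T: "pt (T_op h) n = (case n of 0 \<Rightarrow> 0 | Suc n \<Rightarrow> pt h n)"
  by (simp add: pt_def prod_eq_iff split: nat.splits)

text \<open>Invariance at \<open>e\<^sub>i\<close> determines \<open>fst h\<close> by
  \<open>snd h\<close>; inserted into the condition at \<open>\<tau> e\<^sub>i\<close>, this leaves
  a recursion for the coefficients of \<open>snd h\<close> alone.\<close>

lemma coords_tau_eq_iff: "coords_tau h = h \<longleftrightarrow>
  (\<forall>i. fst h $ i = (fps_X + fps_const \<theta>) * tate_tau (snd h $ i)) \<and>
  (\<forall>n. pt h n + Lpart (pt h n) = (case n of 0 \<Rightarrow> 0 | Suc n \<Rightarrow> frob4 (pt h n)))" (is "_ \<longleftrightarrow> ?P \<and> ?Q")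
proof -
  have "coords_tau h = h \<longleftrightarrow> h = coords_tau h" by (rule eq_commute)
  also have "\<dots> \<longleftrightarrow> ?P \<and>
    (\<forall>j. snd h $ j = tate_tau (fst h $ j) + (\<Sum>i\<in>UNIV. fps_const (A $ i $ j) * tate_tau (snd h $ i)))"
    unfolding prod_eq_iff vec_eq_iff coords_tau_def
    by (simp only: fst_conv snd_conv vec_lambda_beta)
  also have "\<dots> \<longleftrightarrow> ?P \<and> ?Q"
  proof (rule conj_cong[OF refl])
    assume P: ?P
    \<comment> \<open>The coefficient of \<open>fst h\<close> is the previous square of
      \<open>snd h\<close> plus \<open>\<theta>\<close> times the current one; squaring it again
      gives fourth powers and \<open>\<theta> ^ 2\<close>.\<close>
    have f: "fps_nth (fst h $ j) n ^ 2 = (case n of 0 \<Rightarrow> 0 | Suc n \<Rightarrow> fps_nth (snd h $ j) n ^ 4)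
       + \<theta> ^ 2 * fps_nth (snd h $ j) n ^ 4" for j n
      unfolding P[rule_format] distrib_right
      by (cases n) (simp_all add: square_add power_mult_distrib)
    have "(\<forall>j. snd h $ j = tate_tau (fst h $ j) + (\<Sum>i\<in>UNIV. fps_const (A $ i $ j) * tate_tau (snd h $ i)))
      \<longleftrightarrow> (\<forall>n j. fps_nth (snd h $ j) n = fps_nth (fst h $ j) n ^ 2
            + (\<Sum>i\<in>UNIV. A $ i $ j * fps_nth (snd h $ i) n ^ 2))"
      by (auto simp: fps_eq_iff fps_sum_nth)
    also have "\<dots> \<longleftrightarrow> ?Q"
    proof (rule all_cong1)
      fix n
      show "(\<forall>j. fps_nth (snd h $ j) n = fps_nth (fst h $ j) n ^ 2
            + (\<Sum>i\<in>UNIV. A $ i $ j * fps_nth (snd h $ i) n ^ 2)) \<longleftrightarrow>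
          pt h n + Lpart (pt h n) = (case n of 0 \<Rightarrow> 0 | Suc n \<Rightarrow> frob4 (pt h n))"
        unfolding f forall_2 sum_2
        by (cases n) (auto simp: pt_def Lpart_def frob4_def prod_eq_iff char2_eq_iff ac_simps)
    qed
    finally show "(\<forall>j. snd h $ j = tate_tau (fst h $ j) + (\<Sum>i\<in>UNIV. fps_const (A $ i $ j) * tate_tau (snd h $ i))) \<longleftrightarrow> ?Q" .
  qed
  finally show ?thesis .
qed

lemma invariants_eqI:
  assumes "h \<in> invariants" "h' \<in> invariants" "\<And>n. pt h n = pt h' n"
  shows "h = h'"
proof -
  have "\<forall>j. snd h $ j = snd h' $ j"
    unfolding forall_2 using assms(3) by (auto simp: pt_def fps_eq_iff)
  moreover have "fst h $ j = fst h' $ j" for j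
    using assms(1,2) calculation by (simp add: invariants_def coords_tau_eq_iff)
  ultimately show ?thesis by (intro coords_eqI) auto
qed

lemma invariants_pt:
  assumes "h \<in> invariants"
  shows "pt h 0 + Lpart (pt h 0) = 0"
    and "pt h (Suc n) + Lpart (pt h (Suc n)) = frob4 (pt h n)"
    and "\<forall>\<^sub>F n in sequentially. ord_ge B (fst (pt h n)) \<and> ord_ge B (snd (pt h n))"
proof -
  have Q: "pt h n + Lpart (pt h n) = (case n of 0 \<Rightarrow> 0 | Suc n \<Rightarrow> frob4 (pt h n))" for n
    using assms coords_tau_eq_iff by (simp add: invariants_def)
  show "pt h 0 + Lpart (pt h 0) = 0" "pt h (Suc n) + Lpart (pt h (Suc n)) = frob4 (pt h n)"
    using Q[of 0] Q[of "Suc n"] by simp_all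
  have "snd h $ 1 \<in> tate ord" "snd h $ 2 \<in> tate ord"
    using assms by (auto simp: invariants_def tate_coords_def)
  thus "\<forall>\<^sub>F n in sequentially. ord_ge B (fst (pt h n)) \<and> ord_ge B (snd (pt h n))"
    by (auto simp: tate_iff pt_def intro: eventually_conj)
qed

lemma invariants_ofI:
  assumes "s 0 + Lpart (s 0) = 0" "\<And>n. s (Suc n) + Lpart (s (Suc n)) = frob4 (s n)"
    and lim: "\<And>B. \<forall>\<^sub>F n in sequentially. ord_ge B (fst (s n)) \<and> ord_ge B (snd (s n))"
  shows "\<exists>h\<in>invariants. pt h = s"
proof -
  define g :: "'c fps ^ 2" where "g = (\<chi> i. if i = 1 then Abs_fps (\<lambda>n. fst (s n)) else Abs_fps (\<lambda>n. snd (s n)))"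
  define h where "h = ((\<chi> i. (fps_X + fps_const \<theta>) * tate_tau (g $ i)) :: 'c fps ^ 2, g)"
  have pt: "pt h n = s n" for n
    by (simp add: pt_def h_def g_def)
  have "g $ i \<in> tate ord" for i
    unfolding tate_iff
  proof
    fix B show "\<forall>\<^sub>F n in sequentially. ord_ge B (fps_nth (g $ i) n)"
      using lim[of B] by eventually_elim (auto simp: g_def)
  qed
  hence "h \<in> tate_coords"
    by (auto simp: tate_coords_def h_def distrib_right intro!: tate_add tate_const_mult tate_tau_tate)
  moreover have "coords_tau h = h" unfolding coords_tau_eq_iff pt
    using assms(1,2) by (auto simp: h_def split: nat.splits)
  ultimately show ?thesis using pt by (intro bexI[of _ h]) (auto simp: invariants_def)
qed

text \<open>Evaluation at the first point has kernel \<open>T_op\<close> applied to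
  \<open>invariants\<close> and, by \<open>lift\<close>, all solutions of
  \<open>z + Lpart z = 0\<close> as image; counting gives every basis \<open>r\<close> elements. A
  basis exists by the filtration according to the index from which on the points lie in
  \<open>U\<close>. In \<open>lift\<close> the point \<open>w\<close> may lie outside the polydisc,
  provided that its fourth power is inside.\<close>

theorem h1_eqI:
  assumes pos: "\<xi> \<ge> 0" "\<eta> \<ge> 0"
    and contr: "\<And>\<rho> z. \<rho> \<ge> 0 \<Longrightarrow> pair_ge \<xi> \<eta> \<rho> z \<Longrightarrow> pair_ge \<xi> \<eta> (2 * \<rho>) (Lpart z)"
    and lift: "\<And>z. z + Lpart z = 0 \<Longrightarrow>
      \<exists>w. w + Lpart w = frob4 z \<and> (\<exists>\<rho>>0. pair_ge \<xi> \<eta> \<rho> (frob4 w))"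
    and fin: "finite {z. z + Lpart z = 0}" and card: "card {z. z + Lpart z = 0} = 2 ^ r"
  shows "h1 ord \<theta> A = r"
proof -
  define U where "U z \<longleftrightarrow> (\<exists>\<rho>>0. pair_ge \<xi> \<eta> \<rho> z)" for z
  have U_add: "U (z + w)" if "U z" "U w" for z w
  proof -
    obtain \<rho> \<rho>' where "\<rho> > 0" "pair_ge \<xi> \<eta> \<rho> z" "\<rho>' > 0" "pair_ge \<xi> \<eta> \<rho>' w" using \<open>U z\<close> \<open>U w\<close> U_def by auto
    hence "pair_ge \<xi> \<eta> (min \<rho> \<rho>') (z + w)" "min \<rho> \<rho>' > 0"
      by (auto intro!: pair_ge_add elim: pair_ge_mono)
    thus ?thesis unfolding U_def by blast
  qed
  have U_0: "U 0" unfolding U_def by (intro exI[of _ 1]) simp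
  have U_unique: "z = 0" if "U z" "z + Lpart z = 0" for z
    using that(1) unfolding U_def
    by (elim exE conjE) (rule hensel_unique[of \<xi> \<eta> Lpart, OF contr _ _ that(2)])
  define \<epsilon> where "\<epsilon> h = pt h 0" for h
  define F where "F d = {h \<in> invariants. \<forall>n\<ge>d. U (pt h n)}" for d
  have eps_image: "\<epsilon> ` invariants = {z. z + Lpart z = 0}"
  proof (intro equalityI subsetI)
    fix z assume "z \<in> {z. z + Lpart z = 0}"
    then obtain w \<rho> where w: "z + Lpart z = 0" "w + Lpart w = frob4 z" "\<rho> > 0" "pair_ge \<xi> \<eta> \<rho> (frob4 w)"
      using lift by blast
    \<comment> \<open>The fourth power of the \<open>n\<close>-th point gets deeper with
      \<open>n\<close>; the clause for \<open>n = 0\<close> prescribes the start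
      \<open>w\<close>.\<close>
    define P where "P n y \<longleftrightarrow> pair_ge \<xi> \<eta> (\<rho> + real n * \<rho>) (frob4 y) \<and> (n = 0 \<longrightarrow> y = w)" for n y
    have "\<exists>s. \<forall>n. P n (s n) \<and> s (Suc n) + Lpart (s (Suc n)) = frob4 (s n)"
    proof (rule dependent_nat_choice)
      show "\<exists>y. P 0 y" using w by (intro exI[of _ w]) (simp add: P_def)
      fix y n assume "P n y"
      hence y: "pair_ge \<xi> \<eta> (\<rho> + real n * \<rho>) (frob4 y)" by (simp add: P_def)
      have p: "\<rho> + real n * \<rho> > 0" using w(3) by (simp add: add_pos_nonneg)
      from hensel[of Lpart \<xi> \<eta>, OF Lpart_add contr p y] obtain y'
        where y': "pair_ge \<xi> \<eta> (\<rho> + real n * \<rho>) y'" "y' + Lpart y' = frob4 y" by blast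
      have "real n * \<rho> \<ge> 0" using w(3) by simp
      \<comment> \<open>As the radii are nonnegative, a fourth power gains more than the required
        \<open>\<rho>\<close>.\<close>
      hence "\<xi> + (\<rho> + real (Suc n) * \<rho>) \<le> real 4 * (\<xi> + (\<rho> + real n * \<rho>))"
        "\<eta> + (\<rho> + real (Suc n) * \<rho>) \<le> real 4 * (\<eta> + (\<rho> + real n * \<rho>))"
        using w(3) pos by (simp_all add: algebra_simps)
      hence "pair_ge \<xi> \<eta> (\<rho> + real (Suc n) * \<rho>) (frob4 y')"
        using y'(1) unfolding pair_ge_def frob4_def by (auto intro: ord_ge_power')
      thus "\<exists>y'. P (Suc n) y' \<and> y' + Lpart y' = frob4 y" using y'(2) by (intro exI[of _ y']) (simp add: P_def)
    qed
    then obtain s where s: "\<And>n. P n (s n)" "\<And>n. s (Suc n) + Lpart (s (Suc n)) = frob4 (s n)" by blast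
    \<comment> \<open>The sequence \<open>s\<close> starts with \<open>w\<close>, the point after
      \<open>z\<close>.\<close>
    define s' where "s' n = (case n of 0 \<Rightarrow> z | Suc n \<Rightarrow> s n)" for n
    have "\<exists>h\<in>invariants. pt h = s'"
    proof (rule invariants_ofI)
      show "s' 0 + Lpart (s' 0) = 0" using w(1) by (simp add: s'_def)
      have "s 0 = w" using s(1)[of 0] by (simp add: P_def)
      thus "s' (Suc n) + Lpart (s' (Suc n)) = frob4 (s' n)" for n
        using s(2) w(2) by (cases n) (auto simp: s'_def)
      fix B
      obtain N :: nat where N: "4 * \<bar>B\<bar> / \<rho> < real N" using reals_Archimedean2 by blast
      have ge: "ord_ge B (fst (s n)) \<and> ord_ge B (snd (s n))" if "n \<ge> N" for n
      proof -
        have "4 * \<bar>B\<bar> / \<rho> < real n" using N that by linarith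
        hence "4 * \<bar>B\<bar> < real n * \<rho>" using w(3) by (simp add: pos_divide_less_eq)
        hence B: "B \<le> (\<xi> + (\<rho> + real n * \<rho>)) / real 4" "B \<le> (\<eta> + (\<rho> + real n * \<rho>)) / real 4"
          using pos w(3) by auto
        have "ord_ge (\<xi> + (\<rho> + real n * \<rho>)) (fst (s n) ^ 4)" "ord_ge (\<eta> + (\<rho> + real n * \<rho>)) (snd (s n) ^ 4)"
          using s(1)[of n] by (auto simp: P_def pair_ge_def frob4_def)
        from this[THEN ord_ge_powerD] B show ?thesis by (auto intro: ord_ge_mono)
      qed
      show "\<forall>\<^sub>F n in sequentially. ord_ge B (fst (s' n)) \<and> ord_ge B (snd (s' n))"
        unfolding eventually_sequentially
      proof (intro exI[of _ "Suc N"] allI impI)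
        fix n assume "Suc N \<le> n"
        then obtain n' where "n = Suc n'" "n' \<ge> N" by (cases n) auto
        thus "ord_ge B (fst (s' n)) \<and> ord_ge B (snd (s' n))" using ge by (simp add: s'_def)
      qed
    qed
    then obtain h where "h \<in> invariants" "pt h = s'" by blast
    moreover from this(2) have "z = \<epsilon> h" by (simp add: \<epsilon>_def s'_def)
    ultimately show "z \<in> \<epsilon> ` invariants" by blast
  qed (auto simp: \<epsilon>_def invariants_pt)
  have eps_0: "\<epsilon> h = 0 \<longleftrightarrow> h \<in> T_op ` invariants" if h: "h \<in> invariants" for h
  proof
    assume e: "\<epsilon> h = 0"
    \<comment> \<open>If the first point is 0, the remaining points satisfy the recursion from its
      start: this is division by \<open>T\<close>.\<close>
    have "\<exists>h'\<in>invariants. pt h' = (\<lambda>n. pt h (Suc n))"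
    proof (rule invariants_ofI)
      show "pt h (Suc 0) + Lpart (pt h (Suc 0)) = 0" using invariants_pt(2)[OF h, of 0] e by (simp add: \<epsilon>_def)
      show "pt h (Suc (Suc n)) + Lpart (pt h (Suc (Suc n))) = frob4 (pt h (Suc n))" for n
        by (rule invariants_pt(2)[OF h])
      show "\<forall>\<^sub>F n in sequentially. ord_ge B (fst (pt h (Suc n))) \<and> ord_ge B (snd (pt h (Suc n)))" for B
        using invariants_pt(3)[OF h, of B] unfolding eventually_sequentially by (meson le_SucI)
    qed
    then obtain h' where h': "h' \<in> invariants" "pt h' = (\<lambda>n. pt h (Suc n))" by blast
    have "h = T_op h'"
      by (rule invariants_eqI[OF h invariants_T[OF h'(1)]])
         (use h'(2) e in \<open>auto simp: pt_T \<epsilon>_def split: nat.splits\<close>)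
    thus "h \<in> T_op ` invariants" using h'(1) by blast
  qed (auto simp: \<epsilon>_def pt_T)
  interpret M: F2T_module invariants T_op \<epsilon>
  proof
    show "h = 0" if "T_op h = 0" for h :: "'c coords"
    proof (rule coords_eqI)
      fix i
      have "fst (T_op h) $ i = 0" "snd (T_op h) $ i = 0" using that by simp_all
      thus "fst h $ i = fst 0 $ i" "snd h $ i = snd 0 $ i" by simp_all
    qed
  qed (auto simp: coords_double invariants_0 invariants_add invariants_T smul_add_right \<epsilon>_def pt_add
      eps_0[unfolded \<epsilon>_def] eps_image[unfolded \<epsilon>_def] fin)
  interpret M: filtered_F2T_module invariants T_op \<epsilon> F
  proof
    show "x + y \<in> F d" if "x \<in> F d" "y \<in> F d" for x y d
      using that U_add by (auto simp: F_def pt_add invariants_add)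
    show "F 0 = {0}"
    proof (intro equalityI subsetI)
      fix h assume h: "h \<in> F 0"
      hence inv: "h \<in> invariants" by (simp add: F_def)
      \<comment> \<open>Once a point is 0, the next one solves the homogeneous equation inside
        \<open>U\<close>, hence is 0 too.\<close>
      have "pt h n = pt 0 n" for n
      proof (induction n)
        case 0
        have "U (pt h 0)" using h by (simp add: F_def)
        from U_unique[OF this invariants_pt(1)[OF inv]] show ?case by simp
      next
        case (Suc n)
        hence "pt h (Suc n) + Lpart (pt h (Suc n)) = 0" using invariants_pt(2)[OF inv, of n] by simp
        moreover have "U (pt h (Suc n))" using h by (simp add: F_def)
        ultimately show ?case using U_unique by simp
      qed
      thus "h \<in> {0}" using invariants_eqI[OF inv invariants_0] by simp
    qed (auto simp: F_def invariants_0 U_0)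
    show "F d \<subseteq> F (Suc d)" for d by (auto simp: F_def)
    show "T_op x \<in> F (Suc d) \<longleftrightarrow> x \<in> F d" if "x \<in> invariants" for x d
    proof -
      have "(\<forall>n\<ge>Suc d. U (pt (T_op x) n)) \<longleftrightarrow> (\<forall>n\<ge>d. U (pt x n))"
        by (auto simp: pt_T split: nat.splits)
      thus ?thesis using that by (simp add: F_def invariants_T)
    qed
    show "invariants = (\<Union>d. F d)"
    proof (intro equalityI subsetI)
      fix h assume h: "h \<in> invariants"
      from invariants_pt(3)[OF h, of "max \<xi> \<eta> + 1"] obtain N where
        N: "\<And>n. n \<ge> N \<Longrightarrow> ord_ge (max \<xi> \<eta> + 1) (fst (pt h n)) \<and> ord_ge (max \<xi> \<eta> + 1) (snd (pt h n))"
        unfolding eventually_sequentially by blast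
      have "U (pt h n)" if "n \<ge> N" for n
        using N[OF that] unfolding U_def pair_ge_def
        by (intro exI[of _ 1]) (auto elim: ord_ge_mono)
      thus "h \<in> (\<Union>d. F d)" using h by (auto simp: F_def)
    qed (auto simp: F_def)
  qed
  have M': "F2T_module invariants T_op \<epsilon>" by unfold_locales
  \<comment> \<open>\<open>h1\<close> is a definite description, so no other number may be the size
    of a basis.\<close>
  have unique: "n = r" if b: "is_H1_basis ord \<theta> A n b" for n b
  proof -
    have "\<exists>\<beta>. \<forall>i. i < n \<longrightarrow> \<beta> i \<in> invariants \<and> b i = tensor_of (\<beta> i)"
    proof (intro choice allI)
      fix i
      show "\<exists>h. i < n \<longrightarrow> h \<in> invariants \<and> b i = tensor_of h"
      proof (cases "i < n")
        case True
        hence "b i \<in> tensor_of ` invariants" using b by (auto simp: is_H1_basis_def H1_eq)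
        thus ?thesis by blast
      qed simp
    qed
    then obtain \<beta> where \<beta>: "\<And>i. i < n \<Longrightarrow> \<beta> i \<in> invariants" "\<And>i. i < n \<Longrightarrow> b i = tensor_of (\<beta> i)" by blast
    have "M.is_basis {..<n} \<beta>" by (rule iffD1[OF is_H1_basis_iff_is_basis[OF M' \<beta>] b])
    from M.basis_card[OF this] have "(2::nat) ^ n = 2 ^ r" by (simp only: eps_image card card_lessThan)
    thus ?thesis by simp
  qed
  moreover have "\<exists>b. is_H1_basis ord \<theta> A r b"
  proof -
    obtain I and \<beta> :: "nat \<times> 'c coords \<Rightarrow> 'c coords" where I: "M.is_basis I \<beta>" using M.basis_exists by blast
    have "finite I" and "(2::nat) ^ card I = 2 ^ r"
      using M.basis_card[OF I] by (simp_all only: eps_image card)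
    hence "card I = r" by simp
    then obtain e where e: "bij_betw e {..<r} I"
      using \<open>finite I\<close> ex_bij_betw_nat_finite[of I] by (auto simp: atLeast0LessThan)
    have B: "M.is_basis {..<r} (\<beta> \<circ> e)" by (rule M.is_basis_reindex[OF e I])
    hence inv: "(\<beta> \<circ> e) i \<in> invariants" if "i < r" for i using that by (auto simp: M.is_basis_def)
    have "is_H1_basis ord \<theta> A r (\<lambda>i. tensor_of ((\<beta> \<circ> e) i))"
      by (rule iffD2[OF is_H1_basis_iff_is_basis[OF M' inv refl] B])
    thus ?thesis by blast
  qed
  ultimately show ?thesis unfolding h1_def by (intro the_equality) auto
qed

end


section \<open>Solutions of the recursion\<close>

locale prop_8_3 = t_motive ord \<theta> A
  for ord :: "'c::field \<Rightarrow> ereal" and \<theta> and A :: "'c ^ 2 ^ 2" +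
  fixes a11 a12 a21 :: 'c and v :: real
  assumes A: "A $ 1 $ 1 = a11" "A $ 1 $ 2 = a12" "A $ 2 $ 1 = a21" "A $ 2 $ 2 = 0"
    and ord_a11: "ord a11 = -1" and ord_a21: "ord a21 = ereal v"
    and ord_a12: "ord_ge (- 2 * v - 3) a12"
    and v_gt: "- (4 / 3) < v" and v_less: "v < - (1 / 3)"
begin

section \<open>Orders of the constants and the polydisc\<close>

lemma ord_theta_real: "ord \<theta> = ereal (- 1)"
  using ord_theta by (simp add: one_ereal_def)

lemma ord_theta2: "ord (\<theta> ^ 2) = ereal (- 2)"
  using ord_power[OF ord_theta_real, of 2] by simp

lemma theta2_ge: "ord_ge (- 2) (\<theta> ^ 2)"
  by (rule ord_geI[OF ord_theta2]) simp

lemma a11_ge: "ord_ge (- 1) a11"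
  using ord_a11 by (simp add: ord_ge_def one_ereal_def)

lemma a21_ge: "ord_ge v a21"
  by (rule ord_geI[OF ord_a21]) simp

lemma nonzero [simp]: "\<theta> \<noteq> 0" "a21 \<noteq> 0"
  using ord_theta_real ord_a21 by (auto simp: ord_zero)

text \<open>The radii of the polydisc on which \<open>Lpart\<close> is contracting.\<close>

definition \<xi> :: real where "\<xi> = max 1 (2 + v)"
definition \<eta> :: real where "\<eta> = (\<xi> - v) / 2"

text \<open>One condition for each monomial of \<open>Lpart\<close>: \<open>\<xi> \<ge> 1\<close>
  for the two powers of \<open>x\<close> in the first coordinate,
  \<open>2 * \<eta> + v = \<xi>\<close> for \<open>a21 * y ^ 2\<close>,
  \<open>3 * \<eta> \<ge> 2\<close> for \<open>\<theta> ^ 2 * y ^ 4\<close>, and the next one for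
  \<open>a12 * x ^ 2\<close>. The remaining facts serve to place fourth powers in the
  polydisc.\<close>

lemma radii: "\<xi> \<ge> 1" "2 * \<eta> + v = \<xi>" "3 * \<eta> \<ge> 2" "2 * \<xi> - 2 * v - 3 \<ge> \<eta>" "\<xi> < 2" "\<eta> < - 2 * v \<or> v \<ge> - (1 / 2)"
  "v \<ge> - 1 \<Longrightarrow> \<eta> = 1"
  using v_gt v_less by (auto simp: \<xi>_def \<eta>_def max_def field_simps)

text \<open>All monomials of \<open>Lpart\<close> have degree at least 2, which doubles the depth;
  \<open>radii\<close> accounts for the orders of the coefficients.\<close>

lemma Lpart_contracting:
  assumes "\<rho> \<ge> 0" "pair_ge \<xi> \<eta> \<rho> z"
  shows "pair_ge \<xi> \<eta> (2 * \<rho>) (Lpart z)"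
proof -
  have x: "ord_ge (\<xi> + \<rho>) (fst z)" and y: "ord_ge (\<eta> + \<rho>) (snd z)"
    using assms(2) by (simp_all add: pair_ge_def)
  show ?thesis
    unfolding pair_ge_def Lpart_def A fst_conv snd_conv mult_zero_left add_0_right
    using radii assms(1)
    by (intro conjI ord_ge_add ord_ge_mult'[OF theta2_ge ord_ge_power[OF x]] ord_ge_mult'[OF a11_ge ord_ge_power[OF x]]
      ord_ge_mult'[OF a21_ge ord_ge_power[OF y]] ord_ge_mult'[OF theta2_ge ord_ge_power[OF y]]
      ord_ge_mult'[OF ord_a12 ord_ge_power[OF x]]) simp_all
qed

lemma ord_ge_limit:
  assumes "\<And>n::nat. ord_ge (c - m / 2 ^ n) x"
  shows "ord_ge c x"
proof (rule ccontr)
  assume "\<not> ord_ge c x"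
  then obtain s where s: "s < c" "ord x = ereal s" using not_ord_geD by blast
  obtain n :: nat where n: "\<bar>m\<bar> / (c - s) < 2 ^ n" using real_arch_pow[of 2] by auto
  have "\<bar>m\<bar> / 2 ^ n < c - s" using n s(1) by (simp add: field_simps)
  moreover have "m / 2 ^ n \<le> \<bar>m\<bar> / 2 ^ n" by (simp add: divide_right_mono)
  ultimately have "c - m / 2 ^ n > s" by linarith
  thus False using assms[of n] s(2) by (simp add: ord_ge_def)
qed

text \<open>At the radii \<open>1/2\<close> and \<open>-v/2\<close> the terms \<open>\<theta>\<^sup>2 x\<^sup>4\<close> and \<open>\<theta>\<^sup>2 y\<^sup>4\<close> dominate: after rescaling, the
  two equations are monic with integral coefficients, so that their solutions are integral.\<close>

lemma solution_bound:
  assumes eq: "z + Lpart z = r" and r: "ord_ge 0 (fst r)" "ord_ge (- 2 * v - 2) (snd r)"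
  shows "ord_ge (1 / 2) (fst z)" "ord_ge (- v / 2) (snd z)"
proof -
  define x y where "x = fst z" and "y = snd z"
  have eq1: "\<theta> ^ 2 * x ^ 4 = x + a11 * x ^ 2 + a21 * y ^ 2 + fst r"
    and eq2: "\<theta> ^ 2 * y ^ 4 = y + a12 * x ^ 2 + snd r"
    unfolding eq[symmetric] x_def y_def by (simp_all add: Lpart_def A ac_simps)
  \<comment> \<open>\<open>m\<close> is the defect from the claimed bounds; bounding the fourth
    power in each equation by the other terms halves it.\<close>
  have step: "ord_ge (1 / 2 - m / 2) x \<and> ord_ge (- v / 2 - m / 2) y"
    if m: "m \<ge> 0" "ord_ge (1 / 2 - m) x" "ord_ge (- v / 2 - m) y" for m
  proof -
    have "ord_ge (- 2 * m) (\<theta> ^ 2 * x ^ 4)"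
      unfolding eq1 using m(1)
      by (intro ord_ge_add ord_ge_mono[OF m(2)] ord_ge_mono[OF r(1)] ord_ge_mult'[OF a11_ge ord_ge_power[OF m(2)]]
        ord_ge_mult'[OF a21_ge ord_ge_power[OF m(3)]]) simp_all
    hence "ord_ge (1 / 2 - m / 2) x"
      by (rule ord_ge_mono[OF ord_ge_powerD[OF ord_ge_multD[OF _ ord_theta2]]]) (simp_all add: field_simps)
    moreover
    \<comment> \<open>The linear term \<open>y\<close> satisfies this bound because
      \<open>v > - (4 / 3)\<close>.\<close>
    have "ord_ge (- 2 * v - 2 - 2 * m) (\<theta> ^ 2 * y ^ 4)"
      unfolding eq2 using m(1) v_gt
      by (intro ord_ge_add ord_ge_mono[OF m(3)] ord_ge_mono[OF r(2)] ord_ge_mult'[OF ord_a12 ord_ge_power[OF m(2)]])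
        (simp_all add: field_simps)
    hence "ord_ge (- v / 2 - m / 2) y"
      by (rule ord_ge_mono[OF ord_ge_powerD[OF ord_ge_multD[OF _ ord_theta2]]]) (simp_all add: field_simps)
    ultimately show ?thesis ..
  qed
  obtain c d where cd: "ord_ge c x" "ord_ge d y" using ord_ge_exists by meson
  define m where "m = max 0 (max (1 / 2 - c) (- v / 2 - d))"
  have m: "m \<ge> 0" "ord_ge (1 / 2 - m) x" "ord_ge (- v / 2 - m) y"
    using cd by (auto simp: m_def elim!: ord_ge_mono)
  have "ord_ge (1 / 2 - m / 2 ^ n) x \<and> ord_ge (- v / 2 - m / 2 ^ n) y" for n
  proof (induction n)
    case (Suc n)
    thus ?case using step[of "m / 2 ^ n"] m(1) by (simp add: mult.commute)
  qed (use m in simp)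
  thus "ord_ge (1 / 2) (fst z)" "ord_ge (- v / 2) (snd z)"
    using ord_ge_limit[of "1 / 2" m x] ord_ge_limit[of "- v / 2" m y] by (auto simp: x_def y_def)
qed


section \<open>Elimination of the second coordinate\<close>

text \<open>Eliminating \<open>y\<close> from \<open>(x, y) + L (x, y) = r\<close>, by means of the first equation in the square of
  the second, leaves an additive polynomial equation of degree 16 for \<open>x\<close>.\<close>

definition elim_coeff :: "nat \<Rightarrow> 'c"
  where "elim_coeff k = [a21 ^ 3 * inverse \<theta> ^ 12, a11 * a21 ^ 3 * inverse \<theta> ^ 12,
    a21 ^ 3 * inverse \<theta> ^ 10 + inverse \<theta> ^ 8 + a12 ^ 2 * a21 ^ 4 * inverse \<theta> ^ 12,
    a11 ^ 4 * inverse \<theta> ^ 8, 1] ! k"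

text \<open>The squared second equation is multiplied by
  \<open>a21 ^ 4 * inverse \<theta> ^ 12\<close>, which makes the result monic in
  \<open>x\<close>.\<close>

definition elim_rhs :: "'c \<times> 'c \<Rightarrow> 'c"
  where "elim_rhs r = a21 ^ 3 * inverse \<theta> ^ 12 * fst r + inverse \<theta> ^ 8 * fst r ^ 4
    + a21 ^ 4 * inverse \<theta> ^ 12 * snd r ^ 2"

lemma elim_poly: "apoly elim_coeff 4 x = a21 ^ 3 * inverse \<theta> ^ 12 * x + a11 * a21 ^ 3 * inverse \<theta> ^ 12 * x ^ 2
    + (a21 ^ 3 * inverse \<theta> ^ 10 + inverse \<theta> ^ 8 + a12 ^ 2 * a21 ^ 4 * inverse \<theta> ^ 12) * x ^ 4
    + a11 ^ 4 * inverse \<theta> ^ 8 * x ^ 8 + x ^ 16"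
  by (simp add: apoly_def elim_coeff_def eval_nat_numeral)

text \<open>Squaring the second equation loses nothing, as an element vanishes when its square does.
  The square contains \<open>y\<close> only through \<open>y ^ 2\<close> and \<open>y ^ 8\<close>,
  which the first equation expresses by \<open>x\<close>.\<close>

lemma eliminate:
  "z + Lpart z = r \<longleftrightarrow>
    a21 * snd z ^ 2 = fst r + fst z + \<theta> ^ 2 * fst z ^ 4 + a11 * fst z ^ 2 \<and>
    apoly elim_coeff 4 (fst z) = elim_rhs r" (is "_ \<longleftrightarrow> ?E1 \<and> ?E2")
proof -
  define x y i where "x = fst z" and "y = snd z" and "i = inverse \<theta>"
  define w where "w = fst r + x + \<theta> ^ 2 * x ^ 4 + a11 * x ^ 2"
  have \<theta>i: "\<theta> * i = 1" by (simp add: i_def)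
  hence \<theta>ip: "\<theta> ^ n * i ^ n = 1" for n by (metis power_mult_distrib power_one)
  have "\<theta> ^ 2 * i ^ 12 = (\<theta> ^ 2 * i ^ 2) * i ^ 10" "\<theta> ^ 4 * i ^ 12 = (\<theta> ^ 4 * i ^ 4) * i ^ 8"
    unfolding mult.assoc by (simp_all flip: power_add)
  hence p1: "\<theta> ^ 2 * i ^ 12 = i ^ 10" "\<theta> ^ 4 * i ^ 12 = i ^ 8" "\<theta> ^ 8 * i ^ 8 = 1"
    by (simp_all add: \<theta>ip)
  have "z + Lpart z = r \<longleftrightarrow> a21 * y ^ 2 = w \<and> y + \<theta> ^ 2 * y ^ 4 + a12 * x ^ 2 + snd r = 0"
  proof -
    have "x + (\<theta> ^ 2 * x ^ 4 + a11 * x ^ 2 + a21 * y ^ 2) = fst r \<longleftrightarrow> a21 * y ^ 2 = w"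
      using char2_eq_iff[of "a21 * y ^ 2" "x + \<theta> ^ 2 * x ^ 4 + a11 * x ^ 2" "fst r"]
      by (simp only: w_def ac_simps)
    moreover have "y + (\<theta> ^ 2 * y ^ 4 + a12 * x ^ 2) = snd r \<longleftrightarrow> y + \<theta> ^ 2 * y ^ 4 + a12 * x ^ 2 + snd r = 0"
      by (simp only: char2_eq_iff[of _ "snd r" 0] add.assoc[symmetric] add_0_right)
    ultimately show ?thesis by (simp add: prod_eq_iff Lpart_def A x_def y_def)
  qed
  also have "\<dots> \<longleftrightarrow> a21 * y ^ 2 = w \<and> apoly elim_coeff 4 x = elim_rhs r"
  proof (rule conj_cong[OF refl])
    assume w: "a21 * y ^ 2 = w"
    let ?q = "y + \<theta> ^ 2 * y ^ 4 + a12 * x ^ 2 + snd r"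
    have w4: "w ^ 4 = fst r ^ 4 + x ^ 4 + \<theta> ^ 8 * x ^ 16 + a11 ^ 4 * x ^ 8"
      unfolding w_def fourth_power_add power_mult_distrib by (simp flip: power_mult)
    have w4': "a21 ^ 4 * y ^ 8 = w ^ 4"
      unfolding w[symmetric] power_mult_distrib by (simp flip: power_mult)
    have q2: "?q ^ 2 = y ^ 2 + \<theta> ^ 4 * y ^ 8 + a12 ^ 2 * x ^ 4 + snd r ^ 2"
      unfolding square_add power_mult_distrib by (simp flip: power_mult)
    have "a21 ^ 4 * i ^ 12 * ?q ^ 2 = a21 ^ 3 * i ^ 12 * (a21 * y ^ 2) + (\<theta> ^ 4 * i ^ 12) * (a21 ^ 4 * y ^ 8)
        + a12 ^ 2 * a21 ^ 4 * i ^ 12 * x ^ 4 + a21 ^ 4 * i ^ 12 * snd r ^ 2"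
      unfolding q2 by (simp add: algebra_simps eval_nat_numeral)
    also have "\<dots> = a21 ^ 3 * i ^ 12 * w + i ^ 8 * w ^ 4
        + a12 ^ 2 * a21 ^ 4 * i ^ 12 * x ^ 4 + a21 ^ 4 * i ^ 12 * snd r ^ 2"
      unfolding w w4' p1 ..
    also have "\<dots> = a21 ^ 3 * i ^ 12 * (fst r + x + a11 * x ^ 2) + a21 ^ 3 * (\<theta> ^ 2 * i ^ 12) * x ^ 4
        + i ^ 8 * (fst r ^ 4 + x ^ 4 + a11 ^ 4 * x ^ 8) + (\<theta> ^ 8 * i ^ 8) * x ^ 16
        + a12 ^ 2 * a21 ^ 4 * i ^ 12 * x ^ 4 + a21 ^ 4 * i ^ 12 * snd r ^ 2"
      unfolding w4 by (simp add: w_def distrib_left distrib_right ac_simps)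
    also have "\<dots> = apoly elim_coeff 4 x + elim_rhs r"
      unfolding p1 elim_poly elim_rhs_def i_def[symmetric] by (simp add: distrib_left distrib_right ac_simps)
    finally have *: "a21 ^ 4 * i ^ 12 * ?q ^ 2 = apoly elim_coeff 4 x + elim_rhs r" .
    have "?q = 0 \<longleftrightarrow> a21 ^ 4 * i ^ 12 * ?q ^ 2 = 0" by (simp add: i_def)
    also have "\<dots> \<longleftrightarrow> apoly elim_coeff 4 x = elim_rhs r" unfolding * by (simp add: char2_eq_iff)
    finally show "?q = 0 \<longleftrightarrow> apoly elim_coeff 4 x = elim_rhs r" .
  qed
  finally show ?thesis by (simp add: w_def x_def y_def)
qed

lemma elim_coeff_ends: "elim_coeff 0 \<noteq> 0" "elim_coeff 4 = 1"
  by (simp_all add: elim_coeff_def)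

lemmas elim_poly_theory = apoly_surj_and_kernel[of elim_coeff 4, OF elim_coeff_ends]

lemma solution_of_elim_poly:
  assumes "apoly elim_coeff 4 x = elim_rhs r"
  shows "\<exists>y. (x, y) + Lpart (x, y) = r"
proof -
  obtain y where "y ^ 2 = (fst r + x + \<theta> ^ 2 * x ^ 4 + a11 * x ^ 2) / a21" using square_root_exists by blast
  hence "a21 * y ^ 2 = fst r + x + \<theta> ^ 2 * x ^ 4 + a11 * x ^ 2" by simp
  hence "(x, y) + Lpart (x, y) = r" unfolding eliminate using assms by simp
  thus ?thesis ..
qed

text \<open>Given \<open>x\<close>, the first equation fixes \<open>y ^ 2\<close>, and square roots
  are unique in characteristic 2; so the solutions correspond to the roots of the additive
  polynomial in \<open>x\<close>.\<close>

lemma kernel_card: "finite {z. z + Lpart z = 0} \<and> card {z. z + Lpart z = 0} = 2 ^ 4"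
proof -
  have rhs0: "elim_rhs 0 = 0" by (simp add: elim_rhs_def)
  have "bij_betw fst {z. z + Lpart z = 0} {x. apoly elim_coeff 4 x = 0}"
    unfolding bij_betw_def
  proof
    show "inj_on fst {z. z + Lpart z = 0}"
    proof (rule inj_onI)
      fix z z' assume z: "z \<in> {z. z + Lpart z = 0}" "z' \<in> {z. z + Lpart z = 0}" and f: "fst z = fst z'"
      have "a21 * snd z ^ 2 = a21 * snd z' ^ 2" using z f by (simp add: eliminate)
      hence "snd z ^ 2 = snd z' ^ 2" by simp
      hence "snd z = snd z'" by (simp only: square_inj)
      thus "z = z'" using f by (simp add: prod_eq_iff)
    qed
    show "fst ` {z. z + Lpart z = 0} = {x. apoly elim_coeff 4 x = 0}"
    proof (intro equalityI subsetI)
      fix x assume "x \<in> {x. apoly elim_coeff 4 x = 0}"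
      then obtain y where "(x, y) + Lpart (x, y) = 0" using solution_of_elim_poly[of x 0] rhs0 by auto
      thus "x \<in> fst ` {z. z + Lpart z = 0}" by (force intro: rev_image_eqI)
    qed (auto simp: eliminate rhs0)
  qed
  from bij_betw_finite[OF this] bij_betw_same_card[OF this] show ?thesis
    using elim_poly_theory by simp
qed

lemma kernel_lift:
  assumes z: "z + Lpart z = 0"
  shows "\<exists>w. w + Lpart w = frob4 z \<and> (\<exists>\<rho>>0. pair_ge \<xi> \<eta> \<rho> (frob4 w))"
proof -
  have "ord_ge (1 / 2) (fst z)" "ord_ge (- v / 2) (snd z)" using solution_bound[OF z] by simp_all
  from this[THEN ord_ge_power, of 4] have z4: "ord_ge 2 (fst (frob4 z))" "ord_ge (- 2 * v) (snd (frob4 z))"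
    by (simp_all add: frob4_def)
  show ?thesis
  proof (cases "v < - (1 / 2)")
    case True
    \<comment> \<open>The margin by which the bounds \<open>2\<close> and \<open>- 2 * v\<close> for
      the fourth powers exceed the radii.\<close>
    define \<rho> where "\<rho> = min (2 - \<xi>) (- 2 * v - \<eta>)"
    have \<rho>: "\<rho> > 0" using True radii by (auto simp: \<rho>_def)
    have "pair_ge \<xi> \<eta> \<rho> (frob4 z)"
      using z4 by (auto simp: pair_ge_def \<rho>_def elim!: ord_ge_mono)
    from hensel[of Lpart \<xi> \<eta>, OF Lpart_add Lpart_contracting \<rho> this] obtain w
      where w: "pair_ge \<xi> \<eta> \<rho> w" "w + Lpart w = frob4 z" by blast
    have "\<xi> + \<rho> \<le> real 4 * (\<xi> + \<rho>)" "\<eta> + \<rho> \<le> real 4 * (\<eta> + \<rho>)" using radii \<rho> by simp_all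
    hence "pair_ge \<xi> \<eta> \<rho> (frob4 w)" using w(1) unfolding pair_ge_def frob4_def
      by (auto intro: ord_ge_power')
    thus ?thesis using w(2) \<rho> by blast
  next
    case False
    have i: "ord (inverse \<theta>) = ereal 1" using ord_inverse[OF ord_theta_real] by simp
    have i': "ord_ge (real n) (inverse \<theta> ^ n)" for n
      by (rule ord_geI[OF ord_power[OF i]]) simp
    have b: "ord_ge (real n * v) (a21 ^ n)" for n by (rule ord_geI[OF ord_power[OF ord_a21]]) simp
    \<comment> \<open>The last term gives \<open>4 * v + 12 + 2 * (- 2 * v) = 12\<close>; the first
      gives \<open>3 * v + 14\<close>, which is larger here.\<close>
    have "ord_ge 12 (elim_rhs (frob4 z))"
      unfolding elim_rhs_def using False
      by (intro ord_ge_add ord_ge_mult'[OF ord_ge_mult[OF b i'] z4(1)] ord_ge_mult'[OF i' ord_ge_power[OF z4(1)]]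
        ord_ge_mult'[OF ord_ge_mult[OF b i'] ord_ge_power[OF z4(2)]]) simp_all
    then obtain x where x: "apoly elim_coeff 4 x = elim_rhs (frob4 z)" "ord_ge (12 / 2 ^ 4) x"
      using elim_poly_theory by blast
    then obtain y where w: "(x, y) + Lpart (x, y) = frob4 z" using solution_of_elim_poly by blast
    have x': "ord_ge (3 / 4) x" using x(2) by simp
    have "ord_ge (- v / 2) (snd (x, y))"
      by (rule solution_bound(2)[OF w ord_ge_mono[OF z4(1)] ord_ge_mono[OF z4(2)]]) simp_all
    hence y': "ord_ge (- v / 2) y" by simp
    \<comment> \<open>The bound \<open>- v / 2\<close> for \<open>y\<close> is improved by means of
      the better bound \<open>3 / 4\<close> for \<open>x\<close>.\<close>
    have "\<theta> ^ 2 * y ^ 4 = y + a12 * x ^ 2 + snd (frob4 z)"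
      unfolding w[symmetric] by (simp add: Lpart_def A ac_simps)
    moreover have "ord_ge (- 2 * v - 3 / 2) (y + a12 * x ^ 2 + snd (frob4 z))"
      using False
      by (intro ord_ge_add ord_ge_mono[OF y'] ord_ge_mult'[OF ord_a12 ord_ge_power[OF x']] ord_ge_mono[OF z4(2)])
        simp_all
    ultimately have "ord_ge (- 2 * v - 3 / 2) (\<theta> ^ 2 * y ^ 4)" by (simp only:)
    hence "ord_ge (1 / 2 - 2 * v) (y ^ 4)"
      by (rule ord_ge_mono[OF ord_ge_multD[OF _ ord_theta2]]) simp
    moreover have "ord_ge 3 (x ^ 4)" using ord_ge_power[OF x', of 4] by simp
    moreover define \<rho> where "\<rho> = min (3 - \<xi>) (1 / 2 - 2 * v - \<eta>)"
    ultimately have "pair_ge \<xi> \<eta> \<rho> (frob4 (x, y))"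
      by (auto simp: pair_ge_def frob4_def elim!: ord_ge_mono)
    \<comment> \<open>In this case \<open>\<eta>\<close> is 1, and \<open>v < - (1 / 3)\<close>
      makes \<open>1 / 2 - 2 * v\<close> larger than 1.\<close>
    moreover have "\<rho> > 0" using radii(5,7) False v_less by (auto simp: \<rho>_def)
    ultimately show ?thesis using w by blast
  qed
qed

theorem h1_eq_4: "h1 ord \<theta> A = 4"
proof (rule h1_eqI[where \<xi> = \<xi> and \<eta> = \<eta>])
  show "\<xi> \<ge> 0" "\<eta> \<ge> 0" using radii by auto
qed (use Lpart_contracting kernel_lift kernel_card in auto)

end

section \<open>From the condition on \<open>t\<close> to the bound on \<open>a12\<close>\<close>

theorem proposition8p3:
  fixes ord :: "'c::field \<Rightarrow> ereal" and \<theta> a11 a12 a21 :: 'c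
    and A :: "'c ^ 2 ^ 2" and v :: real and t :: ereal
  assumes "C_infinity ord \<theta>"
    and "A = vector [vector [a11, a12], vector [a21, 0]]"
    and "ord a11 = -1"
    and "a21 \<noteq> 0"
    and "ord a21 = ereal v"
    and "t = ord (\<theta> ^ 2 / a21 + \<theta> ^ 4 / a21 ^ 4 - a12 ^ 2)"
    and "- (4 / 3) < v" and "v < - (1 / 3)"
    and "t \<ge> ereal (- 4 * v - 6)"
  shows "h1 ord \<theta> A = 4"
proof -
  interpret C_infinity ord \<theta> by (rule assms(1))
  let ?q = "\<theta> ^ 2 / a21 + \<theta> ^ 4 / a21 ^ 4 - a12 ^ 2"
  have \<theta>: "ord \<theta> = ereal (- 1)" using ord_theta by (simp add: one_ereal_def)
  \<comment> \<open>The first two summands of \<open>?q\<close> satisfy the bound by themselves,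
    this one because \<open>v > - (4 / 3)\<close>; hence so does \<open>a12 ^ 2\<close>.\<close>
  have "ord_ge (- 4 * v - 6) (\<theta> ^ 2 / a21)"
    by (rule ord_geI[OF ord_divide[OF ord_power[OF \<theta>] assms(5)]]) (use assms(7) in simp)
  moreover have "ord_ge (- 4 * v - 6) (\<theta> ^ 4 / a21 ^ 4)"
    by (rule ord_geI[OF ord_divide[OF ord_power[OF \<theta>] ord_power[OF assms(5)]]]) simp
  moreover have "ord_ge (- 4 * v - 6) ?q" using assms(6,9) by (simp only: ord_ge_def)
  ultimately have "ord_ge (- 4 * v - 6) (\<theta> ^ 2 / a21 + \<theta> ^ 4 / a21 ^ 4 + ?q)"
    by (intro ord_ge_add)
  hence "ord_ge (- 4 * v - 6) (a12 ^ 2)" by (simp add: ac_simps)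
  hence "ord_ge (- 2 * v - 3) a12" by (rule ord_ge_mono[OF ord_ge_powerD]) simp_all
  then interpret prop_8_3 ord \<theta> A a11 a12 a21 v
    using assms by unfold_locales simp_all
  show ?thesis by (rule h1_eq_4)
qed

end
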